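(* Let $q>0$, $k>0$, let $u_+\ge 0$ and $s>u_+$ satisfy $2qs<(s-u_+)^2$, and set $u_*=2s-u_+$ and $u_-=s+\sqrt{s^2-2qs+u_+^2-2su_+}$. Let $\varphi$ be an ignition function satisfying $\varphi=0$ in a neighborhood of $u_+$ and $\varphi=1$ in a neighborhood of $[u_-,u_*]$ (in particular, $\varphi$ may be a step function equal to $0$ below and $1$ above some $u_i$ with $u_->u_i>u_+$). Then the Lopatinski determinant $D_{ZND}$ of the corresponding strong ZND detonation of Majda's model is given, for $\Re\lambda\ge 0$ and up to multiplication by a nonvanishing analytic function of $\lambda$, by $$D_{ZND}(\lambda)=\bigl((u_*-u_+)\lambda+(u_*-u_+-q-qk\Psi)k\bigr)\left(\frac{\lambda}{k+\lambda}\right),$$ where $$\Psi=\Psi(\lambda):=\int_{-\infty}^{0}e^{-\int_y^0P(\eta)\,d\eta}\ \frac{e^{\frac{k+\lambda}{s}y}}{\sqrt{s^2-2qs(1-e^{(k/s)y})+u_+^2-2su_+}}\,dy,$$ $$P(\xi):=\frac{\lambda}{\sqrt{s^2-2qs(1-e^{(k/s)\xi})+u_+^2-2su_+}}.$$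
   Context: **Model.** The inviscid Majda model is $$(u+qz)_t+\left(\tfrac{u^2}{2}\right)_x=0,\qquad z_t+k\varphi(u)z=0,$$ with $u\ge 0$ a lumped gas-dynamical variable, $z$ the reactant mass fraction, $q$ the heat release, $k>0$ the reaction rate, and $\varphi$ the ignition function. **Strong detonation.** A strong ZND detonation is a weak (distributional) traveling-wave solution $(u,z)(x,t)=(\overline u,\overline z)(\xi)$, $\xi=x-st$, smooth except for a single shock at $\xi=0$, converging to $(u_\pm,z_\pm)$ as $\xi\to\pm\infty$, with $z_-=0$, $z_+=1$, $u_->s>u_+\ge 0$, and (for a step-type ignition function) $u_->u_i>u_+$; write $u_*:=\overline u(0^-)$. Explicitly, the wave is given by $(\overline u,\overline z)(\xi)=(u_+,1)$ for $\xi>0$ and $$\overline z(\xi)=e^{(k/s)\xi},\qquad \overline u(\xi)=s+\sqrt{s^2-2qs\bigl(1-e^{(k/s)\xi}\bigr)+u_+^2-2su_+}\qquad(\xi<0),$$ where $u_*=2s-u_+$, $u_-=s+\sqrt{s^2-2qs+u_+^2-2su_+}$, $s<u_-<u_*$, and $0<q<\frac{(u_*-s)^2}{2s}$, i.e. $2qs<(s-u_+)^2$. **Eigenvalue equation.** On $\xi<0$, with $\overline W=(\overline u,\overline z)^T$, put $$A=\begin{pmatrix}\overline u-s&0\\0&-s\end{pmatrix},\qquad E=\begin{pmatrix}qk\,d\varphi(\overline u)\overline z& qk\varphi(\overline u)\\-k\,d\varphi(\overline u)\overline z&-k\varphi(\overline u)\end{pmatrix},$$ where $d\varphi$ is the derivative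 of $\varphi$. Under the assumptions on $\varphi$, on $\xi<0$ one has $\varphi(\overline u)=1$ and $d\varphi(\overline u)=0$. The eigenvalue equation, linearized about the wave and written in the variable $Z=A\,(u,z)^T$, is $$Z'=G Z,\qquad G=(E-\lambda I)A^{-1},\qquad '=\partial_\xi .$$ **Lopatinski determinant.** For $\Re\lambda\ge 0$, $$D_{ZND}(\lambda):=\det\bigl(Z^-(\lambda,0),\ \lambda[\overline W]-[A\overline W']\bigr),$$ where $[h]:=h(0^+)-h(0^-)$ and $Z^-(\lambda,\xi)$ is a nontrivial solution on $\xi<0$ (with $Z^-(\lambda,0)$ its value at $\xi=0^-$) of $Z'=GZ$ that decays exponentially as $\xi\to-\infty$, chosen to depend analytically on $\lambda$ (on an open neighborhood of $\{\Re\lambda\ge0\}$), and tangent as $\xi\to-\infty$ to the subspace of exponentially decaying solutions of the limiting constant-coefficient system $Z'=G_-Z$, $G_-=\lim_{\xi\to-\infty}G$. $Z^-$, and hence $D_{ZND}$, is determined only up to multiplication by an analytic factor that does not vanish on $\{\Re\lambda\ge0\}$. *)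

theory Defs
  imports "HOL-Analysis.Analysis"
begin

section \<open>Weak solutions of the inviscid Majda model\<close>

text \<open>
  Points of the plane are pairs \<open>(x, t)\<close>.  The test functions are the compactly supported
  functions of class \<open>C\<^sup>1\<close>; for first-order equations with locally bounded
  coefficients they define the same weak solutions as the \<open>C\<^sup>\<infinity>\<close> ones.
\<close>

definition test_function ::
  "(real \<times> real \<Rightarrow> real) \<Rightarrow> (real \<times> real \<Rightarrow> real) \<Rightarrow> (real \<times> real \<Rightarrow> real) \<Rightarrow> bool"
  where
  "test_function \<psi> \<psi>x \<psi>t \<longleftrightarrow>
     compact (closure {p. \<psi> p \<noteq> 0}) \<and>
     (\<forall>p. (\<psi> has_derivative (\<lambda>h. fst h * \<psi>x p + snd h * \<psi>t p)) (at p)) \<and>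
     continuous_on UNIV \<psi>x \<and> continuous_on UNIV \<psi>t"

text \<open>
  \<open>has_bochner_integral\<close> is used rather than an equation between integrals, because the
  integral of a non-integrable function is \<open>0\<close> by convention.
\<close>

definition majda_weak_solution ::
  "real \<Rightarrow> real \<Rightarrow> (real \<Rightarrow> real) \<Rightarrow> (real \<times> real \<Rightarrow> real) \<Rightarrow> (real \<times> real \<Rightarrow> real) \<Rightarrow> bool"
  where
  "majda_weak_solution q k \<phi> u z \<longleftrightarrow>
     (\<forall>\<psi> \<psi>x \<psi>t. test_function \<psi> \<psi>x \<psi>t \<longrightarrow>
        has_bochner_integral lborel
          (\<lambda>p. (u p + q * z p) * \<psi>t p + (u p)\<^sup>2 / 2 * \<psi>x p) 0 \<and>
        has_bochner_integral lborel
          (\<lambda>p. z p * \<psi>t p - k * \<phi> (u p) * z p * \<psi> p) 0)"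


section \<open>Strong detonations\<close>

text \<open>Infinite differentiability; meant for open \<open>S\<close>.\<close>

definition smooth_on :: "real set \<Rightarrow> (real \<Rightarrow> real) \<Rightarrow> bool" where
  "smooth_on S f \<longleftrightarrow> (\<forall>n. \<forall>x\<in>S. (deriv ^^ n) f differentiable (at x))"

text \<open>
  The wave \<open>(u, z)(x, t) = (ub, zb)(x - s t)\<close>.  The values of the profile at the shock \<open>\<xi> = 0\<close>
  itself are irrelevant.
\<close>

definition strong_ZND_detonation ::
  "real \<Rightarrow> real \<Rightarrow> (real \<Rightarrow> real) \<Rightarrow> real \<Rightarrow> real \<Rightarrow> real \<Rightarrow> (real \<Rightarrow> real) \<Rightarrow> (real \<Rightarrow> real) \<Rightarrow> bool"
  where
  "strong_ZND_detonation q k \<phi> s um up ub zb \<longleftrightarrow>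
     um > s \<and> s > up \<and> up \<ge> 0 \<and>
     majda_weak_solution q k \<phi> (\<lambda>(x, t). ub (x - s * t)) (\<lambda>(x, t). zb (x - s * t)) \<and>
     smooth_on {..<0} ub \<and> smooth_on {0<..} ub \<and>
     smooth_on {..<0} zb \<and> smooth_on {0<..} zb \<and>
     (\<exists>l r. ((\<lambda>\<xi>. (ub \<xi>, zb \<xi>)) \<longlongrightarrow> l) (at_left 0) \<and>
            ((\<lambda>\<xi>. (ub \<xi>, zb \<xi>)) \<longlongrightarrow> r) (at_right 0) \<and> l \<noteq> r) \<and>
     (ub \<longlongrightarrow> um) at_bot \<and> (zb \<longlongrightarrow> 0) at_bot \<and>
     (ub \<longlongrightarrow> up) at_top \<and> (zb \<longlongrightarrow> 1) at_top"


section \<open>The eigenvalue equation\<close>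

definition profile :: "(real \<Rightarrow> real) \<Rightarrow> (real \<Rightarrow> real) \<Rightarrow> real \<Rightarrow> complex ^ 2" where
  "profile ub zb \<xi> = vector [of_real (ub \<xi>), of_real (zb \<xi>)]"

definition A_mat :: "real \<Rightarrow> (real \<Rightarrow> real) \<Rightarrow> real \<Rightarrow> complex ^ 2 ^ 2" where
  "A_mat s ub \<xi> = vector [vector [of_real (ub \<xi> - s), 0], vector [0, of_real (- s)]]"

definition E_mat ::
  "real \<Rightarrow> real \<Rightarrow> (real \<Rightarrow> real) \<Rightarrow> (real \<Rightarrow> real) \<Rightarrow> (real \<Rightarrow> real) \<Rightarrow> real \<Rightarrow> complex ^ 2 ^ 2"
  where
  "E_mat q k \<phi> ub zb \<xi> =
     vector [vector [of_real (q * k * deriv \<phi> (ub \<xi>) * zb \<xi>), of_real (q * k * \<phi> (ub \<xi>))],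
             vector [of_real (- k * deriv \<phi> (ub \<xi>) * zb \<xi>), of_real (- k * \<phi> (ub \<xi>))]]"

definition G_mat ::
  "real \<Rightarrow> real \<Rightarrow> (real \<Rightarrow> real) \<Rightarrow> real \<Rightarrow> (real \<Rightarrow> real) \<Rightarrow> (real \<Rightarrow> real) \<Rightarrow>
   complex \<Rightarrow> real \<Rightarrow> complex ^ 2 ^ 2"
  where
  "G_mat q k \<phi> s ub zb lam \<xi> = (E_mat q k \<phi> ub zb \<xi> - mat lam) ** matrix_inv (A_mat s ub \<xi>)"

definition G_minus ::
  "real \<Rightarrow> real \<Rightarrow> (real \<Rightarrow> real) \<Rightarrow> real \<Rightarrow> (real \<Rightarrow> real) \<Rightarrow> (real \<Rightarrow> real) \<Rightarrow>
   complex \<Rightarrow> complex ^ 2 ^ 2"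
  where
  "G_minus q k \<phi> s ub zb lam = Lim at_bot (G_mat q k \<phi> s ub zb lam)"

definition decays_exponentially :: "(real \<Rightarrow> complex ^ 2) \<Rightarrow> bool" where
  "decays_exponentially w \<longleftrightarrow>
     (\<exists>C. \<exists>\<alpha>>0. \<forall>\<^sub>F \<xi> in at_bot. norm (w \<xi>) \<le> C * exp (\<alpha> * \<xi>))"

text \<open>
  The subspace of initial data of the solutions of \<open>w' = M w\<close> that decay at \<open>-\<infinity>\<close>; as the
  system is autonomous, the position at which the data are taken does not matter.
\<close>

definition decaying_subspace :: "complex ^ 2 ^ 2 \<Rightarrow> (complex ^ 2) set" where
  "decaying_subspace M =
     {w 0 | w. (\<forall>\<xi>. (w has_vector_derivative M *v w \<xi>) (at \<xi>)) \<and> decays_exponentially w}"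

text \<open>
  An admissible choice of \<open>Z\<^sup>-\<close>.  \<open>Z lam 0\<close> is the limit of the solution at \<open>0\<^sup>-\<close>.  Being
  \<open>analytic_on\<close> the closed half-plane means being holomorphic on an open neighbourhood
  of it.  Tangency is convergence of the direction of \<open>Z lam \<xi>\<close> to the decaying subspace
  of the limiting system.
\<close>

definition decaying_mode ::
  "real \<Rightarrow> real \<Rightarrow> (real \<Rightarrow> real) \<Rightarrow> real \<Rightarrow> (real \<Rightarrow> real) \<Rightarrow> (real \<Rightarrow> real) \<Rightarrow>
   (complex \<Rightarrow> real \<Rightarrow> complex ^ 2) \<Rightarrow> bool"
  where
  "decaying_mode q k \<phi> s ub zb Z \<longleftrightarrow>
     (\<forall>lam. Re lam \<ge> 0 \<longrightarrow>
        (\<forall>\<xi><0. (Z lam has_vector_derivative G_mat q k \<phi> s ub zb lam \<xi> *v Z lam \<xi>) (at \<xi>)) \<and>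
        (Z lam \<longlongrightarrow> Z lam 0) (at_left 0) \<and>
        (\<exists>\<xi><0. Z lam \<xi> \<noteq> 0) \<and>
        decays_exponentially (Z lam) \<and>
        ((\<lambda>\<xi>. infdist (Z lam \<xi> /\<^sub>R norm (Z lam \<xi>))
                (decaying_subspace (G_minus q k \<phi> s ub zb lam))) \<longlongrightarrow> 0) at_bot) \<and>
     (\<forall>\<xi>\<le>0. \<forall>i. (\<lambda>lam. Z lam \<xi> $ i) analytic_on {lam. Re lam \<ge> 0})"


section \<open>The Lopatinski determinant\<close>

definition jump :: "(real \<Rightarrow> complex ^ 2) \<Rightarrow> complex ^ 2" where
  "jump h = Lim (at_right 0) h - Lim (at_left 0) h"

definition D_ZND ::
  "real \<Rightarrow> (real \<Rightarrow> real) \<Rightarrow> (real \<Rightarrow> real) \<Rightarrow> (complex \<Rightarrow> real \<Rightarrow> complex ^ 2) \<Rightarrow> complex \<Rightarrow> complex"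
  where
  "D_ZND s ub zb Z lam =
     (let b = lam *s jump (profile ub zb)
              - jump (\<lambda>\<xi>. A_mat s ub \<xi> *v vector_derivative (profile ub zb) (at \<xi>))
      in det (transpose (vector [Z lam 0, b])))"

definition znd_root :: "real \<Rightarrow> real \<Rightarrow> real \<Rightarrow> real \<Rightarrow> real \<Rightarrow> real" where
  "znd_root q k s up \<xi> =
     sqrt (s\<^sup>2 - 2 * q * s * (1 - exp (k / s * \<xi>)) + up\<^sup>2 - 2 * s * up)"

definition P_fun :: "real \<Rightarrow> real \<Rightarrow> real \<Rightarrow> real \<Rightarrow> complex \<Rightarrow> real \<Rightarrow> complex" where
  "P_fun q k s up lam \<xi> = lam / of_real (znd_root q k s up \<xi>)"

definition Psi :: "real \<Rightarrow> real \<Rightarrow> real \<Rightarrow> real \<Rightarrow> complex \<Rightarrow> complex" where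
  "Psi q k s up lam =
     integral {..0} (\<lambda>y. exp (- integral {y..0} (P_fun q k s up lam)) *
       (exp ((of_real k + lam) / of_real s * of_real y) / of_real (znd_root q k s up y)))"

end

theory Submission
  imports Defs "HOL-Complex_Analysis.Cauchy_Integral_Formula"
begin

text \<open>
  Testing the weak form with tensor products in the moving frame \<open>\<xi> = x - s t\<close> yields the
  integrated profile equations, also across the shock: \<open>u\<^sup>2 / 2 - s (u + q z)\<close> is constant and
  the increments of \<open>s z\<close> are
  the integrals of \<open>k \<phi>(u) z\<close>.  Ignition is off near \<open>up\<close> and on along the reaction zone, so a continuation
  argument on each side of \<open>0\<close> forces the explicit profile, \<open>u = s + R\<close> and \<open>z = e\<^bsup>k\<xi>/s\<^esup>\<close> for
  \<open>\<xi> < 0\<close>, where \<open>R\<close> is \<open>znd_root\<close>.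

  Along this profile the eigenvalue equation is triangular:
  \<open>Z1' = - (\<lambda> / R) Z1 - (q k / s) Z2\<close> and \<open>Z2' = ((k + \<lambda>) / s) Z2\<close>.  With \<open>h' = 1 / R\<close> and
  \<open>h 0 = 0\<close>, the homogeneous solution \<open>e\<^bsup>-\<lambda>h\<^esup>\<close> of the first equation does not decay, so the decaying
  solution is determined by \<open>C = Z2(0) \<noteq> 0\<close>; an integration by parts gives
  \<open>Z1(0) = - (q k C / (k + \<lambda>)) (1 - \<lambda> \<Psi>)\<close>, and inserting this into the \<open>2 \<times> 2\<close> determinant produces
  the formula with the factor \<open>c = Z2(0)\<close>.
\<close>

section \<open>Weak formulation of scalar equations\<close>

text \<open>The formula is claimed for every wave with the defining properties of a detonation and
  for every admissible \<open>Z\<close>, so neither may be taken explicit from the outset. Two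
  obstacles shape the profile part. Away from \<open>up\<close> and \<open>[um, us]\<close> nothing
  is known about \<open>\<phi>\<close>, not even measurability: integrability of the reaction term
  has to be read off the weak form, and the wave can be followed only while u stays where
  \<open>\<phi>\<close> is known. Moreover the conserved quantity is quadratic in u, so z determines
  u only up to reflection in s. Continuity keeps u on its side of s; only the shock switches sides,
  while z, an indefinite integral, cannot jump there.

  In the spectral part, analyticity is required on a neighbourhood of the closed half-plane. For Re
  \<lambda> \<ge> 0 the integrating factor exp(\<lambda> h) supports decay at minus infinity; for Re
  \<lambda> < 0 it grows and competes with exp(k y / s). The constant \<open>\<delta>\<close> says
  how far to the left half of that rate survives. The wave and an admissible mode are also
  constructed, so that the formula is not about an empty class.\<close>

lemma has_real_derivative_max_square:
  "((\<lambda>x::real. (max 0 x)\<^sup>2) has_real_derivative 2 * max 0 x) (at x)"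
proof -
  consider "x < 0" | "x = 0" | "x > 0" by linarith
  then show ?thesis
  proof cases
    case 1
    show ?thesis
      by (rule has_field_derivative_transform_within_open[of "\<lambda>x. 0" _ x "{..<0}"])
         (use 1 in auto)
  next
    case 2
    have "((\<lambda>h::real. max 0 h) \<longlongrightarrow> max 0 0) (at 0)"
      by (intro tendsto_intros)
    moreover have "(max 0 h)\<^sup>2 / h = max 0 h" for h :: real
      by (simp add: max_def power2_eq_square)
    ultimately show ?thesis
      using 2 by (simp add: DERIV_def)
  next
    case 3
    have "((\<lambda>x::real. x\<^sup>2) has_real_derivative 2 * max 0 x) (at x)"
      using 3 by (auto intro!: derivative_eq_intros)
    then show ?thesis
      by (rule has_field_derivative_transform_within_open[of "\<lambda>x. x\<^sup>2" _ x "{0<..}"])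
         (use 3 in auto)
  qed
qed

section \<open>Piecewise quadratic cutoff functions of class C^1\<close>

definition step :: "real \<Rightarrow> real" where
  "step x = 2 * ((max 0 x)\<^sup>2 - 2 * (max 0 (x - 1/2))\<^sup>2 + (max 0 (x - 1))\<^sup>2)"

text \<open>A hat function on [0, 1] of height 2, hence of unit mass; \<open>step\<close> is its
  antiderivative. Test functions have to be only once continuously differentiable, so no exponential
  bump is called for.\<close>

definition dstep :: "real \<Rightarrow> real" where
  "dstep x = 4 * (max 0 x - 2 * max 0 (x - 1/2) + max 0 (x - 1))"

lemma step_deriv: "(step has_real_derivative dstep x) (at x)"
  unfolding step_def dstep_def
  by (rule derivative_eq_intros DERIV_chain2[OF has_real_derivative_max_square] refl)+ simp

lemma continuous_on_dstep [continuous_intros]: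
  "continuous_on S f \<Longrightarrow> continuous_on S (\<lambda>x. dstep (f x))"
  unfolding dstep_def by (intro continuous_intros)

lemma continuous_on_step [continuous_intros]:
  "continuous_on S f \<Longrightarrow> continuous_on S (\<lambda>x. step (f x))"
  unfolding step_def by (intro continuous_intros)

lemma step_nonpos: "x \<le> 0 \<Longrightarrow> step x = 0"
  by (simp add: step_def max_absorb1)

lemma step_ge1: "1 \<le> x \<Longrightarrow> step x = 1"
  by (simp add: step_def max_absorb2 power2_eq_square algebra_simps)

lemma dstep_outside: "x \<le> 0 \<or> 1 \<le> x \<Longrightarrow> dstep x = 0"
  by (auto simp: dstep_def max_def)

lemma dstep_nonneg: "0 \<le> dstep x"
  by (auto simp: dstep_def max_def)

lemma mono_step: "mono step"
proof (rule monoI)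
  show "step x \<le> step y" if "x \<le> y" for x y
    by (rule DERIV_nonneg_imp_nondecreasing[OF that]) (use step_deriv dstep_nonneg in blast)
qed

lemma step_range: "0 \<le> step x" "step x \<le> 1"
  using monoD[OF mono_step, of "min 0 x" x] monoD[OF mono_step, of x "max 1 x"]
  by (simp_all add: step_nonpos step_ge1)

lemma has_integral_dstep: "(dstep has_integral 1) {0..1}"
  using fundamental_theorem_of_calculus[of 0 1 step dstep]
  by (simp add: step_nonpos step_ge1 has_real_derivative_iff_has_vector_derivative[symmetric]
      step_deriv has_field_derivative_at_within)

definition test1 :: "(real \<Rightarrow> real) \<Rightarrow> (real \<Rightarrow> real) \<Rightarrow> bool" where
  "test1 a a' \<longleftrightarrow> (\<exists>M. \<forall>x. \<bar>x\<bar> > M \<longrightarrow> a x = 0) \<and>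
     (\<forall>x. (a has_real_derivative a' x) (at x)) \<and> continuous_on UNIV a'"

text \<open>Both flanks lie to the right of their base points, on [\<alpha>, \<alpha> + e] and
  [\<beta>, \<beta> + e]. The derivative is therefore a difference of two copies of one averaging
  kernel, and a single limit lemma serves both ends.\<close>

definition plateau :: "real \<Rightarrow> real \<Rightarrow> real \<Rightarrow> real \<Rightarrow> real" where
  "plateau \<alpha> \<beta> e x = step ((x - \<alpha>) / e) - step ((x - \<beta>) / e)"

definition dplateau :: "real \<Rightarrow> real \<Rightarrow> real \<Rightarrow> real \<Rightarrow> real" where
  "dplateau \<alpha> \<beta> e x = dstep ((x - \<alpha>) / e) / e - dstep ((x - \<beta>) / e) / e"

lemma plateau_outside:
  assumes "\<alpha> \<le> \<beta>" "e > 0" "x \<le> \<alpha> \<or> \<beta> + e \<le> x"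
  shows "plateau \<alpha> \<beta> e x = 0"
  using assms(3)
proof
  assume "x \<le> \<alpha>"
  then show ?thesis using assms by (simp add: plateau_def step_nonpos divide_le_0_iff)
next
  assume "\<beta> + e \<le> x"
  then have "1 \<le> (x - \<alpha>) / e" "1 \<le> (x - \<beta>) / e" using assms by (simp_all add: field_simps)
  then show ?thesis by (simp add: plateau_def step_ge1)
qed

lemma plateau_inside:
  assumes "e > 0" "\<alpha> + e \<le> x" "x \<le> \<beta>"
  shows "plateau \<alpha> \<beta> e x = 1" "dplateau \<alpha> \<beta> e x = 0"
proof -
  have "1 \<le> (x - \<alpha>) / e" "(x - \<beta>) / e \<le> 0"
    using assms by (simp_all add: field_simps)
  then show "plateau \<alpha> \<beta> e x = 1" "dplateau \<alpha> \<beta> e x = 0"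
    by (simp_all add: plateau_def dplateau_def step_ge1 step_nonpos dstep_outside)
qed

lemma plateau_abs_le_1: "\<bar>plateau \<alpha> \<beta> e x\<bar> \<le> 1"
  using step_range[of "(x - \<alpha>) / e"] step_range[of "(x - \<beta>) / e"]
  unfolding plateau_def by linarith

lemma plateau_nonneg: "\<alpha> \<le> \<beta> \<Longrightarrow> e > 0 \<Longrightarrow> 0 \<le> plateau \<alpha> \<beta> e x"
  unfolding plateau_def using monoD[OF mono_step, of "(x - \<beta>) / e" "(x - \<alpha>) / e"]
  by (simp add: divide_right_mono)

lemma test1_plateau:
  assumes "\<alpha> \<le> \<beta>" "e > 0"
  shows "test1 (plateau \<alpha> \<beta> e) (dplateau \<alpha> \<beta> e)"
proof -
  have "(plateau \<alpha> \<beta> e has_real_derivative dplateau \<alpha> \<beta> e x) (at x)" for x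
    unfolding plateau_def dplateau_def using assms
    by (auto intro!: derivative_eq_intros DERIV_chain2[OF step_deriv])
  moreover have "continuous_on UNIV (dplateau \<alpha> \<beta> e)"
    unfolding dplateau_def using assms by (intro continuous_intros) auto
  moreover have "\<forall>x. \<bar>x\<bar> > max (- \<alpha>) (\<beta> + e) \<longrightarrow> plateau \<alpha> \<beta> e x = 0"
    using plateau_outside[OF assms] assms by (smt (verit, best))
  ultimately show ?thesis unfolding test1_def by blast
qed

section \<open>One-sided averages and the passage from the weak to the integrated equation\<close>

lemma dstep_average_integrable:
  fixes H :: "real \<Rightarrow> real"
  assumes "e > 0" "continuous_on {c..c + e} H"
  shows "integrable lborel (\<lambda>x. H x * (dstep ((x - c) / e) / e))"
proof -
  have "set_integrable lborel {c..c + e} (\<lambda>x. H x * (dstep ((x - c) / e) / e))"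
    using assms by (intro borel_integrable_atLeastAtMost' continuous_intros) auto
  moreover have "(\<lambda>x. indicat_real {c..c + e} x *\<^sub>R (H x * (dstep ((x - c) / e) / e))) =
      (\<lambda>x. H x * (dstep ((x - c) / e) / e))"
  proof
    fix x
    show "indicat_real {c..c + e} x *\<^sub>R (H x * (dstep ((x - c) / e) / e)) =
        H x * (dstep ((x - c) / e) / e)"
    proof (cases "x \<in> {c..c + e}")
      case False
      then have "(x - c) / e \<le> 0 \<or> 1 \<le> (x - c) / e"
        using assms(1) by (auto simp: field_simps)
      then show ?thesis by (simp add: dstep_outside)
    qed simp
  qed
  ultimately show ?thesis by (simp add: set_integrable_def)
qed

text \<open>The rescaled hat is an approximate identity concentrated to the right of c. Substituting
  x = c + e n * y moves the shrinking width from the kernel into the argument of \<open>H\<close>;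
  dominated convergence then applies with a fixed kernel and the bound of \<open>H\<close> on the
  compact interval.\<close>

lemma dstep_average_tendsto:
  fixes H :: "real \<Rightarrow> real"
  assumes "d > 0" "continuous_on {c..c + d} H"
    and e: "\<And>n. 0 < e n" "\<And>n. e n \<le> d" "e \<longlonglongrightarrow> 0"
  shows "(\<lambda>n. LINT x|lborel. H x * (dstep ((x - c) / e n) / e n)) \<longlonglongrightarrow> H c"
proof -
  have eq: "(LINT x|lborel. H x * (dstep ((x - c) / e n) / e n)) =
      (LINT y|lborel. indicator {0..1} y * (H (c + e n * y) * dstep y))" for n
  proof -
    have "e n \<noteq> 0" "\<bar>e n\<bar> = e n" using e(1)[of n] by auto
    note affine = lborel_integral_real_affine[OF this(1), of "\<lambda>x. H x * (dstep ((x - c) / e n) / e n)" c]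
    have "(LINT x|lborel. H x * (dstep ((x - c) / e n) / e n)) =
      e n * (LINT y|lborel. H (c + e n * y) * (dstep ((c + e n * y - c) / e n) / e n))"
      by (subst affine) (simp only: \<open>\<bar>e n\<bar> = e n\<close> real_scaleR_def)
    also have "\<dots> = (LINT y|lborel. indicator {0..1} y * (H (c + e n * y) * dstep y))"
      unfolding integral_mult_right_zero[symmetric]
    proof (rule Bochner_Integration.integral_cong)
      show "e n * (H (c + e n * y) * (dstep ((c + e n * y - c) / e n) / e n)) =
          indicator {0..1} y * (H (c + e n * y) * dstep y)" for y
        using e(1)[of n] dstep_outside[of y] by (cases "y \<in> {0..1}") auto
    qed simp
    finally show ?thesis .
  qed
  obtain B where B: "\<And>x. x \<in> {c..c + d} \<Longrightarrow> \<bar>H x\<bar> \<le> B"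
    using compact_imp_bounded[OF compact_continuous_image[OF assms(2) compact_Icc]]
    unfolding bounded_iff by (auto simp del: atLeastAtMost_iff)
  have in_cd: "c + e n * y \<in> {c..c + d}" if "y \<in> {0..1}" for n y
    using mult_mono[of "e n" d y 1] e(1,2)[of n] that assms(1) by auto
  have "(\<lambda>n. LINT y|lborel. indicator {0..1} y * (H (c + e n * y) * dstep y)) \<longlonglongrightarrow>
      (LINT y|lborel. indicator {0..1} y * (H c * dstep y))"
  proof (rule integral_dominated_convergence[where w="\<lambda>y. B * (indicator {0..1} y * dstep y)"])
    have cont: "continuous_on {0..1} (\<lambda>y. H (c + e n * y) * dstep y)" for n
      by (intro continuous_intros continuous_on_compose2[OF assms(2)]) (use in_cd in auto)
    show "(\<lambda>y. indicator {0..1} y * (H (c + e n * y) * dstep y)) \<in> borel_measurable lborel" for n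
      using borel_measurable_continuous_on_indicator[OF _ cont] by simp
    have "continuous_on {0..1} (\<lambda>y. H c * dstep y)" by (intro continuous_intros)
    then show "(\<lambda>y. indicator {0..1} y * (H c * dstep y)) \<in> borel_measurable lborel"
      using borel_measurable_continuous_on_indicator[of "{0..1}" "\<lambda>y. H c * dstep y"] by simp
    have "set_integrable lborel {0..1} dstep"
      by (intro borel_integrable_atLeastAtMost' continuous_intros)
    then show "integrable lborel (\<lambda>y. B * (indicator {0..1} y * dstep y))"
      by (simp add: set_integrable_def)
    show "AE y in lborel. norm (indicator {0..1} y * (H (c + e n * y) * dstep y)) \<le>
        B * (indicator {0..1} y * dstep y)" for n
      using B[OF in_cd] dstep_nonneg
      by (intro always_eventually) (auto simp: indicator_def abs_mult intro!: mult_right_mono)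
    show "AE y in lborel. (\<lambda>n. indicator {0..1} y * (H (c + e n * y) * dstep y)) \<longlonglongrightarrow>
        indicator {0..1} y * (H c * dstep y)"
    proof (intro always_eventually allI)
      fix y
      have "(\<lambda>n. H (c + e n * y)) \<longlonglongrightarrow> H c" if "y \<in> {0..1}"
      proof (rule continuous_on_tendsto_compose[OF assms(2)])
        show "(\<lambda>n. c + e n * y) \<longlonglongrightarrow> c"
          using tendsto_add[OF tendsto_const tendsto_mult[OF e(3) tendsto_const]] by simp
      qed (use in_cd[OF that] assms(1) in auto)
      then show "(\<lambda>n. indicator {0..1} y * (H (c + e n * y) * dstep y)) \<longlonglongrightarrow>
        indicator {0..1} y * (H c * dstep y)"
        by (auto simp: indicator_def intro!: tendsto_intros)
    qed
  qed
  moreover have "(LINT y|lborel. indicator {0..1} y * (H c * dstep y)) = H c"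
  proof -
    have "set_integrable lborel {0..1} dstep"
      by (intro borel_integrable_atLeastAtMost' continuous_intros)
    then have "(LINT y:{0..1}|lborel. dstep y) = 1"
      using set_borel_integral_eq_integral(2)[of "{0..1}" dstep] has_integral_dstep
      by (simp add: integral_unique)
    then have *: "(LINT y|lborel. indicator {0..1} y * dstep y) = 1"
      by (simp add: set_lebesgue_integral_def)
    have "(LINT y|lborel. indicator {0..1} y * (H c * dstep y)) =
        (LINT y|lborel. H c * (indicator {0..1} y * dstep y))"
      by (intro Bochner_Integration.integral_cong) auto
    then show ?thesis using * by simp
  qed
  ultimately show ?thesis unfolding eq by simp
qed

text \<open>Testing with plateaus of shrinking flank width: the flanks average \<open>H\<close> near
  \<alpha> and near \<beta>, the top recovers the integral of \<open>g\<close>. Continuity of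
  \<open>H\<close> enters only just to the right of the two endpoints, so a discontinuity in between
  is allowed; this is how the equation is carried across the shock.\<close>

lemma weak_ode:
  fixes H g :: "real \<Rightarrow> real"
  assumes weak: "\<And>a a'. test1 a a' \<Longrightarrow> has_bochner_integral lborel (\<lambda>x. H x * a' x - g x * a x) 0"
    and "\<alpha> < \<beta>" "d > 0" "continuous_on {\<alpha>..\<alpha> + d} H" "continuous_on {\<beta>..\<beta> + d} H"
  shows "g integrable_on {\<alpha>..\<beta>}" and "H \<alpha> - H \<beta> = integral {\<alpha>..\<beta>} g"
proof -
  define G where "G x = indicator {\<alpha>..\<beta> + d} x * g x" for x
  have G: "integrable lborel G"
  proof -
    \<comment> \<open>On [\<alpha>, \<beta> + d] this wider plateau equals 1 and has zero
      derivative. Cutting the tested integrand down to that interval leaves exactly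
      \<open>- g\<close>, whose integrability is thereby obtained from the weak form itself.\<close>
    have "has_bochner_integral lborel (\<lambda>x. H x * dplateau (\<alpha> - 1) (\<beta> + d) 1 x -
        g x * plateau (\<alpha> - 1) (\<beta> + d) 1 x) 0"
      using assms by (intro weak test1_plateau) auto
    then have "integrable lborel (\<lambda>x. H x * dplateau (\<alpha> - 1) (\<beta> + d) 1 x -
        g x * plateau (\<alpha> - 1) (\<beta> + d) 1 x)"
      by (simp add: has_bochner_integral_iff)
    then have "integrable lborel (\<lambda>x. indicator {\<alpha>..\<beta> + d} x *\<^sub>R
        (H x * dplateau (\<alpha> - 1) (\<beta> + d) 1 x - g x * plateau (\<alpha> - 1) (\<beta> + d) 1 x))"
      by (rule integrable_mult_indicator[rotated]) simp
    also have "(\<lambda>x. indicator {\<alpha>..\<beta> + d} x *\<^sub>R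
        (H x * dplateau (\<alpha> - 1) (\<beta> + d) 1 x - g x * plateau (\<alpha> - 1) (\<beta> + d) 1 x)) = (\<lambda>x. - G x)"
      by (auto simp: fun_eq_iff G_def indicator_def plateau_inside)
    finally show ?thesis by simp
  qed
  \<comment> \<open>The widths never exceed d, so both flanks stay inside the intervals on which
    \<open>H\<close> is continuous.\<close>
  define e where "e n = d / real (Suc n)" for n
  have e: "\<And>n. 0 < e n" "\<And>n. e n \<le> d" "e \<longlonglongrightarrow> 0"
  proof -
    show "0 < e n" "e n \<le> d" for n
      using \<open>d > 0\<close> by (simp_all add: e_def divide_simps)
    show "e \<longlonglongrightarrow> 0"
      unfolding e_def using LIMSEQ_Suc[OF lim_const_over_n[of d]] by simp
  qed
  have eq: "(LINT x|lborel. H x * (dstep ((x - \<alpha>) / e n) / e n)) -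
      (LINT x|lborel. H x * (dstep ((x - \<beta>) / e n) / e n)) =
      (LINT x|lborel. G x * plateau \<alpha> \<beta> (e n) x)" for n
  proof -
    have 1: "integrable lborel (\<lambda>x. H x * (dstep ((x - \<alpha>) / e n) / e n))"
      using assms e(1,2)[of n]
      by (intro dstep_average_integrable) (auto intro: continuous_on_subset)
    have 2: "integrable lborel (\<lambda>x. H x * (dstep ((x - \<beta>) / e n) / e n))"
      using assms e(1,2)[of n]
      by (intro dstep_average_integrable) (auto intro: continuous_on_subset)
    have gG: "g x * plateau \<alpha> \<beta> (e n) x = G x * plateau \<alpha> \<beta> (e n) x" for x
      using plateau_outside[of \<alpha> \<beta> "e n" x] e(1,2)[of n] assms(2)
      by (cases "x \<in> {\<alpha>..\<beta> + d}") (auto simp: G_def)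
    have "has_bochner_integral lborel (\<lambda>x. H x * dplateau \<alpha> \<beta> (e n) x - g x * plateau \<alpha> \<beta> (e n) x) 0"
      using assms e(1)[of n] by (intro weak test1_plateau) auto
    then have 3: "has_bochner_integral lborel (\<lambda>x. H x * (dstep ((x - \<alpha>) / e n) / e n) -
       H x * (dstep ((x - \<beta>) / e n) / e n) - G x * plateau \<alpha> \<beta> (e n) x) 0"
      by (simp add: dplateau_def gG right_diff_distrib)
    have 4: "integrable lborel (\<lambda>x. G x * plateau \<alpha> \<beta> (e n) x)"
      using Bochner_Integration.integrable_diff[OF Bochner_Integration.integrable_diff[OF 1 2]
          conjunct1[OF 3[unfolded has_bochner_integral_iff]]] by simp
    show ?thesis
      using has_bochner_integral_integral_eq[OF 3] 1 2 4 by simp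
  qed
  have "(\<lambda>n. LINT x|lborel. G x * plateau \<alpha> \<beta> (e n) x) \<longlonglongrightarrow>
      (LINT x|lborel. indicator {\<alpha>..\<beta>} x * G x)"
  proof (rule integral_dominated_convergence[where w="\<lambda>x. norm (G x)"])
    have [measurable]: "plateau \<alpha> \<beta> (e n) \<in> borel_measurable borel" for n
      unfolding plateau_def using e(1)[of n]
      by (intro borel_measurable_continuous_onI continuous_intros) auto
    have [measurable]: "G \<in> borel_measurable borel"
      using borel_measurable_integrable[OF G] by simp
    show "(\<lambda>x. G x * plateau \<alpha> \<beta> (e n) x) \<in> borel_measurable lborel" for n
      by measurable
    show "(\<lambda>x. indicator {\<alpha>..\<beta>} x * G x) \<in> borel_measurable lborel"
      by measurable
    show "integrable lborel (\<lambda>x. norm (G x))" using G by simp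
    show "AE x in lborel. norm (G x * plateau \<alpha> \<beta> (e n) x) \<le> norm (G x)" for n
      using plateau_abs_le_1 by (intro always_eventually) (auto simp: abs_mult intro!: mult_left_le)
    \<comment> \<open>At \<alpha> every plateau vanishes while the indicator is 1, so the
      convergence holds only almost everywhere.\<close>
    have lim: "(\<lambda>n. G x * plateau \<alpha> \<beta> (e n) x) \<longlonglongrightarrow> indicator {\<alpha>..\<beta>} x * G x" if ne: "x \<noteq> \<alpha>" for x
    proof -
      consider "x < \<alpha>" | "\<alpha> < x" "x \<le> \<beta>" | "\<beta> < x" using ne by linarith
      then have "\<forall>\<^sub>F n in sequentially. plateau \<alpha> \<beta> (e n) x = indicator {\<alpha>..\<beta>} x"
      proof cases
        case 1
        then show ?thesis using plateau_outside[OF less_imp_le[OF assms(2)] e(1)] by simp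
      next
        case 2
        then have "\<forall>\<^sub>F n in sequentially. e n < x - \<alpha>"
          using order_tendstoD(2)[OF e(3), of "x - \<alpha>"] by simp
        then show ?thesis
          by eventually_elim (use 2 e(1) in \<open>simp add: plateau_inside\<close>)
      next
        case 3
        then have "\<forall>\<^sub>F n in sequentially. e n < x - \<beta>"
          using order_tendstoD(2)[OF e(3), of "x - \<beta>"] by simp
        then show ?thesis
          by eventually_elim (use 3 plateau_outside[OF less_imp_le[OF assms(2)] e(1)] in simp)
      qed
      then show ?thesis
        by (intro tendsto_eventually) (auto elim: eventually_mono)
    qed
    show "AE x in lborel. (\<lambda>n. G x * plateau \<alpha> \<beta> (e n) x) \<longlonglongrightarrow> indicator {\<alpha>..\<beta>} x * G x"
      using AE_lborel_singleton[of \<alpha>] by eventually_elim (rule lim)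
  qed
  moreover have "(\<lambda>n. LINT x|lborel. G x * plateau \<alpha> \<beta> (e n) x) \<longlonglongrightarrow> H \<alpha> - H \<beta>"
    unfolding eq[symmetric]
    by (intro tendsto_diff dstep_average_tendsto[of d] assms e)
  ultimately have 5: "H \<alpha> - H \<beta> = (LINT x|lborel. indicator {\<alpha>..\<beta>} x * G x)"
    by (rule LIMSEQ_unique[rotated])
  have 6: "(\<lambda>x. indicator {\<alpha>..\<beta>} x * G x) = (\<lambda>x. indicator {\<alpha>..\<beta>} x *\<^sub>R g x)"
    using \<open>d > 0\<close> by (auto simp: fun_eq_iff G_def indicator_def)
  have 7: "set_integrable lborel {\<alpha>..\<beta>} g"
    unfolding set_integrable_def 6[symmetric]
    using integrable_mult_indicator[OF _ G, of "{\<alpha>..\<beta>}"] by simp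
  show "g integrable_on {\<alpha>..\<beta>}" "H \<alpha> - H \<beta> = integral {\<alpha>..\<beta>} g"
    using set_borel_integral_eq_integral[OF 7] 5
    by (simp_all add: 6 set_lebesgue_integral_def)
qed

section \<open>Travelling waves in the moving frame\<close>

text \<open>On each horizontal line the shear is a translation by s t, which preserves length;
  slicing in t reduces the claim to that.\<close>

lemma distr_shear_lborel:
  "distr lborel borel (\<lambda>(\<xi>, t). (\<xi> + s * t, t)) = (lborel :: (real \<times> real) measure)"
proof (rule measure_eqI)
  have sets_prod: "sets (lborel \<Otimes>\<^sub>M lborel) = sets (borel :: (real \<times> real) measure)"
    by (metis lborel_prod sets_lborel)
  let ?T = "\<lambda>(\<xi>, t). (\<xi> + s * t, t :: real)"
  fix X assume "X \<in> sets (distr lborel borel ?T)"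
  then have X: "X \<in> sets (borel :: (real \<times> real) measure)" by simp
  have T: "?T \<in> borel_measurable (borel :: (real \<times> real) measure)"
    by (intro borel_measurable_continuous_onI) (auto simp: case_prod_unfold intro!: continuous_intros)
  then have TX: "?T -` X \<in> sets (borel :: (real \<times> real) measure)"
    using measurable_sets[OF T X] by simp
  have "emeasure (distr lborel borel ?T) X = emeasure lborel (?T -` X)"
    using T X by (subst emeasure_distr) auto
  also have "\<dots> = (\<integral>\<^sup>+t. emeasure lborel ((\<lambda>x. (x, t)) -` (?T -` X)) \<partial>lborel)"
    using TX by (subst lborel_prod[symmetric], intro lborel_pair.emeasure_pair_measure_alt2)
      (simp only: sets_prod)
  also have "\<dots> = (\<integral>\<^sup>+t. emeasure lborel ((\<lambda>x. (x, t)) -` X) \<partial>lborel)"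
  proof (rule nn_integral_cong)
    fix t :: real
    have "(\<lambda>x. (x, t)) -` X \<in> sets borel"
      using sets_Pair2[of X lborel lborel t] X by (simp only: sets_prod sets_lborel)
    then have "emeasure (distr lborel borel ((+) (s * t))) ((\<lambda>x. (x, t)) -` X) =
        emeasure lborel ((+) (s * t) -` ((\<lambda>x. (x, t)) -` X))"
      by (subst emeasure_distr) auto
    also have "(+) (s * t) -` ((\<lambda>x. (x, t)) -` X) = (\<lambda>x. (x, t)) -` (?T -` X)"
      by (auto simp: add.commute)
    finally show "emeasure lborel ((\<lambda>x. (x, t)) -` (?T -` X)) = emeasure lborel ((\<lambda>x. (x, t)) -` X)"
      by (simp add: lborel_distr_plus)
  qed
  also have "\<dots> = emeasure lborel X"
    using lborel_pair.emeasure_pair_measure_alt2[of X] X by (simp add: sets_prod[simplified] lborel_prod)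
  finally show "emeasure (distr lborel borel ?T) X = emeasure lborel X" .
qed simp

text \<open>Serves in both directions: to pass into the moving frame when the wave is given, and
  back out of it when the explicit wave is shown to be a weak solution.\<close>

lemma has_bochner_integral_shear:
  fixes f :: "real \<times> real \<Rightarrow> real"
  assumes f: "f \<in> borel_measurable borel"
  shows "has_bochner_integral lborel (\<lambda>(\<xi>, t). f (\<xi> + s * t, t)) c \<longleftrightarrow> has_bochner_integral lborel f c"
proof -
  have "(\<lambda>(\<xi>, t). (\<xi> + s * t, t)) \<in> borel_measurable (borel :: (real \<times> real) measure)"
    by (intro borel_measurable_continuous_onI) (auto simp: case_prod_unfold intro!: continuous_intros)
  then have *: "(\<lambda>(\<xi>, t). (\<xi> + s * t, t)) \<in> measurable lborel (borel :: (real \<times> real) measure)"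
    by simp
  have "has_bochner_integral lborel f c \<longleftrightarrow>
      has_bochner_integral (distr lborel borel (\<lambda>(\<xi>, t). (\<xi> + s * t, t))) f c"
    by (simp add: distr_shear_lborel)
  also have "\<dots> \<longleftrightarrow> has_bochner_integral lborel (\<lambda>p. f ((\<lambda>(\<xi>, t). (\<xi> + s * t, t)) p)) c"
    unfolding has_bochner_integral_iff using integrable_distr_eq[OF * f] integral_distr[OF * f] by simp
  finally show ?thesis by (simp add: case_prod_unfold)
qed

text \<open>That a derivative of a compactly supported function has zero mean is what removes the
  t-derivative terms from the tested equations.\<close>

lemma test1_integral:
  assumes "test1 a a'"
  shows "integrable lborel a" "has_bochner_integral lborel a' 0"
proof -
  obtain M where M: "\<And>x. \<bar>x\<bar> > M \<Longrightarrow> a x = 0" using assms by (auto simp: test1_def)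
  define N where "N = \<bar>M\<bar> + 1"
  have da: "\<And>x. (a has_real_derivative a' x) (at x)" and ca': "continuous_on UNIV a'"
    using assms by (auto simp: test1_def)
  have ca: "isCont a x" for x using da DERIV_isCont by blast
  have z: "a x = 0" if "\<bar>x\<bar> \<ge> N" for x using M that by (simp add: N_def)
  have z': "a' x = 0" if "\<bar>x\<bar> \<ge> N" for x
  proof -
    have "((\<lambda>x. 0) has_real_derivative a' x) (at x)"
      by (rule has_field_derivative_transform_within_open[OF da, where S="{y. \<bar>y\<bar> > \<bar>M\<bar>}"])
        (use that M in \<open>auto simp: N_def intro!: open_Collect_less continuous_intros\<close>)
    then show ?thesis by (metis DERIV_const DERIV_unique)
  qed
  have "integrable lborel (\<lambda>x. a x * indicator {-N..N} x)"
    by (rule borel_integrable_atLeastAtMost) (rule ca)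
  also have "(\<lambda>x. a x * indicator {-N..N} x) = a"
  proof
    show "a x * indicator {-N..N} x = a x" for x
    proof (cases "\<bar>x\<bar> \<ge> N")
      case False
      then have "x \<in> {-N..N}" by auto
      then show ?thesis by simp
    qed (simp add: z)
  qed
  finally show "integrable lborel a" .
  have "has_bochner_integral lborel (\<lambda>x. a' x * indicator {-N..N} x) (a N - a (- N))"
    by (rule has_bochner_integral_FTC_Icc_real)
      (use da ca' in \<open>auto simp: N_def continuous_on_eq_continuous_at\<close>)
  also have "(\<lambda>x. a' x * indicator {-N..N} x) = a'"
  proof
    show "a' x * indicator {-N..N} x = a' x" for x
    proof (cases "\<bar>x\<bar> \<ge> N")
      case False
      then have "x \<in> {-N..N}" by auto
      then show ?thesis by simp
    qed (simp add: z')
  qed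
  finally show "has_bochner_integral lborel a' 0" using z[of N] z[of "-N"] by (simp add: N_def)
qed

lemma test_function_travelling:
  assumes a: "test1 a a'" and b: "test1 b b'"
  shows "test_function (\<lambda>(x, t). a (x - s * t) * b t) (\<lambda>(x, t). a' (x - s * t) * b t)
    (\<lambda>(x, t). - s * a' (x - s * t) * b t + a (x - s * t) * b' t)"
proof -
  obtain M where M: "\<And>x. \<bar>x\<bar> > M \<Longrightarrow> a x = 0" using a by (auto simp: test1_def)
  obtain N where N: "\<And>x. \<bar>x\<bar> > N \<Longrightarrow> b x = 0" using b by (auto simp: test1_def)
  have da: "\<And>x. (a has_real_derivative a' x) (at x)" and ca': "continuous_on UNIV a'"
    using a by (auto simp: test1_def)
  have db: "\<And>x. (b has_real_derivative b' x) (at x)" and cb': "continuous_on UNIV b'"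
    using b by (auto simp: test1_def)
  have ca: "continuous_on UNIV a" and cb: "continuous_on UNIV b"
    using da db by (auto intro!: DERIV_isCont continuous_at_imp_continuous_on)
  note cont = continuous_on_compose2[OF ca] continuous_on_compose2[OF cb]
    continuous_on_compose2[OF ca'] continuous_on_compose2[OF cb']
  define A where "A = \<bar>M\<bar> + \<bar>s\<bar> * \<bar>N\<bar>"
  have sub: "{p. (case p of (x, t) \<Rightarrow> a (x - s * t) * b t) \<noteq> 0} \<subseteq> {-A..A} \<times> {-\<bar>N\<bar>..\<bar>N\<bar>}"
  proof clarsimp
    fix x t assume "a (x - s * t) \<noteq> 0" "b t \<noteq> 0"
    then have 1: "\<bar>x - s * t\<bar> \<le> M" "\<bar>t\<bar> \<le> N" using M N by force+
    have "\<bar>s * t\<bar> \<le> \<bar>s\<bar> * \<bar>N\<bar>" using 1 by (auto simp: abs_mult intro!: mult_left_mono)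
    then show "- A \<le> x \<and> x \<le> A \<and> - \<bar>N\<bar> \<le> t \<and> t \<le> \<bar>N\<bar>" using 1 unfolding A_def by linarith
  qed
  have "compact (closure {p. (case p of (x, t) \<Rightarrow> a (x - s * t) * b t) \<noteq> 0})"
    unfolding compact_closure
    by (rule bounded_subset[OF bounded_Times sub]) (auto intro: compact_imp_bounded)
  moreover have "((\<lambda>(x, t). a (x - s * t) * b t) has_derivative
      (\<lambda>h. fst h * (case p of (x, t) \<Rightarrow> a' (x - s * t) * b t) +
           snd h * (case p of (x, t) \<Rightarrow> - s * a' (x - s * t) * b t + a (x - s * t) * b' t))) (at p)" for p
  proof -
    have "((\<lambda>p. a (fst p - s * snd p)) has_derivative
        (\<lambda>h. (fst h - s * snd h) * a' (fst p - s * snd p))) (at p)"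
      by (rule has_derivative_compose[OF _ da[unfolded has_field_derivative_def], THEN has_derivative_eq_rhs])
        (auto intro!: derivative_eq_intros simp: fun_eq_iff)
    moreover have "((\<lambda>p. b (snd p)) has_derivative (\<lambda>h. snd h * b' (snd p))) (at p)"
      by (rule has_derivative_compose[OF _ db[unfolded has_field_derivative_def], THEN has_derivative_eq_rhs])
        (auto intro!: derivative_eq_intros simp: fun_eq_iff)
    ultimately have "((\<lambda>p. a (fst p - s * snd p) * b (snd p)) has_derivative
       (\<lambda>h. a (fst p - s * snd p) * (snd h * b' (snd p)) +
          (fst h - s * snd h) * a' (fst p - s * snd p) * b (snd p))) (at p)"
      by (rule has_derivative_mult)
    then show ?thesis
      by (simp add: case_prod_unfold algebra_simps)
  qed
  moreover have "continuous_on UNIV (\<lambda>(x, t). a' (x - s * t) * b t)"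
    "continuous_on UNIV (\<lambda>(x, t). - s * a' (x - s * t) * b t + a (x - s * t) * b' t)"
    unfolding case_prod_unfold by (intro continuous_intros cont; simp)+
  ultimately show ?thesis unfolding test_function_def by blast
qed

text \<open>Testing with \<open>\<psi>(x, t) = a(x - s t) b(t)\<close>, where \<open>b\<close> has nonzero integral.\<close>

lemma travelling_weak_solution:
  fixes V F K :: "real \<Rightarrow> real"
  assumes weak: "\<And>\<psi> \<psi>x \<psi>t. test_function \<psi> \<psi>x \<psi>t \<Longrightarrow> has_bochner_integral lborel
      (\<lambda>(x, t). V (x - s * t) * \<psi>t (x, t) + F (x - s * t) * \<psi>x (x, t) - K (x - s * t) * \<psi> (x, t)) 0"
    and a: "test1 a a'"
  shows "has_bochner_integral lborel (\<lambda>\<xi>. (F \<xi> - s * V \<xi>) * a' \<xi> - K \<xi> * a \<xi>) 0"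
proof -
  \<comment> \<open>This choice equals 1 on [1, 2] and is nonnegative, so its integral is at least 1
    and may be divided out.\<close>
  define b b' where "b = plateau 0 2 1" and "b' = dplateau 0 2 1"
  have b: "test1 b b'" unfolding b_def b'_def by (rule test1_plateau) auto
  define \<beta> where "\<beta> = (LINT t|lborel. b t)"
  have "1 = (LINT t|lborel. indicat_real {1..2::real} t)" by simp
  also have "\<dots> \<le> \<beta>"
    unfolding \<beta>_def
  proof (rule integral_mono)
    show "indicat_real {1..2} t \<le> b t" for t
      using plateau_inside[of 1 0 t 2] plateau_nonneg[of 0 2 1 t] by (auto simp: b_def indicator_def)
  qed (use test1_integral(1)[OF b] in \<open>auto intro!: integrable_real_indicator\<close>)
  finally have \<beta>: "\<beta> \<ge> 1" .
  define L where "L \<xi> = (F \<xi> - s * V \<xi>) * a' \<xi> - K \<xi> * a \<xi>" for \<xi>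
  define g where "g \<xi> t = L \<xi> * b t + V \<xi> * a \<xi> * b' t" for \<xi> t
  have 0: "has_bochner_integral lborel (\<lambda>(x, t). g (x - s * t) t) 0"
    using weak[OF test_function_travelling[OF a b]]
    by (simp add: g_def L_def case_prod_unfold algebra_simps)
  then have "(\<lambda>(x, t). g (x - s * t) t) \<in> borel_measurable borel"
    by (auto simp: has_bochner_integral_iff dest: borel_measurable_integrable)
  from has_bochner_integral_shear[OF this, of s 0] 0
  have 1: "has_bochner_integral (lborel \<Otimes>\<^sub>M lborel) (\<lambda>(\<xi>, t). g \<xi> t) 0"
    by (simp add: case_prod_unfold lborel_prod)
  \<comment> \<open>The summand with \<open>b'\<close> integrates to zero in t; a steady profile
    feels the time cutoff only through the factor \<beta>.\<close>
  have inner: "(LINT t|lborel. g \<xi> t) = L \<xi> * \<beta>" for \<xi>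
    using test1_integral[OF b] unfolding g_def \<beta>_def
    by (simp add: has_bochner_integral_iff)
  have "integrable lborel (\<lambda>\<xi>. L \<xi> * \<beta>)" "(LINT \<xi>|lborel. L \<xi> * \<beta>) = 0"
    using lborel_pair.integrable_fst[of "\<lambda>\<xi> t. g \<xi> t"] lborel_pair.integral_fst[of "\<lambda>\<xi> t. g \<xi> t"] 1
    by (simp_all add: has_bochner_integral_iff inner)
  then have "has_bochner_integral lborel L 0"
    using \<beta> by (simp add: has_bochner_integral_iff)
  then show ?thesis unfolding L_def .
qed

section \<open>Tools for integrating the profile equations\<close>

lemma smooth_on_imp_continuous_on: "smooth_on S f \<Longrightarrow> continuous_on S f"
  unfolding smooth_on_def
  by (rule continuous_at_imp_continuous_on) (metis differentiable_imp_continuous_within funpow_0)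

text \<open>The agreement set is closed in \<open>I\<close> by continuity and open by
  \<open>loc\<close>. Local agreement is demanded only around points where the functions already
  agree, which suits an ignition function that is known only near the values of the expected
  profile.\<close>

lemma continuation_eqI:
  fixes f g :: "real \<Rightarrow> 'a::real_normed_vector"
  assumes "connected I" "continuous_on I f" "continuous_on I g"
    and "x0 \<in> I" "f x0 = g x0"
    and loc: "\<And>x. x \<in> I \<Longrightarrow> f x = g x \<Longrightarrow> \<exists>U. open U \<and> x \<in> U \<and> U \<subseteq> I \<and> (\<forall>y\<in>U. f y = g y)"
    and "x \<in> I"
  shows "f x = g x"
proof -
  let ?S = "{x \<in> I. f x - g x = 0}"
  have "closedin (top_of_set I) ?S"
    by (intro continuous_closedin_preimage_constant continuous_intros assms)
  moreover have "openin (top_of_set I) ?S"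
  proof (rule open_subset)
    show "open ?S"
    proof (rule Topological_Spaces.openI)
      fix x assume "x \<in> ?S"
      then obtain U where "open U" "x \<in> U" "U \<subseteq> I" "\<forall>y\<in>U. f y = g y"
        using loc[of x] by auto
      then show "\<exists>T. open T \<and> x \<in> T \<and> T \<subseteq> ?S" by (intro exI[of _ U]) auto
    qed
  qed auto
  ultimately have "?S = {} \<or> ?S = I"
    using \<open>connected I\<close> unfolding connected_clopen by blast
  then show ?thesis using assms(4,5,7) by auto
qed

text \<open>The integrated equation upgrades continuity of z to differentiability, after which z(x)
  exp(- c x) has zero derivative.\<close>

lemma linear_ode_exp:
  fixes z :: "real \<Rightarrow> real"
  assumes "open I" "convex I" "continuous_on I z"
    and int: "\<And>\<alpha> \<beta>. \<alpha> \<in> I \<Longrightarrow> \<beta> \<in> I \<Longrightarrow> \<alpha> < \<beta> \<Longrightarrow> z \<beta> - z \<alpha> = integral {\<alpha>..\<beta>} (\<lambda>x. c * z x)"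
  shows "\<exists>A. \<forall>x\<in>I. z x = A * exp (c * x)"
proof -
  have dz: "(z has_real_derivative c * z x) (at x)" if x: "x \<in> I" for x
  proof -
    obtain e where e: "e > 0" "cball x e \<subseteq> I" using \<open>open I\<close> x open_contains_cball by blast
    have sub: "{x - e..x + e} \<subseteq> I" using e(2) by (simp add: cball_eq_atLeastAtMost)
    have "((\<lambda>y. integral {x - e..y} (\<lambda>x. c * z x)) has_real_derivative c * z x) (at x within {x - e..x + e})"
      by (rule integral_has_real_derivative)
        (use e sub in \<open>auto intro!: continuous_intros continuous_on_subset[OF assms(3)]\<close>)
    moreover have "at x within {x - e..x + e} = at x"
      using e by (intro at_within_interior) (simp add: interior_atLeastAtMost_real)
    ultimately have "((\<lambda>y. integral {x - e..y} (\<lambda>x. c * z x)) has_real_derivative c * z x) (at x)"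
      by (simp only:)
    from DERIV_add[OF DERIV_const[of "z (x - e)"] this]
    have "((\<lambda>y. z (x - e) + integral {x - e..y} (\<lambda>x. c * z x)) has_real_derivative c * z x) (at x)"
      by (simp only: add_0)
    then show ?thesis
    proof (rule has_field_derivative_transform_within_open[where S="{x - e<..<x + e}"])
      fix y assume "y \<in> {x - e<..<x + e}"
      then show "z (x - e) + integral {x - e..y} (\<lambda>x. c * z x) = z y"
        using int[of "x - e" y] sub e(1) by (auto simp: subset_iff)
    qed (use e in auto)
  qed
  have "((\<lambda>x. z x * exp (- c * x)) has_real_derivative 0) (at x within I)" if "x \<in> I" for x
    using has_field_derivative_at_within[OF dz[OF that]]
    by (auto intro!: derivative_eq_intros simp: algebra_simps)
  then obtain A where A: "\<And>x. x \<in> I \<Longrightarrow> z x * exp (- c * x) = A"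
    using has_field_derivative_zero_constant[OF \<open>convex I\<close>, of "\<lambda>x. z x * exp (- c * x)"] by blast
  have "z x = A * exp (c * x)" if "x \<in> I" for x
    unfolding A[OF that, symmetric] by (simp add: mult.assoc exp_minus_inverse flip: exp_add)
  then show ?thesis by blast
qed

section \<open>Uniqueness of the detonation profile\<close>

lemma tendsto_unique_eventually_eq:
  fixes a b :: "'a::t2_space"
  assumes "(f \<longlongrightarrow> a) F" "(g \<longlongrightarrow> b) F" "\<forall>\<^sub>F x in F. f x = g x" "F \<noteq> bot"
  shows "a = b"
  using assms(4,1) assms(2)[folded tendsto_cong[OF assms(3)]] by (rule tendsto_unique)

section \<open>The square root in the profile and its bounds\<close>

locale majda =
  fixes q k s up :: real
  assumes q_pos: "q > 0" and k_pos: "k > 0" and up_nonneg: "up \<ge> 0" and up_less: "up < s"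
    and q_small: "2 * q * s < (s - up)\<^sup>2"
begin

lemma s_pos: "s > 0" using up_nonneg up_less by simp

abbreviation R :: "real \<Rightarrow> real" where "R \<equiv> znd_root q k s up"

text \<open>The limit of \<open>R\<close> at minus infinity, that is \<open>um - s\<close>. The
  bound on q makes it positive, so u - s stays away from zero along the whole reaction zone and the
  eigenvalue equation remains regular.\<close>

definition R0 :: real where "R0 = sqrt ((s - up)\<^sup>2 - 2 * q * s)"

lemma R0_pos: "R0 > 0" and R0_sq: "R0\<^sup>2 = (s - up)\<^sup>2 - 2 * q * s"
  using q_small by (simp_all add: R0_def)

lemma R_eq: "R \<xi> = sqrt (R0\<^sup>2 + 2 * q * s * exp (k / s * \<xi>))"
  unfolding znd_root_def R0_sq by (simp add: power2_diff algebra_simps)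

lemma R_gt: "R0 < R \<xi>"
proof -
  have "R0\<^sup>2 < R0\<^sup>2 + 2 * q * s * exp (k / s * \<xi>)" using q_pos s_pos by simp
  then show ?thesis unfolding R_eq by (rule real_less_rsqrt)
qed

lemma R_pos: "R \<xi> > 0" using R0_pos R_gt[of \<xi>] by simp

lemma R_sq: "(R \<xi>)\<^sup>2 = R0\<^sup>2 + 2 * q * s * exp (k / s * \<xi>)"
  using q_pos s_pos by (simp add: R_eq)

lemma R_sq': "(R \<xi>)\<^sup>2 = (s - up)\<^sup>2 + 2 * q * s * (exp (k / s * \<xi>) - 1)"
  by (simp add: R_sq R0_sq algebra_simps)

lemma R_zero: "R 0 = s - up"
  using up_less by (simp add: R_eq R0_sq)

lemma R_mono: "\<xi> \<le> \<eta> \<Longrightarrow> R \<xi> \<le> R \<eta>"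
  unfolding R_eq using q_pos s_pos k_pos
  by (auto intro!: real_sqrt_le_mono mult_left_mono divide_right_mono)

lemma R_le: "\<xi> \<le> 0 \<Longrightarrow> R \<xi> \<le> s - up"
  using R_mono[of \<xi> 0] by (simp add: R_zero)

lemma R_deriv: "(R has_real_derivative q * k * exp (k / s * \<xi>) / R \<xi>) (at \<xi>)"
proof -
  have "R0\<^sup>2 + 2 * q * s * exp (k / s * \<xi>) > 0"
    using R_pos[of \<xi>] R_sq[of \<xi>] by (metis zero_less_power)
  then have "((\<lambda>\<xi>. sqrt (R0\<^sup>2 + 2 * q * s * exp (k / s * \<xi>))) has_real_derivative
      q * k * exp (k / s * \<xi>) / sqrt (R0\<^sup>2 + 2 * q * s * exp (k / s * \<xi>))) (at \<xi>)"
    using s_pos by (auto intro!: derivative_eq_intros simp: field_simps)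
  then show ?thesis unfolding R_eq .
qed

lemma R_deriv_within [derivative_intros]:
  "(f has_real_derivative f') (at x within S) \<Longrightarrow>
    ((\<lambda>x. R (f x)) has_real_derivative q * k * exp (k / s * f x) / R (f x) * f') (at x within S)"
  by (rule DERIV_chain2[OF R_deriv])

lemma continuous_on_R [continuous_intros]: "continuous_on S f \<Longrightarrow> continuous_on S (\<lambda>x. R (f x))"
  by (rule continuous_on_compose2[of UNIV R])
    (auto intro!: continuous_at_imp_continuous_on DERIV_isCont[OF R_deriv])

lemma tendsto_exp_at_bot: "((\<lambda>\<xi>. exp (k / s * \<xi>)) \<longlongrightarrow> 0) at_bot"
  using k_pos s_pos
  by (intro filterlim_compose[OF exp_at_bot]
      filterlim_tendsto_pos_mult_at_bot[OF tendsto_const _ filterlim_ident]) simp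

lemma tendsto_R_at_bot: "(R \<longlongrightarrow> R0) at_bot"
proof -
  have "((\<lambda>\<xi>. sqrt (R0\<^sup>2 + 2 * q * s * exp (k / s * \<xi>))) \<longlongrightarrow> sqrt (R0\<^sup>2 + 2 * q * s * 0)) at_bot"
    by (intro tendsto_intros tendsto_exp_at_bot)
  then show ?thesis using R0_pos by (simp add: R_eq[abs_def])
qed

lemma tendsto_R_0: "(R \<longlongrightarrow> s - up) (at 0 within S)"
  using DERIV_isCont[OF R_deriv[of 0]] tendsto_within_subset[of R "nhds (s - up)" 0 UNIV S]
  by (simp add: isCont_def R_zero)

end

text \<open>The endpoints \<open>s + R0\<close> and \<open>2 * s - up\<close> are the value of u at
  minus infinity and its value just behind the shock.\<close>

locale majda_ignition = majda +
  fixes \<phi> :: "real \<Rightarrow> real"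
  assumes ignition_0: "\<exists>N. open N \<and> up \<in> N \<and> (\<forall>v\<in>N. \<phi> v = 0)"
    and ignition_1: "\<exists>N. open N \<and> {s + R0..2 * s - up} \<subseteq> N \<and> (\<forall>v\<in>N. \<phi> v = 1)"
begin

text \<open>Information is transported from plus infinity to the left: the unburnt state fixes the
  conserved quantity and the profile ahead of the shock, the shock fixes the state at 0 from the
  left, and that state fixes the reaction zone.\<close>

lemma detonation_profile:
  assumes det: "strong_ZND_detonation q k \<phi> s um up ub zb"
  shows "\<xi> > 0 \<Longrightarrow> ub \<xi> = up \<and> zb \<xi> = 1"
    and "\<xi> < 0 \<Longrightarrow> ub \<xi> = s + R \<xi> \<and> zb \<xi> = exp (k / s * \<xi>)"
proof -
  obtain N0 where N0: "open N0" "up \<in> N0" "\<And>v. v \<in> N0 \<Longrightarrow> \<phi> v = 0" using ignition_0 by blast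
  obtain N1 where N1: "open N1" "{s + R0..2 * s - up} \<subseteq> N1" "\<And>v. v \<in> N1 \<Longrightarrow> \<phi> v = 1"
    using ignition_1 by blast
  have weak: "majda_weak_solution q k \<phi> (\<lambda>(x, t). ub (x - s * t)) (\<lambda>(x, t). zb (x - s * t))"
    and cu: "continuous_on {..<0} ub" "continuous_on {0<..} ub"
    and cz: "continuous_on {..<0} zb" "continuous_on {0<..} zb"
    and ltop: "(ub \<longlongrightarrow> up) at_top" "(zb \<longlongrightarrow> 1) at_top"
    using det by (auto simp: strong_ZND_detonation_def smooth_on_imp_continuous_on)
  obtain l r where l: "((\<lambda>\<xi>. (ub \<xi>, zb \<xi>)) \<longlongrightarrow> l) (at_left 0)"
    and r: "((\<lambda>\<xi>. (ub \<xi>, zb \<xi>)) \<longlongrightarrow> r) (at_right 0)" and "l \<noteq> r"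
    using det unfolding strong_ZND_detonation_def by blast
  have cu': "continuous_on I ub" and cz': "continuous_on I zb" if "I \<subseteq> {..<0} \<or> I \<subseteq> {0<..}" for I
    using that cu cz continuous_on_subset by blast+

  have ode: "g integrable_on {\<alpha>..\<beta>} \<and> H \<alpha> - H \<beta> = integral {\<alpha>..\<beta>} g"
    if w: "\<And>a a'. test1 a a' \<Longrightarrow> has_bochner_integral lborel (\<lambda>x. H x * a' x - g x * a x) 0"
      and H: "continuous_on {..<0} H" "continuous_on {0<..} H"
      and "\<alpha> < \<beta>" "\<alpha> \<noteq> 0" "\<beta> \<noteq> 0" for \<alpha> \<beta> and H g :: "real \<Rightarrow> real"
  proof -
    \<comment> \<open>Keeps [\<alpha>, \<alpha> + d] and [\<beta>, \<beta> + d] each on one side of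
      the shock, even when \<alpha> and \<beta> lie on opposite sides.\<close>
    define d where "d = min (\<bar>\<alpha>\<bar>) (\<bar>\<beta>\<bar>) / 2"
    have "d > 0" using that by (simp add: d_def)
    have sub: "{x..x + d} \<subseteq> {..<0} \<or> {x..x + d} \<subseteq> {0<..}" if "x = \<alpha> \<or> x = \<beta>" for x
      using that \<open>\<alpha> \<noteq> 0\<close> \<open>\<beta> \<noteq> 0\<close> unfolding d_def by (auto simp: min_def abs_if split: if_splits)
    have "continuous_on {\<alpha>..\<alpha> + d} H" "continuous_on {\<beta>..\<beta> + d} H"
      using sub[of \<alpha>] sub[of \<beta>] H continuous_on_subset by blast+
    then show ?thesis using weak_ode[OF w \<open>\<alpha> < \<beta>\<close> \<open>d > 0\<close>] by blast
  qed

  define F where "F \<xi> = (ub \<xi>)\<^sup>2 / 2 - s * (ub \<xi> + q * zb \<xi>)" for \<xi>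
  have cF: "continuous_on {..<0} F" "continuous_on {0<..} F"
    unfolding F_def using cu cz by (auto intro!: continuous_intros)
  \<comment> \<open>The case \<alpha> < 0 < \<beta> contains the Rankine-Hugoniot condition.\<close>
  have F_eq: "F \<alpha> = F \<beta>" if "\<alpha> < \<beta>" "\<alpha> \<noteq> 0" "\<beta> \<noteq> 0" for \<alpha> \<beta>
  proof -
    have "has_bochner_integral lborel (\<lambda>x. F x * a' x - 0 * a x) 0" if "test1 a a'" for a a'
      unfolding F_def
      by (rule travelling_weak_solution[OF _ that])
        (use weak in \<open>simp add: majda_weak_solution_def case_prod_unfold\<close>)
    from ode[OF this cF that] show ?thesis by simp
  qed
  have F_const: "F \<xi> = up\<^sup>2 / 2 - s * (up + q)" if "\<xi> \<noteq> 0" for \<xi>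
  proof -
    have "(F \<longlongrightarrow> up\<^sup>2 / 2 - s * (up + q * 1)) at_top"
      unfolding F_def by (intro tendsto_intros ltop) auto
    moreover have "\<forall>\<^sub>F \<eta> in at_top. F \<eta> = F \<xi>"
      using eventually_gt_at_top[of "max \<xi> 0"]
      by eventually_elim (use F_eq[of \<xi>] that in auto)
    then have "(F \<longlongrightarrow> F \<xi>) at_top" by (rule tendsto_eventually)
    ultimately show ?thesis using tendsto_unique[of "at_top :: real filter"] by fastforce
  qed
  \<comment> \<open>Completing the square in the conserved quantity; from here on u is a function of
    z and of the sign of u - s.\<close>
  have quad: "(ub \<xi> - s)\<^sup>2 = (s - up)\<^sup>2 + 2 * q * s * (zb \<xi> - 1)" if "\<xi> \<noteq> 0" for \<xi>
    using F_const[OF that] by (simp add: F_def power2_eq_square field_simps)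

  define g where "g \<xi> = k * \<phi> (ub \<xi>) * zb \<xi>" for \<xi>
  have gz: "g integrable_on {\<alpha>..\<beta>}" "s * (zb \<beta> - zb \<alpha>) = integral {\<alpha>..\<beta>} g"
    if "\<alpha> < \<beta>" "\<alpha> \<noteq> 0" "\<beta> \<noteq> 0" for \<alpha> \<beta>
  proof -
    have w: "has_bochner_integral lborel (\<lambda>x. (0 - s * zb x) * a' x - g x * a x) 0"
      if "test1 a a'" for a a'
      unfolding g_def
      by (rule travelling_weak_solution[OF _ that])
        (use weak in \<open>simp add: majda_weak_solution_def case_prod_unfold\<close>)
    have c: "continuous_on {..<0} (\<lambda>x. 0 - s * zb x)" "continuous_on {0<..} (\<lambda>x. 0 - s * zb x)"
      by (intro continuous_intros cz)+
    have "g integrable_on {\<alpha>..\<beta>} \<and> 0 - s * zb \<alpha> - (0 - s * zb \<beta>) = integral {\<alpha>..\<beta>} g"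
      using ode[OF w c that] .
    then show "g integrable_on {\<alpha>..\<beta>}" "s * (zb \<beta> - zb \<alpha>) = integral {\<alpha>..\<beta>} g"
      by (auto simp: algebra_simps)
  qed
  \<comment> \<open>Where ignition has the constant value c the reactant equation is z' = (c k / s)
    z; it is applied with c = 0 ahead of the shock and c = 1 behind it.\<close>
  have zexp: "\<exists>A. \<forall>x\<in>I. zb x = A * exp (c * k / s * x)"
    if "open I" "convex I" and I: "I \<subseteq> {..<0} \<or> I \<subseteq> {0<..}" and c: "\<And>x. x \<in> I \<Longrightarrow> \<phi> (ub x) = c" for I c
  proof (rule linear_ode_exp[OF that(1,2) cz'[OF I]])
    fix \<alpha> \<beta> assume ab: "\<alpha> \<in> I" "\<beta> \<in> I" "\<alpha> < \<beta>"
    have sub: "{\<alpha>..\<beta>} \<subseteq> I"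
      using closed_segment_subset[OF ab(1,2) \<open>convex I\<close>] ab(3) by (simp add: closed_segment_eq_real_ivl)
    have "\<alpha> \<noteq> 0" "\<beta> \<noteq> 0" using ab I by auto
    then have "s * (zb \<beta> - zb \<alpha>) = integral {\<alpha>..\<beta>} g" using gz ab by blast
    also have "\<dots> = integral {\<alpha>..\<beta>} (\<lambda>x. s * (c * k / s * zb x))"
      using sub s_pos by (intro Henstock_Kurzweil_Integration.integral_cong) (auto simp: g_def c subset_iff)
    also have "\<dots> = s * integral {\<alpha>..\<beta>} (\<lambda>x. c * k / s * zb x)"
      by (rule integral_mult_right)
    finally show "zb \<beta> - zb \<alpha> = integral {\<alpha>..\<beta>} (\<lambda>x. c * k / s * zb x)"
      using s_pos by (simp add: field_simps)
  qed

  have right: "ub \<xi> = up \<and> zb \<xi> = 1" if "\<xi> > 0" for \<xi>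
  proof -
    have burnt: "(\<forall>y\<in>I. zb y = A)"
      if I: "open I" "convex I" "I \<subseteq> {0<..}" "\<And>x. x \<in> I \<Longrightarrow> ub x \<in> N0" "x \<in> I" "zb x = A" for I x A
    proof -
      obtain B where "\<forall>y\<in>I. zb y = B * exp (0 * k / s * y)"
        using zexp[of I 0] I(1-4) N0(3) by blast
      then show ?thesis using I(5,6) by simp
    qed
    \<comment> \<open>At z = 1 the roots are \<open>up\<close> and \<open>2 * s - up\<close>; lying
      below s picks the first.\<close>
    have from_z: "ub y = up" if "zb y = 1" "y > 0" "ub y < s" for y
      using quad[of y] that up_less by (auto simp: power2_eq_iff)
    have "\<forall>\<^sub>F \<xi> in at_top. ub \<xi> \<in> N0 \<and> ub \<xi> < s \<and> \<xi> > 0"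
      using topological_tendstoD[OF ltop(1) N0(1,2)] order_tendstoD(2)[OF ltop(1) up_less]
        eventually_gt_at_top[of 0] by eventually_elim simp
    then obtain X where X: "\<And>x. x \<ge> X \<Longrightarrow> ub x \<in> N0 \<and> ub x < s \<and> x > 0"
      unfolding eventually_at_top_linorder by blast
    have "\<forall>y\<in>{X<..}. zb y = zb (X + 1)"
    proof (rule burnt[of "{X<..}" "X + 1"])
      show "{X<..} \<subseteq> {0<..}" using X[of X] by auto
      show "ub x \<in> N0" if "x \<in> {X<..}" for x using X[of x] that by simp
    qed auto
    then have "\<forall>\<^sub>F y in at_top. zb y = zb (X + 1)"
      by (intro eventually_mono[OF eventually_gt_at_top[of X]]) blast
    then have "(zb \<longlongrightarrow> zb (X + 1)) at_top" by (rule tendsto_eventually)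
    then have "zb (X + 1) = 1"
      using tendsto_unique[OF trivial_limit_at_top_linorder _ ltop(2)] by blast
    then have start: "(ub (X + 1), zb (X + 1)) = (up, 1)"
      using from_z[of "X + 1"] X[of "X + 1"] by auto
    have "(ub \<xi>, zb \<xi>) = (up, 1)"
    proof (rule continuation_eqI[of "{0<..}" "\<lambda>x. (ub x, zb x)" "\<lambda>x. (up, 1)" "X + 1"])
      fix x assume x: "x \<in> {0<..}" "(ub x, zb x) = (up, 1)"
      \<comment> \<open>On this open set ignition is off and the root is decided, so agreement at
        one point propagates to a ball.\<close>
      define W where "W = {0<..} \<inter> ub -` (N0 \<inter> {..<s})"
      have "open W" unfolding W_def
        by (rule continuous_open_preimage[OF cu(2)]) (use N0 in auto)
      moreover have "x \<in> W" using x N0 up_less by (simp add: W_def)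
      ultimately obtain e where e: "e > 0" "ball x e \<subseteq> W" using open_contains_ball by blast
      have "\<forall>y\<in>ball x e. zb y = 1"
        by (rule burnt[of _ x]) (use e x in \<open>auto simp: W_def\<close>)
      then have "\<forall>y\<in>ball x e. (ub y, zb y) = (up, 1)"
        using e(2) from_z unfolding W_def by blast
      then show "\<exists>U. open U \<and> x \<in> U \<and> U \<subseteq> {0<..} \<and> (\<forall>y\<in>U. (ub y, zb y) = (up, 1))"
        using e by (intro exI[of _ "ball x e"]) (auto simp: W_def)
    qed (use \<open>\<xi> > 0\<close> start X[of "X + 1"] cu cz in \<open>auto intro!: continuous_intros\<close>)
    then show ?thesis by simp
  qed
  then show "\<xi> > 0 \<Longrightarrow> ub \<xi> = up \<and> zb \<xi> = 1" .

  have lu: "(ub \<longlongrightarrow> fst l) (at_left 0)" and lz: "(zb \<longlongrightarrow> snd l) (at_left 0)"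
    using tendsto_fst[OF l] tendsto_snd[OF l] by simp_all
  have "r = (up, 1)"
  proof (rule tendsto_unique_eventually_eq[OF r tendsto_const])
    show "\<forall>\<^sub>F x in at_right 0. (ub x, zb x) = (up, 1)"
      using right by (intro eventually_mono[OF eventually_at_right_less]) auto
  qed simp
  \<comment> \<open>Since z differs from an indefinite integral only by a constant, it has equal
    limits from both sides of the shock, and the right one is 1.\<close>
  have "snd l = 1"
  proof -
    define h where "h x = integral {-1..x} g" for x
    have "g integrable_on {-1..1}" using gz(1)[of "-1" 1] by simp
    then have "continuous_on {-1..1} h"
      unfolding h_def by (rule indefinite_integral_continuous_1)
    then have "(h \<longlongrightarrow> h 0) (at 0 within {-1..1})" by (simp add: continuous_on)
    then have h: "(h \<longlongrightarrow> h 0) (at 0)"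
      by (simp add: at_within_Icc_at)
    have zh: "zb x = zb (-1) + h x / s" if "x > -1" "x \<noteq> 0" for x
      using gz(2)[of "-1" x] that s_pos by (simp add: h_def field_simps)
    have lim: "((\<lambda>x. zb (-1) + h x / s) \<longlongrightarrow> zb (-1) + h 0 / s) (at 0 within S)" for S
      by (intro tendsto_intros tendsto_within_subset[OF h]) (use s_pos in auto)
    have "\<forall>\<^sub>F x in at_left 0. zb x = zb (-1) + h x / s"
      by (rule eventually_mono[OF eventually_at_left_real[of "-1" "0::real"]]) (auto intro!: zh)
    then have "snd l = zb (-1) + h 0 / s"
      by (rule tendsto_unique_eventually_eq[OF lz lim]) simp
    moreover have "zb (-1) + h 0 / s = 1"
    proof (rule tendsto_unique_eventually_eq[OF lim tendsto_const])
      show "\<forall>\<^sub>F x in at_right 0. zb (-1) + h x / s = 1"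
      proof (rule eventually_mono[OF eventually_at_right_less])
        show "zb (-1) + h x / s = 1" if "0 < x" for x
          using right[OF that] zh[of x] that by simp
      qed
    qed simp
    ultimately show ?thesis by simp
  qed
  have "fst l = 2 * s - up"
  proof -
    have "(fst l - s)\<^sup>2 = (s - up)\<^sup>2 + 2 * q * s * (snd l - 1)"
    proof (rule tendsto_unique_eventually_eq)
      show "((\<lambda>\<xi>. (ub \<xi> - s)\<^sup>2) \<longlongrightarrow> (fst l - s)\<^sup>2) (at_left 0)"
        by (intro tendsto_intros lu)
      show "((\<lambda>\<xi>. (s - up)\<^sup>2 + 2 * q * s * (zb \<xi> - 1)) \<longlongrightarrow>
          (s - up)\<^sup>2 + 2 * q * s * (snd l - 1)) (at_left 0)"
        by (intro tendsto_intros lz)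
      show "\<forall>\<^sub>F \<xi> in at_left 0. (ub \<xi> - s)\<^sup>2 = (s - up)\<^sup>2 + 2 * q * s * (zb \<xi> - 1)"
        by (rule eventually_mono[OF eventually_at_left_real[of "-1" "0::real"]]) (auto intro!: quad)
    qed simp
    then have "(fst l - s)\<^sup>2 = (s - up)\<^sup>2" using \<open>snd l = 1\<close> by simp
    \<comment> \<open>The shock has to be genuine. As z does not jump, u does, which leaves the
      reflected root \<open>2 * s - up\<close>.\<close>
    moreover have "fst l \<noteq> up"
      using \<open>l \<noteq> r\<close> \<open>r = (up, 1)\<close> \<open>snd l = 1\<close> by (metis prod.collapse)
    ultimately show ?thesis by (auto simp: power2_eq_iff)
  qed

  have in_N1: "s + R \<xi> \<in> N1" if "\<xi> \<le> 0" for \<xi>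
    using N1(2) R_gt[of \<xi>] R_le[OF that] by (auto simp: subset_iff)
  have from_z: "ub y = s + R y" if "zb y = exp (k / s * y)" "y < 0" "ub y > s" for y
  proof -
    have "(ub y - s)\<^sup>2 = (R y)\<^sup>2" using quad[of y] that by (simp add: R_sq')
    then show ?thesis using that R_pos[of y] by (auto simp: power2_eq_iff)
  qed
  have burning: "\<exists>A. \<forall>y\<in>I. zb y = A * exp (k / s * y)"
    if "open I" "convex I" "I \<subseteq> {..<0}" "\<And>x. x \<in> I \<Longrightarrow> ub x \<in> N1" for I
    using zexp[of I 1] that N1(3) by simp
  have left: "(ub \<xi>, zb \<xi>) = (s + R \<xi>, exp (k / s * \<xi>))" if "\<xi> < 0" for \<xi>
  proof -
    have "2 * s - up \<in> N1" "2 * s - up > s" using in_N1[of 0] up_less by (simp_all add: R_zero)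
    then have "\<forall>\<^sub>F x in at_left 0. ub x \<in> N1 \<and> ub x > s"
      using topological_tendstoD[OF lu N1(1)] order_tendstoD(1)[OF lu, of s] \<open>fst l = 2 * s - up\<close>
      by (auto intro: eventually_conj)
    then obtain b where b: "b < 0" "\<And>x. b < x \<Longrightarrow> x < 0 \<Longrightarrow> ub x \<in> N1 \<and> ub x > s"
      by (auto simp: eventually_at_left_field)
    have "\<exists>A. \<forall>y\<in>{b<..<0}. zb y = A * exp (k / s * y)"
      by (rule burning) (use b in auto)
    then obtain A where A: "\<forall>y\<in>{b<..<0}. zb y = A * exp (k / s * y)" ..
    \<comment> \<open>The constant is fixed by z tending to 1 at the shock.\<close>
    have "((\<lambda>y. A * exp (k / s * y)) \<longlongrightarrow> A * exp (k / s * 0)) (at_left 0)"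
      by (intro tendsto_intros)
    moreover have "\<forall>\<^sub>F y in at_left 0. A * exp (k / s * y) = zb y"
      using A by (intro eventually_mono[OF eventually_at_left_real[OF b(1)]]) auto
    ultimately have "A * exp (k / s * 0) = snd l"
      by (rule tendsto_unique_eventually_eq[OF _ lz]) simp
    then have "A = 1" using \<open>snd l = 1\<close> by simp
    then have start: "(ub (b / 2), zb (b / 2)) = (s + R (b / 2), exp (k / s * (b / 2)))"
      using A b from_z[of "b / 2"] by auto
    show ?thesis
    proof (rule continuation_eqI[of "{..<0}" "\<lambda>x. (ub x, zb x)" "\<lambda>x. (s + R x, exp (k / s * x))" "b / 2"])
      fix x assume x: "x \<in> {..<0}" "(ub x, zb x) = (s + R x, exp (k / s * x))"
      define W where "W = {..<0} \<inter> ub -` (N1 \<inter> {s<..})"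
      have "open W" unfolding W_def
        by (rule continuous_open_preimage[OF cu(1)]) (use N1 in auto)
      moreover have "x \<in> W" using x in_N1[of x] R_pos[of x] by (simp add: W_def)
      ultimately obtain e where e: "e > 0" "ball x e \<subseteq> W" using open_contains_ball by blast
      have "\<exists>A. \<forall>y\<in>ball x e. zb y = A * exp (k / s * y)"
        by (rule burning) (use e(2) in \<open>auto simp: W_def\<close>)
      then obtain A where A: "\<forall>y\<in>ball x e. zb y = A * exp (k / s * y)" ..
      moreover have "x \<in> ball x e" using e(1) by simp
      ultimately have "exp (k / s * x) = A * exp (k / s * x)" using x by (metis prod.inject)
      then have "A = 1" by simp
      with A have "\<forall>y\<in>ball x e. zb y = exp (k / s * y)" by simp
      then have "\<forall>y\<in>ball x e. (ub y, zb y) = (s + R y, exp (k / s * y))"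
        using e(2) from_z unfolding W_def by blast
      then show "\<exists>U. open U \<and> x \<in> U \<and> U \<subseteq> {..<0} \<and>
          (\<forall>y\<in>U. (ub y, zb y) = (s + R y, exp (k / s * y)))"
        using e by (intro exI[of _ "ball x e"]) (auto simp: W_def)
    qed (use \<open>\<xi> < 0\<close> start b(1) cu cz s_pos in \<open>auto intro!: continuous_intros\<close>)
  qed
  then show "\<xi> < 0 \<Longrightarrow> ub \<xi> = s + R \<xi> \<and> zb \<xi> = exp (k / s * \<xi>)" by simp
qed

end

section \<open>Existence of the detonation\<close>

text \<open>Every iterated derivative of \<open>F\<close> agrees on \<open>S\<close> with a member
  of the class \<open>Q\<close>. Only agreement on the open set is available, because the profile
  itself jumps elsewhere; openness lets derivatives be transferred.\<close>

lemma smooth_on_derivative_closed: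
  assumes "open S" and "Q f" and F: "\<And>x. x \<in> S \<Longrightarrow> F x = f x"
    and closed: "\<And>f. Q f \<Longrightarrow> \<exists>g. Q g \<and> (\<forall>x\<in>S. (f has_real_derivative g x) (at x))"
  shows "smooth_on S F"
proof -
  have deriv_eq: "(G has_real_derivative h x) (at x)"
    if "\<forall>x\<in>S. (g has_real_derivative h x) (at x)" "\<forall>x\<in>S. G x = g x" "x \<in> S" for G g h x
  proof (rule has_field_derivative_transform_within_open[OF _ \<open>open S\<close> \<open>x \<in> S\<close>])
    show "(g has_real_derivative h x) (at x)" using that by blast
  qed (use that in simp)
  have *: "\<exists>h. Q h \<and> (\<forall>x\<in>S. (deriv ^^ n) F x = h x)" for n
  proof (induction n)
    case 0
    then show ?case using assms(2) F by auto
  next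
    case (Suc n)
    then obtain h where h: "Q h" "\<forall>x\<in>S. (deriv ^^ n) F x = h x" by blast
    obtain g where g: "Q g" "\<forall>x\<in>S. (h has_real_derivative g x) (at x)" using closed[OF h(1)] by blast
    have "(deriv ^^ Suc n) F x = g x" if "x \<in> S" for x
      using DERIV_imp_deriv[OF deriv_eq[OF g(2) h(2) that]] by simp
    then show ?case using g by blast
  qed
  have "(deriv ^^ n) F differentiable (at x)" if x: "x \<in> S" for n x
  proof -
    obtain h where h: "Q h" "\<forall>x\<in>S. (deriv ^^ n) F x = h x" using * by blast
    obtain g where g: "Q g" "\<forall>x\<in>S. (h has_real_derivative g x) (at x)" using closed[OF h(1)] by blast
    show ?thesis using deriv_eq[OF g(2) h(2) x] real_differentiable_def by blast
  qed
  then show ?thesis unfolding smooth_on_def by blast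
qed

lemma smooth_on_eq_const:
  assumes "open S" "\<And>x. x \<in> S \<Longrightarrow> F x = c"
  shows "smooth_on S F"
proof (rule smooth_on_derivative_closed[OF assms(1), of "\<lambda>f. \<exists>c. f = (\<lambda>x. c)" "\<lambda>x. c"])
  fix f :: "real \<Rightarrow> real" assume "\<exists>c. f = (\<lambda>x. c)"
  then obtain d where "f = (\<lambda>x. d)" ..
  then have "\<forall>x\<in>S. (f has_real_derivative (\<lambda>x. 0) x) (at x)" by simp
  then show "\<exists>g. (\<exists>c. g = (\<lambda>x. c)) \<and> (\<forall>x\<in>S. (f has_real_derivative g x) (at x))" by blast
next
  show "\<exists>c'. (\<lambda>x. c) = (\<lambda>x. c')" by (rule exI) (rule refl)
  show "F x = c" if "x \<in> S" for x using assms(2) that .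
qed

section \<open>Arbitrary test functions in the moving frame\<close>

lemma test_function_shear:
  assumes "test_function \<psi> \<psi>x \<psi>t"
  shows "test_function (\<lambda>p. \<psi> (fst p + s * snd p, snd p)) (\<lambda>p. \<psi>x (fst p + s * snd p, snd p))
    (\<lambda>p. s * \<psi>x (fst p + s * snd p, snd p) + \<psi>t (fst p + s * snd p, snd p))"
proof -
  let ?T = "\<lambda>p :: real \<times> real. (fst p + s * snd p, snd p)"
  let ?S = "\<lambda>p :: real \<times> real. (fst p - s * snd p, snd p)"
  have comp: "compact (closure {p. \<psi> p \<noteq> 0})"
    and der: "\<And>p. (\<psi> has_derivative (\<lambda>h. fst h * \<psi>x p + snd h * \<psi>t p)) (at p)"
    and cont: "continuous_on UNIV \<psi>x" "continuous_on UNIV \<psi>t"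
    using assms by (auto simp: test_function_def)
  have "{p. \<psi> (?T p) \<noteq> 0} \<subseteq> ?S ` closure {p. \<psi> p \<noteq> 0}"
  proof
    fix p assume "p \<in> {p. \<psi> (?T p) \<noteq> 0}"
    then have "?T p \<in> {p. \<psi> p \<noteq> 0}" by simp
    then have "?T p \<in> closure {p. \<psi> p \<noteq> 0}" by (rule subsetD[OF closure_subset])
    moreover have "p = ?S (?T p)" by simp
    ultimately show "p \<in> ?S ` closure {p. \<psi> p \<noteq> 0}" by (rule image_eqI[rotated])
  qed
  moreover have "compact (?S ` closure {p. \<psi> p \<noteq> 0})"
    by (intro compact_continuous_image comp continuous_intros)
  ultimately have "compact (closure {p. \<psi> (?T p) \<noteq> 0})"
    unfolding compact_closure by (intro bounded_subset[OF compact_imp_bounded])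
  moreover have "((\<lambda>p. \<psi> (?T p)) has_derivative
      (\<lambda>h. fst h * \<psi>x (?T p) + snd h * (s * \<psi>x (?T p) + \<psi>t (?T p)))) (at p)" for p
    by (rule has_derivative_compose[OF _ der, THEN has_derivative_eq_rhs])
      (auto intro!: derivative_eq_intros simp: fun_eq_iff algebra_simps)
  moreover have "continuous_on UNIV (\<lambda>p. \<psi>x (?T p))" "continuous_on UNIV (\<lambda>p. s * \<psi>x (?T p) + \<psi>t (?T p))"
    by (intro continuous_intros continuous_on_compose2[OF cont(1)] continuous_on_compose2[OF cont(2)]; simp)+
  ultimately show ?thesis unfolding test_function_def by blast
qed

text \<open>Prepares Fubini: after slicing, the one-variable facts on integrals of derivatives apply
  for each frozen coordinate.\<close>

lemma test_function_slices:
  assumes "test_function \<psi> \<psi>x \<psi>t"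
  shows "test1 (\<lambda>x. \<psi> (x, t)) (\<lambda>x. \<psi>x (x, t))" and "test1 (\<lambda>t. \<psi> (x, t)) (\<lambda>t. \<psi>t (x, t))"
proof -
  have der: "\<And>p. (\<psi> has_derivative (\<lambda>h. fst h * \<psi>x p + snd h * \<psi>t p)) (at p)"
    and cont: "continuous_on UNIV \<psi>x" "continuous_on UNIV \<psi>t"
    using assms by (auto simp: test_function_def)
  have "bounded (closure {p. \<psi> p \<noteq> 0})"
    using assms by (auto simp: test_function_def intro: compact_imp_bounded)
  then obtain M where "\<forall>p\<in>closure {p. \<psi> p \<noteq> 0}. norm p \<le> M"
    unfolding bounded_iff ..
  then have "\<forall>p\<in>{p. \<psi> p \<noteq> 0}. norm p \<le> M"
    by (intro ballI) (metis closure_subset subsetD)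
  then have M: "\<psi> p = 0" if "norm p > M" for p
    using that by (metis leD mem_Collect_eq)
  have "((\<lambda>x. \<psi> (x, t)) has_real_derivative \<psi>x (x, t)) (at x)" for x t
    unfolding has_field_derivative_def
    by (rule has_derivative_compose[OF _ der, THEN has_derivative_eq_rhs])
      (auto intro!: derivative_eq_intros simp: fun_eq_iff)
  moreover have "\<psi> (x, t) = 0" if "\<bar>x\<bar> > M" for x t
    using M[of "(x, t)"] norm_fst_le[of x t] that by simp
  moreover have "continuous_on UNIV (\<lambda>x. \<psi>x (x, t))"
    by (intro continuous_intros continuous_on_compose2[OF cont(1)]) auto
  ultimately show "test1 (\<lambda>x. \<psi> (x, t)) (\<lambda>x. \<psi>x (x, t))" unfolding test1_def by blast
  have "((\<lambda>t. \<psi> (x, t)) has_real_derivative \<psi>t (x, t)) (at t)" for x t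
    unfolding has_field_derivative_def
    by (rule has_derivative_compose[OF _ der, THEN has_derivative_eq_rhs])
      (auto intro!: derivative_eq_intros simp: fun_eq_iff)
  moreover have "\<psi> (x, t) = 0" if "\<bar>t\<bar> > M" for x t
    using M[of "(x, t)"] norm_snd_le[of t x] that by simp
  moreover have "continuous_on UNIV (\<lambda>t. \<psi>t (x, t))"
    by (intro continuous_intros continuous_on_compose2[OF cont(2)]) auto
  ultimately show "test1 (\<lambda>t. \<psi> (x, t)) (\<lambda>t. \<psi>t (x, t))" unfolding test1_def by blast
qed

lemma integrable_bounded_mult_compact_support:
  fixes V :: "real \<Rightarrow> real" and g :: "real \<times> real \<Rightarrow> real"
  assumes [measurable]: "V \<in> borel_measurable borel" and V: "\<And>x. \<bar>V x\<bar> \<le> B"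
    and g: "continuous_on UNIV g" and K: "compact K" "\<And>p. p \<notin> K \<Longrightarrow> g p = 0"
  shows "integrable lborel (\<lambda>p. V (fst p) * g p)"
proof (rule Bochner_Integration.integrable_bound)
  have "integrable lborel (\<lambda>p. indicator K p *\<^sub>R g p)"
    by (intro borel_integrable_compact continuous_on_subset[OF g] K) auto
  also have "(\<lambda>p. indicator K p *\<^sub>R g p) = g" using K(2) by (auto simp: fun_eq_iff indicator_def)
  finally show "integrable lborel (\<lambda>p. B * g p)" by simp
  have [measurable]: "g \<in> borel_measurable borel" using g by (rule borel_measurable_continuous_onI)
  have "fst \<in> borel_measurable (borel :: (real \<times> real) measure)"
    by (intro borel_measurable_continuous_onI continuous_intros)
  then show "(\<lambda>p. V (fst p) * g p) \<in> borel_measurable lborel"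
    by simp
  show "AE p in lborel. norm (V (fst p) * g p) \<le> norm (B * g p)"
    using order_trans[OF V abs_ge_self]
    by (intro always_eventually allI) (simp add: abs_mult mult_right_mono)
qed

lemma test_function_integrable:
  fixes V :: "real \<Rightarrow> real"
  assumes \<psi>: "test_function \<psi> \<psi>x \<psi>t" and V: "V \<in> borel_measurable borel" "\<And>x. \<bar>V x\<bar> \<le> B"
  shows "integrable lborel (\<lambda>p. V (fst p) * \<psi> p)" "integrable lborel (\<lambda>p. V (fst p) * \<psi>x p)"
    "integrable lborel (\<lambda>p. V (fst p) * \<psi>t p)"
proof -
  define K where "K = closure {p. \<psi> p \<noteq> 0}"
  have comp: "compact K"
    and der: "\<And>p. (\<psi> has_derivative (\<lambda>h. fst h * \<psi>x p + snd h * \<psi>t p)) (at p)"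
    and cont: "continuous_on UNIV \<psi>x" "continuous_on UNIV \<psi>t"
    using \<psi> by (auto simp: test_function_def K_def)
  have c\<psi>: "continuous_on UNIV \<psi>"
    by (intro continuous_at_imp_continuous_on ballI has_derivative_continuous[OF der])
  have z: "\<psi> p = 0" if "p \<notin> K" for p
    using contra_subsetD[OF closure_subset that[unfolded K_def]] by simp
  \<comment> \<open>Off the closed support the function vanishes on a neighbourhood, so its
    derivative there is zero.\<close>
  have dz: "\<psi>x p = 0 \<and> \<psi>t p = 0" if p: "p \<notin> K" for p
  proof -
    have "(\<psi> has_derivative (\<lambda>h. 0)) (at p)"
    proof (rule has_derivative_transform_within_open[OF has_derivative_const, where s="- K"])
      show "open (- K)" using comp by (simp add: compact_imp_closed open_Compl)
      show "0 = \<psi> y" if "y \<in> - K" for y using z[of y] that by simp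
    qed (use p in simp)
    from has_derivative_unique[OF this der]
    have "0 = fst h * \<psi>x p + snd h * \<psi>t p" for h by (rule fun_cong)
    from this[of "(1, 0)"] this[of "(0, 1)"] show ?thesis by simp
  qed
  show "integrable lborel (\<lambda>p. V (fst p) * \<psi> p)" "integrable lborel (\<lambda>p. V (fst p) * \<psi>x p)"
    "integrable lborel (\<lambda>p. V (fst p) * \<psi>t p)"
    using z dz by (intro integrable_bounded_mult_compact_support[OF V _ comp] c\<psi> cont; simp)+
qed

lemma has_bochner_integral_test_function_t:
  fixes V :: "real \<Rightarrow> real"
  assumes \<psi>: "test_function \<psi> \<psi>x \<psi>t" and V: "V \<in> borel_measurable borel" "\<And>x. \<bar>V x\<bar> \<le> B"
  shows "has_bochner_integral lborel (\<lambda>p. V (fst p) * \<psi>t p) 0"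
proof -
  have int: "integrable (lborel \<Otimes>\<^sub>M lborel) (\<lambda>(x, t). V x * \<psi>t (x, t))"
    using test_function_integrable(3)[OF assms] by (simp add: lborel_prod case_prod_unfold)
  have inner: "(LINT t|lborel. V x * \<psi>t (x, t)) = 0" for x
    using test1_integral(2)[OF test_function_slices(2)[OF \<psi>, of x]] by (simp add: has_bochner_integral_iff)
  have "(LINT p|(lborel \<Otimes>\<^sub>M lborel). (case p of (x, t) \<Rightarrow> V x * \<psi>t (x, t))) = 0"
    unfolding lborel_pair.integral_fst[OF int, symmetric] inner by simp
  with int show ?thesis
    unfolding has_bochner_integral_iff by (simp add: lborel_prod case_prod_unfold)
qed

text \<open>Integration by parts in x on each line. Continuity of \<open>W\<close> at 0 is what
  prevents a boundary term at the shock; a jump of its derivative does no harm.\<close>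

lemma has_bochner_integral_test_function_x:
  fixes W W' :: "real \<Rightarrow> real"
  assumes \<psi>: "test_function \<psi> \<psi>x \<psi>t"
    and W: "continuous_on UNIV W" "\<And>x. \<bar>W x\<bar> \<le> B"
    and W': "W' \<in> borel_measurable borel" "\<And>x. \<bar>W' x\<bar> \<le> B'"
    and der: "\<And>x. x \<noteq> 0 \<Longrightarrow> (W has_real_derivative W' x) (at x)"
  shows "has_bochner_integral lborel (\<lambda>p. W (fst p) * \<psi>x p + W' (fst p) * \<psi> p) 0"
proof -
  have Wm: "W \<in> borel_measurable borel" using W(1) by (rule borel_measurable_continuous_onI)
  let ?g = "\<lambda>x t. W x * \<psi>x (x, t) + W' x * \<psi> (x, t)"
  have int: "integrable (lborel \<Otimes>\<^sub>M lborel) (\<lambda>(x, t). ?g x t)"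
    using Bochner_Integration.integrable_add[OF test_function_integrable(2)[OF \<psi> Wm W(2)]
        test_function_integrable(1)[OF \<psi> W']]
    by (simp add: lborel_prod case_prod_unfold)
  have "(LINT x|lborel. W x * a' x + W' x * a x) = 0" if a: "test1 a a'" for a a'
  proof -
    obtain M where M: "\<And>x. \<bar>x\<bar> > M \<Longrightarrow> a x = 0" using a by (auto simp: test1_def)
    define N where "N = \<bar>M\<bar> + 1"
    have da: "\<And>x. (a has_real_derivative a' x) (at x)" and ca': "continuous_on UNIV a'"
      using a by (auto simp: test1_def)
    have ca: "continuous_on UNIV a"
      using da by (auto intro!: DERIV_isCont continuous_at_imp_continuous_on)
    have a'0: "a' x = 0" if "\<bar>x\<bar> \<ge> N" for x
    proof -
      have "((\<lambda>x. 0) has_real_derivative a' x) (at x)"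
        by (rule has_field_derivative_transform_within_open[OF da, where S="{y. \<bar>y\<bar> > \<bar>M\<bar>}"])
          (use that M in \<open>auto simp: N_def intro!: open_Collect_less continuous_intros\<close>)
      then show ?thesis by (metis DERIV_const DERIV_unique)
    qed
    have a0: "a x = 0" if "\<bar>x\<bar> \<ge> N" for x using M that by (simp add: N_def)
    have "((\<lambda>x. W x * a' x + W' x * a x) has_integral W N * a N - W (- N) * a (- N)) {-N..N}"
    \<comment> \<open>This version tolerates a finite set of points without derivative, here the
      shock position.\<close>
    proof (rule fundamental_theorem_of_calculus_strong[of "{0}"])
      show "((\<lambda>x. W x * a x) has_vector_derivative W x * a' x + W' x * a x) (at x)"
        if "x \<in> {-N..N} - {0}" for x
        unfolding has_real_derivative_iff_has_vector_derivative[symmetric]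
        using that by (auto intro!: derivative_eq_intros der da)
      show "continuous_on {-N..N} (\<lambda>x. W x * a x)"
        by (intro continuous_intros continuous_on_subset[OF W(1)] continuous_on_subset[OF ca]) auto
    qed (auto simp: N_def)
    then have I: "integral {-N..N} (\<lambda>x. W x * a' x + W' x * a x) = 0"
      using a0[of N] a0[of "-N"] by (simp add: N_def integral_unique)
    have "set_integrable lborel {-N..N} (\<lambda>x. W x * a' x)"
      by (intro borel_integrable_atLeastAtMost' continuous_intros
          continuous_on_subset[OF W(1)] continuous_on_subset[OF ca']) auto
    moreover have "set_integrable lborel {-N..N} (\<lambda>x. W' x * a x)"
    proof -
      have [measurable]: "a \<in> borel_measurable borel" using ca by (rule borel_measurable_continuous_onI)
      note W'(1)[measurable]
      have "integrable lborel (\<lambda>x. W' x * a x)"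
      proof (rule Bochner_Integration.integrable_bound)
        show "integrable lborel (\<lambda>x. B' * a x)" using test1_integral(1)[OF a] by simp
        show "AE x in lborel. norm (W' x * a x) \<le> norm (B' * a x)"
          using order_trans[OF W'(2) abs_ge_self]
          by (intro always_eventually allI) (simp add: abs_mult mult_right_mono)
      qed measurable
      then show ?thesis unfolding set_integrable_def by (rule integrable_mult_indicator[rotated]) simp
    qed
    ultimately have "set_integrable lborel {-N..N} (\<lambda>x. W x * a' x + W' x * a x)"
      by (rule set_integral_add(1))
    then have "(LINT x:{-N..N}|lborel. W x * a' x + W' x * a x) = 0"
      using I set_borel_integral_eq_integral(2) by metis
    also have "(LINT x:{-N..N}|lborel. W x * a' x + W' x * a x) = (LINT x|lborel. W x * a' x + W' x * a x)"
      unfolding set_lebesgue_integral_def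
    proof (rule Bochner_Integration.integral_cong)
      show "indicator {-N..N} x *\<^sub>R (W x * a' x + W' x * a x) = W x * a' x + W' x * a x" for x
      proof (cases "\<bar>x\<bar> \<ge> N")
        case False
        then have "x \<in> {-N..N}" by auto
        then show ?thesis by simp
      qed (simp add: a0 a'0)
    qed simp
    finally show ?thesis .
  qed
  from this[OF test_function_slices(1)[OF \<psi>]]
  have inner: "(LINT x|lborel. ?g x t) = 0" for t .
  have "(LINT p|(lborel \<Otimes>\<^sub>M lborel). (case p of (x, t) \<Rightarrow> ?g x t)) = 0"
    unfolding lborel_pair.integral_snd[OF int, symmetric] inner by simp
  with int show ?thesis
    unfolding has_bochner_integral_iff by (simp add: lborel_prod case_prod_unfold)
qed

section \<open>The explicit wave and the functions generated by it\<close>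

context majda
begin

definition ub0 :: "real \<Rightarrow> real" where "ub0 \<xi> = (if \<xi> \<le> 0 then s + R \<xi> else up)"

definition zb0 :: "real \<Rightarrow> real" where "zb0 \<xi> = (if \<xi> \<le> 0 then exp (k / s * \<xi>) else 1)"

text \<open>The function algebra generated by the ingredients of the wave. Including 1 / R makes it
  closed under differentiation: with e = exp(k x / s), R' = q k e / R and (1 / R)' = - q k e /
  R^3.\<close>

inductive wave_algebra :: "(real \<Rightarrow> real) \<Rightarrow> bool" where
  "wave_algebra (\<lambda>x. c)"
| "wave_algebra (\<lambda>x. exp (k / s * x))"
| "wave_algebra R"
| "wave_algebra (\<lambda>x. inverse (R x))"
| "wave_algebra f \<Longrightarrow> wave_algebra g \<Longrightarrow> wave_algebra (\<lambda>x. f x + g x)"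
| "wave_algebra f \<Longrightarrow> wave_algebra g \<Longrightarrow> wave_algebra (\<lambda>x. f x * g x)"

lemma wave_algebra_deriv:
  "wave_algebra f \<Longrightarrow> \<exists>g. wave_algebra g \<and> (\<forall>x. (f has_real_derivative g x) (at x))"
proof (induction rule: wave_algebra.induct)
  case (1 c)
  show ?case by (rule exI[of _ "\<lambda>x. 0"]) (auto intro: wave_algebra.intros)
next
  case 2
  have "wave_algebra (\<lambda>x. k / s * exp (k / s * x))"
    by (intro wave_algebra.intros)
  moreover have "\<forall>x. ((\<lambda>x. exp (k / s * x)) has_real_derivative k / s * exp (k / s * x)) (at x)"
    using s_pos by (auto intro!: derivative_eq_intros)
  ultimately show ?case by (intro exI[of _ "\<lambda>x. k / s * exp (k / s * x)"]) simp
next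
  case 3
  have "wave_algebra (\<lambda>x. (q * k) * exp (k / s * x) * inverse (R x))"
    by (intro wave_algebra.intros)
  moreover have "\<forall>x. (R has_real_derivative (q * k) * exp (k / s * x) * inverse (R x)) (at x)"
    using R_deriv by (simp add: divide_inverse)
  ultimately show ?case by (intro exI[of _ "\<lambda>x. (q * k) * exp (k / s * x) * inverse (R x)"]) simp
next
  case 4
  let ?g = "\<lambda>x. (- q * k) * exp (k / s * x) * inverse (R x) * inverse (R x) * inverse (R x)"
  have "wave_algebra ?g"
    by (intro wave_algebra.intros)
  moreover have "((\<lambda>x. inverse (R x)) has_real_derivative ?g x) (at x)" for x
    by (rule DERIV_inverse'[OF R_deriv, THEN DERIV_cong])
      (use R_pos[of x] in \<open>simp_all add: divide_inverse\<close>)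
  ultimately show ?case by (intro exI[of _ ?g]) simp
next
  case (5 f g)
  then obtain f' g' where "wave_algebra f'" "wave_algebra g'"
    "\<forall>x. (f has_real_derivative f' x) (at x)" "\<forall>x. (g has_real_derivative g' x) (at x)" by blast
  then show ?case
    by (intro exI[of _ "\<lambda>x. f' x + g' x"]) (auto intro: wave_algebra.intros DERIV_add)
next
  case (6 f g)
  then obtain f' g' where "wave_algebra f'" "wave_algebra g'"
    "\<forall>x. (f has_real_derivative f' x) (at x)" "\<forall>x. (g has_real_derivative g' x) (at x)" by blast
  then show ?case using 6(1,2)
    by (intro exI[of _ "\<lambda>x. f' x * g x + g' x * f x"]) (auto intro: wave_algebra.intros DERIV_mult)
qed

lemma smooth_on_wave_algebra:
  assumes "open S" "wave_algebra f" "\<And>x. x \<in> S \<Longrightarrow> F x = f x"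
  shows "smooth_on S F"
  using assms wave_algebra_deriv by (intro smooth_on_derivative_closed[of S wave_algebra f F]) blast+

end

context majda_ignition
begin

text \<open>In the moving frame each tested equation splits into two integrals that vanish
  separately: a profile function times the t-derivative of the sheared test function, and a total
  x-derivative whose primitive is continuous across the shock.\<close>

lemma detonation_weak_solution:
  "majda_weak_solution q k \<phi> (\<lambda>(x, t). ub0 (x - s * t)) (\<lambda>(x, t). zb0 (x - s * t))"
  unfolding majda_weak_solution_def
proof (intro allI impI conjI)
  fix \<psi> \<psi>x \<psi>t assume \<psi>: "test_function \<psi> \<psi>x \<psi>t"
  note \<Psi> = test_function_shear[OF \<psi>, of s]
  have phi: "\<phi> (ub0 \<xi>) = (if \<xi> \<le> 0 then 1 else 0)" for \<xi>
  proof (cases "\<xi> \<le> 0")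
    case True
    then have "s + R \<xi> \<in> {s + R0..2 * s - up}" using R_gt[of \<xi>] R_le[of \<xi>] by auto
    then have "\<phi> (s + R \<xi>) = 1" using ignition_1 by blast
    then show ?thesis using True by (simp add: ub0_def)
  next
    case False
    then show ?thesis using ignition_0 by (auto simp: ub0_def)
  qed
  have zb0_alt: "zb0 = (\<lambda>\<xi>. exp (k / s * min 0 \<xi>))" by (auto simp: zb0_def min_def)
  have zb0_cont: "continuous_on UNIV zb0" unfolding zb0_alt by (intro continuous_intros) (use s_pos in auto)
  have zb0_range: "0 \<le> zb0 \<xi>" "zb0 \<xi> \<le> 1" for \<xi>
    using k_pos s_pos by (auto simp: zb0_def mult_nonneg_nonpos divide_nonpos_pos)
  have ub0_range: "0 \<le> ub0 \<xi>" "ub0 \<xi> \<le> 2 * s" for \<xi>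
    using R_pos[of \<xi>] R_le[of \<xi>] s_pos up_nonneg up_less by (auto simp: ub0_def)
  have [measurable]: "zb0 \<in> borel_measurable borel" using zb0_cont by (rule borel_measurable_continuous_onI)
  have [measurable]: "R \<in> borel_measurable borel" by (intro borel_measurable_continuous_onI continuous_intros)
  have [measurable]: "ub0 \<in> borel_measurable borel" unfolding ub0_def by measurable
  have shift [measurable]: "(\<lambda>p :: real \<times> real. fst p - s * snd p) \<in> borel_measurable borel"
    by (intro borel_measurable_continuous_onI continuous_intros)
  have "continuous_on UNIV \<psi>" "continuous_on UNIV \<psi>x" "continuous_on UNIV \<psi>t"
    using \<psi> unfolding test_function_def
    by (blast intro: continuous_at_imp_continuous_on has_derivative_continuous)+
  note this[THEN borel_measurable_continuous_onI, measurable]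

  let ?f = "\<lambda>p. ((case p of (x, t) \<Rightarrow> ub0 (x - s * t)) + q * (case p of (x, t) \<Rightarrow> zb0 (x - s * t))) * \<psi>t p +
      (case p of (x, t) \<Rightarrow> ub0 (x - s * t))\<^sup>2 / 2 * \<psi>x p"
  \<comment> \<open>The conserved quantity evaluated ahead of the shock. Replacing u^2 / 2 by C + s
    (u + q z) leaves a constant as the flux in the total x-derivative.\<close>
  define C where "C = up\<^sup>2 / 2 - s * (up + q)"
  have C: "(ub0 \<xi>)\<^sup>2 / 2 - s * (ub0 \<xi> + q * zb0 \<xi>) = C" for \<xi>
    using R_sq'[of \<xi>]
    by (auto simp: C_def ub0_def zb0_def power2_eq_square algebra_simps add_divide_distrib)
  have "?f \<in> borel_measurable borel" unfolding case_prod_unfold by measurable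
  moreover have "has_bochner_integral lborel (\<lambda>(\<xi>, t). ?f (\<xi> + s * t, t)) 0"
  proof -
    have "has_bochner_integral lborel (\<lambda>p. (ub0 (fst p) + q * zb0 (fst p)) *
        (s * \<psi>x (fst p + s * snd p, snd p) + \<psi>t (fst p + s * snd p, snd p))) 0"
    proof (rule has_bochner_integral_test_function_t[OF \<Psi>])
      show "\<bar>ub0 x + q * zb0 x\<bar> \<le> 2 * s + q" for x
        using ub0_range[of x] zb0_range[of x] q_pos mult_left_le[of "zb0 x" q]
          mult_nonneg_nonneg[of q "zb0 x"] by linarith
    qed measurable
    moreover have "has_bochner_integral lborel (\<lambda>p. C * \<psi>x (fst p + s * snd p, snd p) +
        0 * \<psi> (fst p + s * snd p, snd p)) 0"
      by (rule has_bochner_integral_test_function_x[OF \<Psi>]) auto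
    ultimately have "has_bochner_integral lborel (\<lambda>p. (ub0 (fst p) + q * zb0 (fst p)) *
        (s * \<psi>x (fst p + s * snd p, snd p) + \<psi>t (fst p + s * snd p, snd p)) +
        (C * \<psi>x (fst p + s * snd p, snd p) + 0 * \<psi> (fst p + s * snd p, snd p))) (0 + 0)"
      by (rule has_bochner_integral_add)
    moreover have "(\<lambda>p. (ub0 (fst p) + q * zb0 (fst p)) *
        (s * \<psi>x (fst p + s * snd p, snd p) + \<psi>t (fst p + s * snd p, snd p)) +
        (C * \<psi>x (fst p + s * snd p, snd p) + 0 * \<psi> (fst p + s * snd p, snd p))) =
        (\<lambda>(\<xi>, t). ?f (\<xi> + s * t, t))"
    proof
      fix p :: "real \<times> real"
      have "(ub0 (fst p))\<^sup>2 / 2 = C + s * (ub0 (fst p) + q * zb0 (fst p))"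
        using C[of "fst p"] by linarith
      then show "(ub0 (fst p) + q * zb0 (fst p)) *
        (s * \<psi>x (fst p + s * snd p, snd p) + \<psi>t (fst p + s * snd p, snd p)) +
        (C * \<psi>x (fst p + s * snd p, snd p) + 0 * \<psi> (fst p + s * snd p, snd p)) =
        (\<lambda>(\<xi>, t). ?f (\<xi> + s * t, t)) p"
        by (simp add: case_prod_unfold algebra_simps)
    qed
    ultimately show ?thesis by simp
  qed
  ultimately show "has_bochner_integral lborel ?f 0"
    using has_bochner_integral_shear by blast

  let ?g = "\<lambda>p. (case p of (x, t) \<Rightarrow> zb0 (x - s * t)) * \<psi>t p -
      k * \<phi> (case p of (x, t) \<Rightarrow> ub0 (x - s * t)) * (case p of (x, t) \<Rightarrow> zb0 (x - s * t)) * \<psi> p"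
  define W' where "W' \<xi> = - k * \<phi> (ub0 \<xi>) * zb0 \<xi>" for \<xi>
  \<comment> \<open>Measurability cannot come from \<open>\<phi>\<close> itself; along the wave,
    however, the composition is the indicator of \<xi> \<le> 0.\<close>
  have [measurable]: "(\<lambda>\<xi>. \<phi> (ub0 \<xi>)) \<in> borel_measurable borel" unfolding phi by measurable
  have "(\<lambda>p :: real \<times> real. \<phi> (ub0 (fst p - s * snd p))) \<in> borel_measurable borel"
    using measurable_compose[OF shift \<open>(\<lambda>\<xi>. \<phi> (ub0 \<xi>)) \<in> borel_measurable borel\<close>] .
  note this[measurable]
  have "?g \<in> borel_measurable borel" unfolding case_prod_unfold by measurable
  moreover have "has_bochner_integral lborel (\<lambda>(\<xi>, t). ?g (\<xi> + s * t, t)) 0"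
  proof -
    have 1: "has_bochner_integral lborel (\<lambda>p. zb0 (fst p) *
        (s * \<psi>x (fst p + s * snd p, snd p) + \<psi>t (fst p + s * snd p, snd p))) 0"
      by (rule has_bochner_integral_test_function_t[OF \<Psi>, where B=1])
        (use zb0_range in \<open>auto simp: abs_le_iff intro: order_trans[of _ 0]\<close>)
    \<comment> \<open>Away from 0, \<open>W'\<close> is the derivative of \<open>- s * zb0\<close>,
      and \<open>zb0\<close> is continuous at 0.\<close>
    have 2: "has_bochner_integral lborel (\<lambda>p. (- s * zb0 (fst p)) * \<psi>x (fst p + s * snd p, snd p) +
        W' (fst p) * \<psi> (fst p + s * snd p, snd p)) 0"
    proof (rule has_bochner_integral_test_function_x[OF \<Psi>])
      show "continuous_on UNIV (\<lambda>\<xi>. - s * zb0 \<xi>)" by (intro continuous_intros zb0_cont)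
      show "\<bar>- s * zb0 x\<bar> \<le> s" for x
        using s_pos zb0_range[of x] by (auto simp: abs_mult intro!: mult_left_le)
      show "W' \<in> borel_measurable borel" unfolding W'_def by measurable
      show "\<bar>W' x\<bar> \<le> k" for x
        using k_pos zb0_range[of x] by (auto simp: W'_def phi abs_mult intro!: mult_left_le)
      show "((\<lambda>\<xi>. - s * zb0 \<xi>) has_real_derivative W' x) (at x)" if "x \<noteq> 0" for x
      proof (cases "x < 0")
        case True
        have "((\<lambda>\<xi>. - s * exp (k / s * \<xi>)) has_real_derivative W' x) (at x)"
          using True s_pos by (auto intro!: derivative_eq_intros simp: W'_def phi zb0_def)
        then show ?thesis
          by (rule has_field_derivative_transform_within_open[where S="{..<0}"])
            (use True in \<open>auto simp: zb0_def\<close>)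
      next
        case False
        then have "((\<lambda>\<xi>. - s) has_real_derivative W' x) (at x)"
          using that by (auto simp: W'_def phi)
        then show ?thesis
          by (rule has_field_derivative_transform_within_open[where S="{0<..}"])
            (use False that in \<open>auto simp: zb0_def\<close>)
      qed
    qed
    have "has_bochner_integral lborel (\<lambda>p. zb0 (fst p) *
        (s * \<psi>x (fst p + s * snd p, snd p) + \<psi>t (fst p + s * snd p, snd p)) +
        ((- s * zb0 (fst p)) * \<psi>x (fst p + s * snd p, snd p) +
        W' (fst p) * \<psi> (fst p + s * snd p, snd p))) (0 + 0)"
      using 1 2 by (rule has_bochner_integral_add)
    moreover have "(\<lambda>p. zb0 (fst p) *
        (s * \<psi>x (fst p + s * snd p, snd p) + \<psi>t (fst p + s * snd p, snd p)) +
        ((- s * zb0 (fst p)) * \<psi>x (fst p + s * snd p, snd p) +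
        W' (fst p) * \<psi> (fst p + s * snd p, snd p))) = (\<lambda>(\<xi>, t). ?g (\<xi> + s * t, t))"
      by (auto simp: fun_eq_iff W'_def algebra_simps)
    ultimately show ?thesis by simp
  qed
  ultimately show "has_bochner_integral lborel ?g 0"
    using has_bochner_integral_shear by blast
qed

lemma strong_ZND_detonation_exists: "strong_ZND_detonation q k \<phi> s (s + R0) up ub0 zb0"
  unfolding strong_ZND_detonation_def
proof (intro conjI)
  show "smooth_on {..<0} ub0"
    by (rule smooth_on_wave_algebra[OF _ wave_algebra.intros(5)[OF wave_algebra.intros(1,3)]])
      (auto simp: ub0_def)
  show "smooth_on {..<0} zb0"
    by (rule smooth_on_wave_algebra[OF _ wave_algebra.intros(2)]) (auto simp: zb0_def)
  show "smooth_on {0<..} ub0" "smooth_on {0<..} zb0"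
    by (auto intro!: smooth_on_eq_const simp: ub0_def zb0_def)
  have left: "\<forall>\<^sub>F x in at_left 0. s + R x = ub0 x" "\<forall>\<^sub>F x in at_left 0. exp (k / s * x) = zb0 x"
    by (rule eventually_mono[OF eventually_at_left_real[of "-1" "0::real"]]; simp add: ub0_def zb0_def)+
  have right: "\<forall>\<^sub>F x in at_right 0. ub0 x = up" "\<forall>\<^sub>F x in at_right 0. zb0 x = 1"
    by (rule eventually_mono[OF eventually_at_right_less]; simp add: ub0_def zb0_def)+
  have "((\<lambda>x. s + R x) \<longlongrightarrow> s + (s - up)) (at_left 0)"
    by (intro tendsto_intros tendsto_R_0)
  then have 1: "(ub0 \<longlongrightarrow> s + (s - up)) (at_left 0)" using tendsto_cong[OF left(1)] by blast
  have "((\<lambda>x. exp (k / s * x)) \<longlongrightarrow> exp (k / s * 0)) (at_left 0)"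
    by (intro tendsto_intros)
  then have 2: "(zb0 \<longlongrightarrow> exp (k / s * 0)) (at_left 0)" using tendsto_cong[OF left(2)] by blast
  have 3: "(ub0 \<longlongrightarrow> up) (at_right 0)" "(zb0 \<longlongrightarrow> 1) (at_right 0)"
    by (rule tendsto_eventually[OF right(1)], rule tendsto_eventually[OF right(2)])
  show "\<exists>l r. ((\<lambda>\<xi>. (ub0 \<xi>, zb0 \<xi>)) \<longlongrightarrow> l) (at_left 0) \<and>
      ((\<lambda>\<xi>. (ub0 \<xi>, zb0 \<xi>)) \<longlongrightarrow> r) (at_right 0) \<and> l \<noteq> r"
  proof (intro exI conjI)
    show "((\<lambda>\<xi>. (ub0 \<xi>, zb0 \<xi>)) \<longlongrightarrow> (s + (s - up), exp (k / s * 0))) (at_left 0)"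
      using 1 2 by (rule tendsto_Pair)
    show "((\<lambda>\<xi>. (ub0 \<xi>, zb0 \<xi>)) \<longlongrightarrow> (up, 1)) (at_right 0)"
      using 3 by (rule tendsto_Pair)
    show "(s + (s - up), exp (k / s * 0)) \<noteq> (up, 1)" using up_less by simp
  qed
  have bot: "\<forall>\<^sub>F x in at_bot. s + R x = ub0 x" "\<forall>\<^sub>F x in at_bot. exp (k / s * x) = zb0 x"
    by (rule eventually_mono[OF eventually_le_at_bot[of 0]]; simp add: ub0_def zb0_def)+
  have "((\<lambda>x. s + R x) \<longlongrightarrow> s + R0) at_bot" by (intro tendsto_intros tendsto_R_at_bot)
  then show "(ub0 \<longlongrightarrow> s + R0) at_bot" using tendsto_cong[OF bot(1)] by blast
  show "(zb0 \<longlongrightarrow> 0) at_bot" using tendsto_cong[OF bot(2)] tendsto_exp_at_bot by blast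
  have top: "\<forall>\<^sub>F x in at_top. ub0 x = up" "\<forall>\<^sub>F x in at_top. zb0 x = 1"
    by (rule eventually_mono[OF eventually_gt_at_top[of 0]]; simp add: ub0_def zb0_def)+
  show "(ub0 \<longlongrightarrow> up) at_top" "(zb0 \<longlongrightarrow> 1) at_top"
    by (rule tendsto_eventually[OF top(1)], rule tendsto_eventually[OF top(2)])
qed (use R0_pos up_less up_nonneg detonation_weak_solution in auto)

end

section \<open>The scalar eigenvalue equations\<close>

lemma has_integral_exp_at_bot:
  fixes b c :: real
  assumes "c > 0"
  shows "((\<lambda>x. exp (c * x)) has_integral exp (c * b) / c) {..b}"
proof -
  have I: "((\<lambda>x. exp (- c * x)) has_integral exp (- c * - b) / c) {- b..}"
    using assms by (rule has_integral_exp_minus_to_infinity)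
  then have "(\<lambda>x. exp (c * - x)) absolutely_integrable_on {- b..}"
    using nonnegative_absolutely_integrable_1[of "\<lambda>x. exp (- c * x)" "{- b..}"]
    by (auto simp: integrable_on_def)
  moreover have "integral {- b..} (\<lambda>x. exp (c * - x)) = exp (c * b) / c"
    using integral_unique[OF I] by simp
  ultimately have "(\<lambda>x. exp (c * x)) absolutely_integrable_on {..b} \<and>
      integral {..b} (\<lambda>x. exp (c * x)) = exp (c * b) / c"
    by (subst has_absolute_integral_reflect_real[symmetric, where A="{- b..}"]) auto
  then show ?thesis
    using has_integral_integral[of "\<lambda>x. exp (c * x)" "{..b}"] absolutely_integrable_on_def by metis
qed

lemma exp_bounded_integrable:
  fixes g :: "real \<Rightarrow> 'a::euclidean_space"
  assumes "c > 0" "continuous_on {..b} g" "\<And>y. y \<le> b \<Longrightarrow> norm (g y) \<le> C * exp (c * y)"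
  shows "g integrable_on {..b}" and "norm (integral {..b} g) \<le> C * (exp (c * b) / c)"
proof -
  have E: "((\<lambda>y. C * exp (c * y)) has_integral C * (exp (c * b) / c)) {..b}"
    by (rule has_integral_mult_right[OF has_integral_exp_at_bot[OF assms(1)]])
  show 1: "g integrable_on {..b}"
  proof (rule measurable_bounded_by_integrable_imp_integrable)
    show "g \<in> borel_measurable (lebesgue_on {..b})"
      by (rule continuous_imp_measurable_on_sets_lebesgue[OF assms(2)]) auto
    show "(\<lambda>y. C * exp (c * y)) integrable_on {..b}" using E by blast
  qed (use assms(3) in auto)
  show "norm (integral {..b} g) \<le> C * (exp (c * b) / c)"
    unfolding integral_unique[OF E, symmetric]
    by (rule Henstock_Kurzweil_Integration.integral_norm_bound_integral) (use 1 E assms(3) in auto)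
qed

lemma integral_atMost_split:
  fixes g :: "real \<Rightarrow> 'a::euclidean_space"
  assumes "g integrable_on {..a}" "continuous_on {a..b} g" "a \<le> b"
  shows "integral {..b} g = integral {..a} g + integral {a..b} g"
proof -
  have "g integrable_on {a..b}" using assms(2) by (rule integrable_continuous_interval)
  moreover have "{..a} \<inter> {a..b} = {a}" "{..a} \<union> {a..b} = {..b}" using assms(3) by auto
  ultimately have "(g has_integral integral {..a} g + integral {a..b} g) {..b}"
    using has_integral_Un[OF integrable_integral integrable_integral, of g "{..a}" "{a..b}"] assms(1)
    by simp
  then show ?thesis by (rule integral_unique)
qed

text \<open>The theorem on [a, b], with a sent to minus infinity. At b only continuity is asked of
  \<open>F\<close>, because solutions of the eigenvalue equation are given for \<xi> < 0 and reach 0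
  only as a limit.\<close>

lemma integral_atMost_FTC:
  fixes F g :: "real \<Rightarrow> 'a::euclidean_space"
  assumes g: "c > 0" "continuous_on {..b} g" "\<And>y. y \<le> b \<Longrightarrow> norm (g y) \<le> C * exp (c * y)"
    and F: "\<And>y. y < b \<Longrightarrow> (F has_vector_derivative g y) (at y)" "continuous_on {..b} F" "(F \<longlongrightarrow> 0) at_bot"
  shows "integral {..b} g = F b"
proof -
  have int: "g integrable_on {..a}" "norm (integral {..a} g) \<le> C * (exp (c * a) / c)" if "a \<le> b" for a
    using exp_bounded_integrable[OF g(1) continuous_on_subset[OF g(2)], of a C] that g(3) by auto
  have split: "integral {..b} g - integral {..a} g = F b - F a" if "a \<le> b" for a
  proof -
    have "(g has_integral F b - F a) {a..b}"
      by (rule fundamental_theorem_of_calculus_interior[OF that])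
        (auto intro!: F(1) continuous_on_subset[OF F(2)])
    then show ?thesis
      using integral_atMost_split[OF int(1)[OF that] _ that] continuous_on_subset[OF g(2)]
      by (simp add: integral_unique)
  qed
  have exp0: "((\<lambda>a. exp (c * a)) \<longlongrightarrow> 0) at_bot"
    using g(1) by (intro filterlim_compose[OF exp_at_bot]
        filterlim_tendsto_pos_mult_at_bot[OF tendsto_const _ filterlim_ident])
  have int0: "((\<lambda>a. integral {..a} g) \<longlongrightarrow> 0) at_bot"
  proof (rule Lim_null_comparison)
    show "\<forall>\<^sub>F a in at_bot. norm (integral {..a} g) \<le> C * (exp (c * a) / c)"
      by (rule eventually_mono[OF eventually_le_at_bot[of b]]) (rule int(2))
    have "((\<lambda>a. C * (exp (c * a) / c)) \<longlongrightarrow> C * (0 / c)) at_bot"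
      by (intro tendsto_intros exp0) (use g(1) in auto)
    then show "((\<lambda>a. C * (exp (c * a) / c)) \<longlongrightarrow> 0) at_bot" by simp
  qed
  have "integral {..b} g - 0 = F b - 0"
  proof (rule tendsto_unique_eventually_eq)
    show "((\<lambda>a. integral {..b} g - integral {..a} g) \<longlongrightarrow> integral {..b} g - 0) at_bot"
      by (intro tendsto_intros int0)
    show "((\<lambda>a. F b - F a) \<longlongrightarrow> F b - 0) at_bot"
      by (intro tendsto_intros F(3))
    show "\<forall>\<^sub>F a in at_bot. integral {..b} g - integral {..a} g = F b - F a"
      by (rule eventually_mono[OF eventually_le_at_bot[of b]]) (rule split)
  qed simp
  then show ?thesis by simp
qed

section \<open>The integrating factor, the weight and its antiderivative\<close>

context majda
begin

text \<open>An explicit antiderivative of \<open>1 / R\<close>, found by substituting \<open>R\<close> for the variable.\<close>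

definition h :: "real \<Rightarrow> real" where
  "h \<xi> = s / (k * R0) * (ln (R \<xi> - R0) - ln (R \<xi> + R0) - (ln (R 0 - R0) - ln (R 0 + R0)))"

lemma h_zero: "h 0 = 0" by (simp add: h_def)

text \<open>The profile equation reads R' = k (R^2 - R0^2) / (2 s R), so d\<xi> / R = (2 s / k) dR /
  (R^2 - R0^2). Partial fractions give the two logarithms and the prefactor s / (k R0).\<close>

lemma h_deriv: "(h has_real_derivative 1 / R \<xi>) (at \<xi>)"
proof -
  have pos: "R \<xi> - R0 > 0" "R \<xi> + R0 > 0" using R_gt[of \<xi>] R0_pos by auto
  let ?d = "q * k * exp (k / s * \<xi>) / R \<xi>"
  have d: "(h has_real_derivative s / (k * R0) * (?d / (R \<xi> - R0) - ?d / (R \<xi> + R0))) (at \<xi>)"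
    unfolding h_def by (rule derivative_eq_intros refl pos)+ (simp add: mult.commute)
  have sq: "(R \<xi> - R0) * (R \<xi> + R0) = 2 * q * s * exp (k / s * \<xi>)"
    using R_sq[of \<xi>] by (simp add: power2_eq_square algebra_simps)
  have "?d / (R \<xi> - R0) - ?d / (R \<xi> + R0) = ?d * (2 * R0) / ((R \<xi> - R0) * (R \<xi> + R0))"
    using pos by (simp add: divide_simps) (simp add: algebra_simps)
  also have "\<dots> = k * R0 / (s * R \<xi>)"
    unfolding sq using q_pos s_pos R_pos[of \<xi>] by (simp add: field_simps)
  finally have "s / (k * R0) * (?d / (R \<xi> - R0) - ?d / (R \<xi> + R0)) = 1 / R \<xi>"
    using s_pos k_pos R0_pos R_pos[of \<xi>] by (simp add: field_simps)
  then show ?thesis using d by simp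
qed

lemma continuous_on_h [continuous_intros]: "continuous_on S f \<Longrightarrow> continuous_on S (\<lambda>x. h (f x))"
  by (rule continuous_on_compose2[of UNIV h])
    (auto intro!: continuous_at_imp_continuous_on DERIV_isCont[OF h_deriv])

text \<open>The slope 1 / R lies between 0 and 1 / R0.\<close>

lemma h_diff_bounds:
  assumes "y \<le> \<xi>"
  shows "0 \<le> h \<xi> - h y" "h \<xi> - h y \<le> (\<xi> - y) / R0"
proof -
  show "0 \<le> h \<xi> - h y"
    using DERIV_nonneg_imp_nondecreasing[OF assms, of h] h_deriv R_pos less_imp_le
    by (smt (verit, best) divide_nonneg_pos)
  have "h \<xi> - \<xi> / R0 \<le> h y - y / R0"
  proof (rule DERIV_nonpos_imp_nonincreasing[OF assms, of "\<lambda>\<xi>. h \<xi> - \<xi> / R0"])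
    fix x
    have "((\<lambda>\<xi>. h \<xi> - \<xi> / R0) has_real_derivative 1 / R x - 1 / R0) (at x)"
      using R0_pos by (intro DERIV_diff[OF h_deriv]) (auto intro!: derivative_eq_intros)
    moreover have "1 / R x - 1 / R0 \<le> 0"
      using R_gt[of x] R0_pos by (simp add: frac_le less_imp_le)
    ultimately show "\<exists>y. ((\<lambda>\<xi>. h \<xi> - \<xi> / R0) has_real_derivative y) (at x) \<and> y \<le> 0" by blast
  qed
  then show "h \<xi> - h y \<le> (\<xi> - y) / R0" by (simp add: diff_divide_distrib)
qed

lemma h_bounds: "y \<le> 0 \<Longrightarrow> h y \<le> 0" "y \<le> 0 \<Longrightarrow> y / R0 \<le> h y"
  using h_diff_bounds[of y 0] by (simp_all add: h_zero)

lemma integral_P_fun: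
  assumes "y \<le> 0"
  shows "integral {y..0} (P_fun q k s up lam) = - lam * of_real (h y)"
proof -
  have "((\<lambda>x. lam * of_real (h x)) has_vector_derivative P_fun q k s up lam x) (at x)" for x
    using has_vector_derivative_mult_right[OF has_vector_derivative_of_real[OF h_deriv[of x]], of lam]
    by (simp add: P_fun_def)
  then have "(P_fun q k s up lam has_integral lam * of_real (h 0) - lam * of_real (h y)) {y..0}"
    by (intro fundamental_theorem_of_calculus assms) (auto intro: has_vector_derivative_at_within)
  then show ?thesis by (simp add: integral_unique h_zero)
qed

text \<open>The exponential weight of \<Psi>: the integrating factor exp(\<lambda> h) of the first
  eigenvalue equation times the second component of the mode. On y \<le> 0 the first factor is the
  exponential of minus the integral of P over [y, 0].\<close>

definition f :: "complex \<Rightarrow> real \<Rightarrow> complex" where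
  "f lam y = exp (lam * of_real (h y) + (of_real k + lam) / of_real s * of_real y)"

lemma norm_f: "norm (f lam y) = exp (Re lam * h y + (k + Re lam) / s * y)"
  by (simp add: f_def)

lemma continuous_on_f [continuous_intros]: "continuous_on S g \<Longrightarrow> continuous_on S (\<lambda>x. f lam (g x))"
  unfolding f_def using s_pos by (intro continuous_intros) auto

lemma f_deriv:
  "(f lam has_vector_derivative (lam / of_real (R y) + (of_real k + lam) / of_real s) * f lam y) (at y)"
proof -
  have "((\<lambda>y. lam * of_real (h y) + (of_real k + lam) / of_real s * of_real y) has_vector_derivative
      lam * of_real (1 / R y) + (of_real k + lam) / of_real s * of_real 1) (at y)"
    by (intro has_vector_derivative_add has_vector_derivative_mult_right has_vector_derivative_of_real
        h_deriv DERIV_ident)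
  then have "((\<lambda>y. lam * of_real (h y) + (of_real k + lam) / of_real s * of_real y) has_vector_derivative
      (lam / of_real (R y) + (of_real k + lam) / of_real s)) (at y)"
    by simp
  from field_vector_diff_chain_at[OF this DERIV_exp]
  show ?thesis by (simp add: f_def[abs_def] o_def)
qed

text \<open>Solves \<delta> (1 / R0 + 1 / s) = k / (2 s). To the right of Re \<lambda> = - \<delta>
  the weight keeps at least half of the rate k / s.\<close>

definition \<delta> :: real where "\<delta> = k / (2 * s) / (1 / R0 + 1 / s)"

lemma \<delta>_pos: "\<delta> > 0"
  using k_pos s_pos R0_pos by (simp add: \<delta>_def add_pos_pos)

text \<open>For Re \<lambda> \<ge> 0 both \<lambda>-terms in the exponent have nonpositive real
  part. For Re \<lambda> < 0 they are estimated by means of h y \<ge> y / R0, and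
  \<open>\<delta>\<close> is chosen so that they cost at most half of the rate.\<close>

lemma norm_f_le:
  assumes "Re lam > - \<delta>" "y \<le> 0"
  shows "norm (f lam y) \<le> exp (k / (2 * s) * y)"
proof -
  let ?x = "Re lam" and ?c = "1 / R0 + 1 / s"
  have c: "?c > 0" using R0_pos s_pos by (simp add: add_pos_pos)
  have half: "k / (2 * s) \<le> k / s" using k_pos s_pos by (simp add: field_simps)
  have "?x * h y + (k + ?x) / s * y \<le> k / (2 * s) * y"
  proof (cases "?x \<ge> 0")
    case True
    have "?x * h y \<le> 0" using True h_bounds(1)[OF assms(2)] by (simp add: mult_nonneg_nonpos)
    moreover have "?x / s * y \<le> 0" using True s_pos assms(2) by (intro mult_nonneg_nonpos) auto
    moreover have "k / s * y \<le> k / (2 * s) * y" using half assms(2) by (rule mult_right_mono_neg)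
    ultimately show ?thesis by (simp add: add_divide_distrib distrib_right)
  next
    case False
    have "?x * h y \<le> ?x * (y / R0)" using False h_bounds(2)[OF assms(2)] by (intro mult_left_mono_neg) auto
    then have "?x * h y + (k + ?x) / s * y \<le> (?x * ?c + k / s) * y"
      by (simp add: algebra_simps add_divide_distrib)
    also have "\<dots> \<le> k / (2 * s) * y"
    proof (rule mult_right_mono_neg[OF _ assms(2)])
      have "- \<delta> * ?c = - (k / (2 * s))" using c by (simp add: \<delta>_def)
      moreover have "- \<delta> * ?c < ?x * ?c" using assms(1) c by (rule mult_strict_right_mono)
      moreover have "k / s = k / (2 * s) + k / (2 * s)" using s_pos by (simp add: field_simps)
      ultimately show "k / (2 * s) \<le> ?x * ?c + k / s" by linarith
    qed
    finally show ?thesis .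
  qed
  then show ?thesis by (simp add: norm_f)
qed

text \<open>A bound relative to the size at \<xi>, by monotonicity of h(y) + y / s. Tangency
  compares directions, so absolute decay estimates would not suffice.\<close>

lemma norm_f_ratio:
  assumes "Re lam \<ge> 0" "y \<le> \<xi>"
  shows "norm (f lam y) \<le> norm (f lam \<xi>) * exp (- (k / s) * \<xi>) * exp (k / s * y)"
proof -
  have "Re lam * h y \<le> Re lam * h \<xi>" using assms h_diff_bounds(1)[OF assms(2)] by (intro mult_left_mono) auto
  moreover have "Re lam / s * y \<le> Re lam / s * \<xi>" using assms s_pos by (intro mult_left_mono) auto
  ultimately have "Re lam * h y + (k + Re lam) / s * y \<le>
      (Re lam * h \<xi> + (k + Re lam) / s * \<xi>) + (- (k / s) * \<xi>) + k / s * y"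
    by (simp add: add_divide_distrib distrib_right)
  then show ?thesis by (simp add: norm_f flip: exp_add)
qed

text \<open>The integral in the variation-of-constants formula for the first component, started at
  minus infinity.\<close>

definition J :: "complex \<Rightarrow> real \<Rightarrow> complex" where "J lam \<xi> = integral {..\<xi>} (f lam)"

lemma f_integrable:
  assumes "Re lam > - \<delta>" "\<xi> \<le> 0"
  shows "f lam integrable_on {..\<xi>}" and "norm (J lam \<xi>) \<le> exp (k / (2 * s) * \<xi>) / (k / (2 * s))"
  using exp_bounded_integrable[of "k / (2 * s)" \<xi> "f lam" 1, OF _ continuous_on_f[OF continuous_on_id]]
    norm_f_le[OF assms(1)] assms(2) k_pos s_pos
  by (auto simp: J_def)

lemma J_split:
  assumes "Re lam > - \<delta>" "a \<le> \<xi>" "\<xi> \<le> 0"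
  shows "J lam \<xi> = J lam a + integral {a..\<xi>} (f lam)"
  unfolding J_def using assms
  by (intro integral_atMost_split f_integrable continuous_on_f continuous_on_id) auto

lemma norm_J_le:
  assumes "Re lam \<ge> 0"
  shows "norm (J lam \<xi>) \<le> norm (f lam \<xi>) * (s / k)"
proof -
  have "norm (integral {..\<xi>} (f lam)) \<le> norm (f lam \<xi>) * exp (- (k / s) * \<xi>) * (exp (k / s * \<xi>) / (k / s))"
    using k_pos s_pos norm_f_ratio[OF assms]
    by (intro exp_bounded_integrable(2) continuous_intros) auto
  also have "\<dots> = norm (f lam \<xi>) * (s / k)"
    by (simp add: exp_minus field_simps)
  finally show ?thesis by (simp add: J_def)
qed

lemma J_deriv:
  assumes "Re lam > - \<delta>" "\<xi> < 0"
  shows "(J lam has_vector_derivative f lam \<xi>) (at \<xi>)"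
proof -
  have "((\<lambda>u. integral {\<xi> - 1..u} (f lam)) has_vector_derivative f lam \<xi>) (at \<xi> within {\<xi> - 1..0})"
    using assms by (intro integral_has_vector_derivative continuous_intros) auto
  moreover have "at \<xi> within {\<xi> - 1..0} = at \<xi>"
    using assms by (intro at_within_interior) (simp add: interior_atLeastAtMost_real)
  ultimately have "((\<lambda>u. J lam (\<xi> - 1) + integral {\<xi> - 1..u} (f lam)) has_vector_derivative 0 + f lam \<xi>) (at \<xi>)"
    by (intro has_vector_derivative_add has_vector_derivative_const) simp
  then have "((\<lambda>u. J lam (\<xi> - 1) + integral {\<xi> - 1..u} (f lam)) has_vector_derivative f lam \<xi>) (at \<xi>)"
    by simp
  then show ?thesis
  proof (rule has_vector_derivative_transform_within_open[where S="{\<xi> - 1<..<0}"])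
    show "J lam (\<xi> - 1) + integral {\<xi> - 1..u} (f lam) = J lam u" if "u \<in> {\<xi> - 1<..<0}" for u
      using J_split[OF assms(1), of "\<xi> - 1" u] that by simp
  qed (use assms(2) in auto)
qed

lemma J_tendsto_0:
  assumes "Re lam > - \<delta>"
  shows "(J lam \<longlongrightarrow> J lam 0) (at_left 0)"
proof -
  have "continuous_on {-1..0} (\<lambda>u. J lam (-1) + integral {-1..u} (f lam))"
    by (intro continuous_intros indefinite_integral_continuous_1 integrable_continuous_interval)
  then have "((\<lambda>u. J lam (-1) + integral {-1..u} (f lam)) \<longlongrightarrow> J lam (-1) + integral {-1..0} (f lam))
      (at 0 within {-1..0})"
    by (simp add: continuous_on)
  then have "((\<lambda>u. J lam (-1) + integral {-1..u} (f lam)) \<longlongrightarrow> J lam 0) (at_left 0)"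
    using assms by (simp add: at_within_Icc_at_left J_split[of lam "-1" 0])
  moreover have "\<forall>\<^sub>F u in at_left 0. J lam (-1) + integral {-1..u} (f lam) = J lam u"
  proof (rule eventually_mono[OF eventually_at_left_real[of "-1" "0::real"]])
    show "J lam (-1) + integral {-1..u} (f lam) = J lam u" if "u \<in> {-1<..<0}" for u
      using J_split[OF assms, of "-1" u] that by simp
  qed simp
  ultimately show ?thesis using tendsto_cong by fast
qed

text \<open>The truncations to [\<xi> - n, \<xi>] are holomorphic by differentiation under the
  integral sign. The remainders obey a bound that does not depend on \<lambda> in the half-plane, so
  the limit is locally uniform.\<close>

lemma J_holomorphic:
  assumes "\<xi> \<le> 0"
  shows "(\<lambda>lam. J lam \<xi>) holomorphic_on {lam. Re lam > - \<delta>}"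
proof (rule holomorphic_uniform_sequence)
  let ?U = "{lam. Re lam > - \<delta>}"
  show U: "open ?U" by (rule open_halfspace_Re_gt)
  show "(\<lambda>lam. integral (cbox (\<xi> - real n) \<xi>) (f lam)) holomorphic_on ?U" for n
  proof (rule leibniz_rule_holomorphic)
    show "((\<lambda>lam. f lam t) has_field_derivative (of_real (h t) + of_real t / of_real s) * f lam t) (at lam within ?U)"
      for lam t
      unfolding f_def using s_pos by (auto intro!: derivative_eq_intros simp: field_simps)
    show "f lam integrable_on cbox (\<xi> - real n) \<xi>" for lam
      unfolding cbox_interval by (intro integrable_continuous_interval continuous_intros)
    have "continuous_on (?U \<times> cbox (\<xi> - real n) \<xi>)
        (\<lambda>p. (of_real (h (snd p)) + of_real (snd p) / of_real s) * f (fst p) (snd p))"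
      unfolding f_def using s_pos by (intro continuous_intros) auto
    then show "continuous_on (?U \<times> cbox (\<xi> - real n) \<xi>)
        (\<lambda>(lam, t). (of_real (h t) + of_real t / of_real s) * f lam t)"
      by (simp add: case_prod_unfold)
    show "convex ?U" by (rule convex_halfspace_Re_gt)
  qed
  fix lam0 assume "lam0 \<in> ?U"
  then obtain d where d: "d > 0" "cball lam0 d \<subseteq> ?U" using U open_contains_cball by blast
  have "uniform_limit (cball lam0 d) (\<lambda>n lam. integral (cbox (\<xi> - real n) \<xi>) (f lam))
      (\<lambda>lam. J lam \<xi>) sequentially"
  proof (rule uniform_limitI)
    fix e :: real assume "e > 0"
    have ks: "k / (2 * s) > 0" using k_pos s_pos by simp
    have "filterlim (\<lambda>n. \<xi> - real n) at_bot sequentially"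
      using filterlim_tendsto_add_at_top[OF tendsto_const[of "- \<xi>"] filterlim_real_sequentially]
      unfolding filterlim_uminus_at_bot by simp
    then have "(\<lambda>n. exp (k / (2 * s) * (\<xi> - real n))) \<longlonglongrightarrow> 0"
      using ks by (intro filterlim_compose[OF exp_at_bot] filterlim_tendsto_pos_mult_at_bot[OF tendsto_const])
    then have "(\<lambda>n. exp (k / (2 * s) * (\<xi> - real n)) / (k / (2 * s))) \<longlonglongrightarrow> 0"
      by (rule tendsto_divide_zero)
    from order_tendstoD(2)[OF this \<open>e > 0\<close>]
    show "\<forall>\<^sub>F n in sequentially. \<forall>lam\<in>cball lam0 d.
        dist (integral (cbox (\<xi> - real n) \<xi>) (f lam)) (J lam \<xi>) < e"
    proof eventually_elim
      case (elim n)
      show ?case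
      proof
        fix lam assume "lam \<in> cball lam0 d"
        then have lam: "Re lam > - \<delta>" using d by auto
        have "dist (integral (cbox (\<xi> - real n) \<xi>) (f lam)) (J lam \<xi>) = norm (J lam (\<xi> - real n))"
          using J_split[OF lam, of "\<xi> - real n" \<xi>] assms
          by (simp add: dist_norm cbox_interval norm_minus_commute)
        also have "\<dots> \<le> exp (k / (2 * s) * (\<xi> - real n)) / (k / (2 * s))"
          using assms by (intro f_integrable(2)[OF lam]) simp
        also note elim
        finally show "dist (integral (cbox (\<xi> - real n) \<xi>) (f lam)) (J lam \<xi>) < e" .
      qed
    qed
  qed
  then show "\<exists>d. 0 < d \<and> cball lam0 d \<subseteq> ?U \<and> uniform_limit (cball lam0 d)
      (\<lambda>n lam. integral (cbox (\<xi> - real n) \<xi>) (f lam)) (\<lambda>lam. J lam \<xi>) sequentially"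
    using d by blast
qed

text \<open>Integrating \<open>f'\<close> expresses \<open>J\<close> through \<open>f\<close> up to a relative error \<open>1 / R0 - 1 / R \<xi>\<close>.\<close>

lemma J_asymptotic:
  assumes "Re lam \<ge> 0" "\<xi> \<le> 0"
  shows "norm ((lam / of_real R0 + (of_real k + lam) / of_real s) * J lam \<xi> - f lam \<xi>) \<le>
    norm (f lam \<xi>) * (norm lam * (1 / R0 - 1 / R \<xi>) * (s / k))"
proof -
  have lam: "Re lam > - \<delta>" using assms \<delta>_pos by simp
  let ?a = "lam / of_real R0 + (of_real k + lam) / of_real s"
  let ?g = "\<lambda>y. lam * (of_real (1 / R0 - 1 / R y)) * f lam y"
  have cont_g: "continuous_on {..\<xi>} ?g"
    using R_pos by (intro continuous_intros) (auto simp: less_imp_neq[symmetric])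
  \<comment> \<open>The deviation from the limiting coefficient increases with y, so over the
    half-line its value at \<xi> dominates; that value tends to 0 at minus infinity.\<close>
  have step: "1 / R0 - 1 / R y \<le> 1 / R0 - 1 / R \<xi>" "0 \<le> 1 / R0 - 1 / R y" if "y \<le> \<xi>" for y
    using R_mono[OF that] R_pos[of y] R_gt[of y] R0_pos by (auto simp: frac_le)
  have bound: "norm (?g y) \<le> norm lam * (1 / R0 - 1 / R \<xi>) * (norm (f lam \<xi>) * exp (- (k / s) * \<xi>)) * exp (k / s * y)"
    if "y \<le> \<xi>" for y
  proof -
    have "norm (?g y) = norm lam * (1 / R0 - 1 / R y) * norm (f lam y)"
      using step(2)[OF that] by (simp only: norm_mult norm_of_real abs_of_nonneg)
    also have "\<dots> \<le> norm lam * (1 / R0 - 1 / R \<xi>) * (norm (f lam \<xi>) * exp (- (k / s) * \<xi>) * exp (k / s * y))"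
      using step[OF that] by (intro mult_mono norm_f_ratio[OF assms(1) that]) auto
    finally show ?thesis by (simp add: mult.assoc)
  qed
  have ks: "k / s > 0" using k_pos s_pos by simp
  note g = exp_bounded_integrable[OF ks cont_g bound]
  have "integral {..\<xi>} (\<lambda>y. (lam / of_real (R y) + (of_real k + lam) / of_real s) * f lam y) = f lam \<xi>"
  proof (rule integral_atMost_FTC[of "k / (2 * s)" _ _ "norm lam / R0 + norm ((of_real k + lam) / of_real s)"])
    show "continuous_on {..\<xi>} (\<lambda>y. (lam / of_real (R y) + (of_real k + lam) / of_real s) * f lam y)"
      using R_pos s_pos by (intro continuous_intros) (auto simp: less_imp_neq[symmetric])
    show "norm ((lam / of_real (R y) + (of_real k + lam) / of_real s) * f lam y) \<le>
        (norm lam / R0 + norm ((of_real k + lam) / of_real s)) * exp (k / (2 * s) * y)" if "y \<le> \<xi>" for y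
    proof -
      have "norm (lam / of_real (R y)) \<le> norm lam / R0"
        using R_gt[of y] R0_pos by (auto simp: norm_divide intro!: divide_left_mono)
      then show ?thesis
        unfolding norm_mult using norm_f_le[OF lam, of y] that assms R0_pos
        by (intro mult_mono order_trans[OF norm_triangle_ineq] add_mono) auto
    qed
    show "(f lam has_vector_derivative (lam / of_real (R y) + (of_real k + lam) / of_real s) * f lam y) (at y)" for y
      by (rule f_deriv)
    show "(f lam \<longlongrightarrow> 0) at_bot"
    proof (rule Lim_null_comparison)
      show "\<forall>\<^sub>F y in at_bot. norm (f lam y) \<le> exp (k / (2 * s) * y)"
        by (rule eventually_mono[OF eventually_le_at_bot[of 0]]) (rule norm_f_le[OF lam])
      show "((\<lambda>y. exp (k / (2 * s) * y)) \<longlongrightarrow> 0) at_bot"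
        using k_pos s_pos by (intro filterlim_compose[OF exp_at_bot]
          filterlim_tendsto_pos_mult_at_bot[OF tendsto_const _ filterlim_ident]) simp
    qed
  qed (use k_pos s_pos in \<open>auto intro!: continuous_intros\<close>)
  moreover have "(\<lambda>y. (lam / of_real (R y) + (of_real k + lam) / of_real s) * f lam y) =
      (\<lambda>y. ?a * f lam y - ?g y)"
    by (simp add: fun_eq_iff algebra_simps)
  moreover have "integral {..\<xi>} (\<lambda>y. ?a * f lam y - ?g y) = ?a * J lam \<xi> - integral {..\<xi>} ?g"
    unfolding J_def using f_integrable(1)[OF lam assms(2)] g(1)
    by (subst Henstock_Kurzweil_Integration.integral_diff) (auto intro: integrable_on_mult_right)
  ultimately have "?a * J lam \<xi> - f lam \<xi> = integral {..\<xi>} ?g" by (simp add: algebra_simps)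
  also have "norm \<dots> \<le> norm lam * (1 / R0 - 1 / R \<xi>) * (norm (f lam \<xi>) * exp (- (k / s) * \<xi>)) * (exp (k / s * \<xi>) / (k / s))"
    by (rule g(2))
  also have "\<dots> = norm (f lam \<xi>) * (norm lam * (1 / R0 - 1 / R \<xi>)) *
      (exp (- (k / s) * \<xi>) * exp (k / s * \<xi>)) / (k / s)"
  proof -
    have "x * (n * e1) * (e2 / K) = n * x * (e1 * e2) / K" for x n e1 e2 K :: real by simp
    then show ?thesis .
  qed
  also have "\<dots> = norm (f lam \<xi>) * (norm lam * (1 / R0 - 1 / R \<xi>) * (s / k))"
    by (simp flip: exp_add)
  finally show ?thesis .
qed

lemma tendsto_f_at_bot: "Re lam \<ge> 0 \<Longrightarrow> (f lam \<longlongrightarrow> 0) at_bot"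
proof (rule Lim_null_comparison)
  assume "Re lam \<ge> 0"
  then show "\<forall>\<^sub>F y in at_bot. norm (f lam y) \<le> exp (k / (2 * s) * y)"
    using \<delta>_pos by (intro eventually_mono[OF eventually_le_at_bot[of 0]] norm_f_le) auto
  show "((\<lambda>y. exp (k / (2 * s) * y)) \<longlongrightarrow> 0) at_bot"
    using k_pos s_pos by (intro filterlim_compose[OF exp_at_bot]
      filterlim_tendsto_pos_mult_at_bot[OF tendsto_const _ filterlim_ident]) simp
qed

lemma Psi_eq: "Psi q k s up lam = integral {..0} (\<lambda>y. f lam y / of_real (R y))"
  unfolding Psi_def
proof (rule Henstock_Kurzweil_Integration.integral_cong)
  fix y :: real assume "y \<in> {..0}"
  then have "exp (- integral {y..0} (P_fun q k s up lam)) = exp (lam * of_real (h y))"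
    by (simp add: integral_P_fun)
  then show "exp (- integral {y..0} (P_fun q k s up lam)) *
      (exp ((of_real k + lam) / of_real s * of_real y) / of_real (R y)) = f lam y / of_real (R y)"
    by (simp add: f_def exp_add)
qed

text \<open>
  For a decaying solution \<open>(z1, z2)\<close> of the scalar equations, this relates its values at \<open>0\<close>:
  the derivative of \<open>e\<^bsup>\<lambda>h\<^esup> z1 + (q k C / (k + \<lambda>)) f\<close> is a multiple of the integrand of \<open>\<Psi>\<close>.
\<close>

lemma decaying_solution_at_0:
  fixes z1 :: "real \<Rightarrow> complex"
  assumes lam: "Re lam \<ge> 0"
    and z1: "\<And>\<xi>. \<xi> < 0 \<Longrightarrow> (z1 has_vector_derivative
        - (lam / of_real (R \<xi>)) * z1 \<xi> - of_real (q * k / s) * (C * exp ((of_real k + lam) / of_real s * of_real \<xi>))) (at \<xi>)"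
    and lim: "(z1 \<longlongrightarrow> z1 0) (at_left 0)" and decay: "(z1 \<longlongrightarrow> 0) at_bot"
  shows "z1 0 = - (of_real (q * k) * C / (of_real k + lam)) * (1 - lam * Psi q k s up lam)"
proof -
  have nz: "of_real k + lam \<noteq> 0" using lam k_pos by (auto simp: complex_eq_iff)
  have lam': "Re lam > - \<delta>" using lam \<delta>_pos by simp
  define a where "a = of_real (q * k) * C / (of_real k + lam)"
  define F where "F \<xi> = exp (lam * of_real (h \<xi>)) * z1 \<xi> + a * f lam \<xi>" for \<xi>
  have norm_eh: "norm (exp (lam * of_real (h y))) \<le> 1" if "y \<le> 0" for y
    using h_bounds(1)[OF that] lam by (simp add: mult_nonneg_nonpos)
  have F': "(F has_vector_derivative lam * a * (f lam \<xi> / of_real (R \<xi>))) (at \<xi>)" if "\<xi> < 0" for \<xi>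
  proof -
    have "((\<lambda>\<xi>. lam * of_real (h \<xi>)) has_vector_derivative lam * of_real (1 / R \<xi>)) (at \<xi>)"
      by (intro has_vector_derivative_mult_right has_vector_derivative_of_real
        h_deriv)
    from field_vector_diff_chain_at[OF this DERIV_exp]
    have "((\<lambda>\<xi>. exp (lam * of_real (h \<xi>))) has_vector_derivative
        lam * of_real (1 / R \<xi>) * exp (lam * of_real (h \<xi>))) (at \<xi>)"
      by (simp add: o_def)
    from has_vector_derivative_add[OF has_vector_derivative_mult[OF this z1[OF that]]
        has_vector_derivative_mult_right[OF f_deriv, of a]]
    have "(F has_vector_derivative exp (lam * of_real (h \<xi>)) * (- (lam / of_real (R \<xi>)) * z1 \<xi> -
          of_real (q * k / s) * (C * exp ((of_real k + lam) / of_real s * of_real \<xi>))) +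
        lam * of_real (1 / R \<xi>) * exp (lam * of_real (h \<xi>)) * z1 \<xi> +
        a * ((lam / of_real (R \<xi>) + (of_real k + lam) / of_real s) * f lam \<xi>)) (at \<xi>)"
      unfolding F_def by simp
    also have "exp (lam * of_real (h \<xi>)) * (- (lam / of_real (R \<xi>)) * z1 \<xi> -
          of_real (q * k / s) * (C * exp ((of_real k + lam) / of_real s * of_real \<xi>))) +
        lam * of_real (1 / R \<xi>) * exp (lam * of_real (h \<xi>)) * z1 \<xi> +
        a * ((lam / of_real (R \<xi>) + (of_real k + lam) / of_real s) * f lam \<xi>) =
        - of_real (q * k / s) * C * f lam \<xi> + a * ((of_real k + lam) / of_real s) * f lam \<xi> +
        lam * a * (f lam \<xi> / of_real (R \<xi>))"
      by (simp add: f_def exp_add algebra_simps)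
    \<comment> \<open>This identity dictates the value of a: the forcing term cancels, and only the
      term with 1 / R, the integrand of \<Psi>, is left.\<close>
    also have "a * ((of_real k + lam) / of_real s) = of_real (q * k / s) * C"
      unfolding a_def using nz by simp
    finally show ?thesis by simp
  qed
  have F_cont: "continuous_on {..0} F"
    unfolding continuous_on
  proof
    fix x :: real assume "x \<in> {..0}"
    then consider "x < 0" | "x = 0" by fastforce
    then show "(F \<longlongrightarrow> F x) (at x within {..0})"
    proof cases
      case 1
      then show ?thesis
        using has_vector_derivative_continuous[OF F'] by (simp add: continuous_at tendsto_within_subset[of F _ x UNIV])
    next
      case 2
      have "continuous_on UNIV (\<lambda>x. exp (lam * of_real (h x)))" "continuous_on UNIV (f lam)"
        by (intro continuous_intros continuous_on_f[OF continuous_on_id])+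
      then have "((\<lambda>x. exp (lam * of_real (h x))) \<longlongrightarrow> exp (lam * of_real (h 0))) (at_left 0)"
        "(f lam \<longlongrightarrow> f lam 0) (at_left 0)"
        by (auto simp: continuous_on intro: tendsto_within_subset)
      then have "(F \<longlongrightarrow> F 0) (at_left 0)"
        unfolding F_def by (intro tendsto_add tendsto_mult tendsto_const lim)
      moreover have "at_left (0::real) = at 0 within {..0}"
        by (simp add: at_within_Iic_at_left)
      ultimately show ?thesis using 2 by simp
    qed
  qed
  have F_lim: "(F \<longlongrightarrow> 0) at_bot"
  proof -
    have "((\<lambda>\<xi>. exp (lam * of_real (h \<xi>)) * z1 \<xi>) \<longlongrightarrow> 0) at_bot"
    proof (rule Lim_null_comparison)
      show "\<forall>\<^sub>F \<xi> in at_bot. norm (exp (lam * of_real (h \<xi>)) * z1 \<xi>) \<le> norm (z1 \<xi>)"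
      proof (rule eventually_mono[OF eventually_le_at_bot[of 0]])
        show "norm (exp (lam * of_real (h \<xi>)) * z1 \<xi>) \<le> norm (z1 \<xi>)" if "\<xi> \<le> 0" for \<xi>
          unfolding norm_mult using mult_right_mono[OF norm_eh[OF that] norm_ge_zero[of "z1 \<xi>"]] by simp
      qed
      show "((\<lambda>\<xi>. norm (z1 \<xi>)) \<longlongrightarrow> 0) at_bot" using decay by (rule tendsto_norm_zero)
    qed
    from tendsto_add[OF this tendsto_mult[OF tendsto_const tendsto_f_at_bot[OF lam], of a]]
    show ?thesis by (simp add: F_def[abs_def])
  qed
  have cont: "continuous_on {..0} (\<lambda>y. lam * a * (f lam y / of_real (R y)))"
    using R_pos by (intro continuous_intros) (auto simp: less_imp_neq[symmetric])
  have bound: "norm (lam * a * (f lam y / of_real (R y))) \<le> norm (lam * a) / R0 * exp (k / (2 * s) * y)"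
    if "y \<le> 0" for y
  proof -
    have "norm (f lam y / of_real (R y)) \<le> exp (k / (2 * s) * y) / R0"
      using norm_f_le[OF lam' that] R_gt[of y] R0_pos by (auto simp: norm_divide intro!: frac_le)
    from mult_left_mono[OF this norm_ge_zero[of "lam * a"]]
    have "norm (lam * a * (f lam y / of_real (R y))) \<le> norm (lam * a) * (exp (k / (2 * s) * y) / R0)"
      by (simp only: norm_mult[of "lam * a"])
    then show ?thesis by simp
  qed
  have "k / (2 * s) > 0" using k_pos s_pos by simp
  from integral_atMost_FTC[OF this cont bound F' F_cont F_lim]
  have "integral {..0} (\<lambda>y. lam * a * (f lam y / of_real (R y))) = F 0" .
  then have "lam * a * Psi q k s up lam = F 0"
    unfolding Psi_eq by (simp only: integral_mult_right)
  \<comment> \<open>Here h 0 = 0 makes both exponentials equal to 1.\<close>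
  then have "lam * a * Psi q k s up lam = z1 0 + a"
    by (simp add: F_def h_zero f_def)
  then have "z1 0 = - a * (1 - lam * Psi q k s up lam)" by (simp add: algebra_simps)
  then show ?thesis by (simp add: a_def)
qed

end

section \<open>The decaying mode and the Lopatinski determinant\<close>

lemma vec2_eq_iff: "(v :: 'a ^ 2) = w \<longleftrightarrow> v $ 1 = w $ 1 \<and> v $ 2 = w $ 2"
  by (simp add: vec_eq_iff forall_2)

lemma tendsto_vec2:
  fixes v :: "'b::topological_space ^ 2"
  assumes "((\<lambda>x. g x $ 1) \<longlongrightarrow> v $ 1) F" "((\<lambda>x. g x $ 2) \<longlongrightarrow> v $ 2) F"
  shows "(g \<longlongrightarrow> v) F"
proof (rule vec_tendstoI)
  show "((\<lambda>x. g x $ i) \<longlongrightarrow> v $ i) F" for i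
    using exhaust_2[of i] assms by auto
qed

lemma has_vector_derivative_vec2:
  fixes a b :: "real \<Rightarrow> complex"
  assumes "(a has_vector_derivative a') F" "(b has_vector_derivative b') F"
  shows "((\<lambda>x. vector [a x, b x] :: complex ^ 2) has_vector_derivative vector [a', b']) F"
proof -
  have "bounded_linear (\<lambda>x :: complex. vector [x, 0] :: complex ^ 2)"
    "bounded_linear (\<lambda>x :: complex. vector [0, x] :: complex ^ 2)"
    unfolding linear_conv_bounded_linear[symmetric]
    by (rule linearI; simp add: vec2_eq_iff)+
  from has_vector_derivative_add[OF bounded_linear.has_vector_derivative[OF this(1) assms(1)]
      bounded_linear.has_vector_derivative[OF this(2) assms(2)]]
  have "((\<lambda>x. (vector [a x, 0] :: complex ^ 2) + vector [0, b x]) has_vector_derivative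
      vector [a', 0] + vector [0, b']) F" .
  moreover have "(vector [x, 0] :: complex ^ 2) + vector [0, y] = vector [x, y]" for x y
    by (simp add: vec2_eq_iff)
  ultimately show ?thesis by simp
qed

lemma norm_vec2_le: "norm (v :: complex ^ 2) \<le> norm (v $ 1) + norm (v $ 2)"
  unfolding norm_vec_def using L2_set_le_sum[of UNIV "\<lambda>i. norm (v $ i)"] by (simp add: sum_2)

text \<open>\<open>matrix_inv\<close> is a choice among two-sided inverses, so a candidate is
  identified through uniqueness.\<close>

lemma matrix_inv_eqI:
  fixes A :: "'a::field ^ 'n ^ 'n"
  assumes "A ** B = mat 1" "B ** A = mat 1"
  shows "matrix_inv A = B"
proof -
  have "\<exists>B. A ** B = mat 1 \<and> B ** A = mat 1" using assms by blast
  then have "matrix_inv A ** A = mat 1"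
    unfolding matrix_inv_def by (rule someI2_ex) blast
  then have "matrix_inv A ** (A ** B) = B"
    by (simp add: matrix_mul_assoc)
  then show ?thesis using assms(1) by simp
qed

section \<open>The limiting system and an explicit decaying mode\<close>

context majda_ignition
begin

text \<open>The coefficient matrix depends on \<xi> only through r = R \<xi>; with r as the
  argument, the limiting matrix is the value at \<open>R0\<close>.\<close>

definition G :: "complex \<Rightarrow> real \<Rightarrow> complex ^ 2 ^ 2" where
  "G lam r = vector [vector [- lam / of_real r, - of_real (q * k / s)],
                     vector [0, (of_real k + lam) / of_real s]]"

lemma G_mult: "G lam r *v w =
    vector [- (lam / of_real r) * w $ 1 - of_real (q * k / s) * w $ 2, (of_real k + lam) / of_real s * w $ 2]"
  by (simp add: G_def vec2_eq_iff matrix_vector_mult_def sum_2)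

text \<open>The decaying direction of the limiting system, normalised by its second component.\<close>

definition v_minus :: "complex \<Rightarrow> complex ^ 2" where
  "v_minus lam = vector [- of_real (q * k / s) / (lam / of_real R0 + (of_real k + lam) / of_real s), 1]"

text \<open>The gap between the eigenvalues (k + \<lambda>) / s and - \<lambda> / R0 of the limiting
  matrix; its real part is positive.\<close>

lemma rate_nonzero:
  assumes "Re lam \<ge> 0"
  shows "lam / of_real R0 + (of_real k + lam) / of_real s \<noteq> 0"
proof -
  have "Re (lam / of_real R0 + (of_real k + lam) / of_real s) = Re lam / R0 + (k + Re lam) / s"
    by simp
  also have "\<dots> > 0" using assms R0_pos k_pos s_pos by (intro add_nonneg_pos) auto
  finally show ?thesis by (metis less_irrefl zero_complex.sel(1))
qed

text \<open>\<open>v_minus lam\<close> is an eigenvector for the eigenvalue (k + \<lambda>) / s.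
  Membership is all that an upper bound on \<open>infdist\<close> calls for.\<close>

lemma v_minus_in_decaying_subspace:
  assumes "Re lam \<ge> 0"
  shows "c *s v_minus lam \<in> decaying_subspace (G lam R0)"
proof -
  let ?m = "(of_real k + lam) / of_real s" and ?n = "lam / of_real R0 + (of_real k + lam) / of_real s"
  define w where "w x = (vector [c * exp (?m * of_real x) * v_minus lam $ 1, c * exp (?m * of_real x)] :: complex ^ 2)" for x :: real
  have "(w has_vector_derivative G lam R0 *v w x) (at x)" for x
  proof -
    have "((\<lambda>x. ?m * of_real x) has_vector_derivative ?m * of_real 1) (at x)"
      by (intro has_vector_derivative_mult_right has_vector_derivative_of_real DERIV_ident)
    from field_vector_diff_chain_at[OF this DERIV_exp]
    have e: "((\<lambda>x. exp (?m * of_real x)) has_vector_derivative ?m * exp (?m * of_real x)) (at x)"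
      by (simp add: o_def)
    have "(w has_vector_derivative vector [c * (?m * exp (?m * of_real x)) * v_minus lam $ 1,
        c * (?m * exp (?m * of_real x))]) (at x)"
      unfolding w_def
      by (intro has_vector_derivative_vec2 has_vector_derivative_mult_left has_vector_derivative_mult_right e)
    moreover have "?m * v_minus lam $ 1 = - (lam / of_real R0) * v_minus lam $ 1 - of_real (q * k / s)"
    proof -
      have "?n * v_minus lam $ 1 = - of_real (q * k / s)"
        using rate_nonzero[OF assms] by (simp add: v_minus_def)
      moreover have "(a + m) * v = - d \<Longrightarrow> m * v = - a * v - d" for a m v d :: complex by algebra
      ultimately show ?thesis by blast
    qed
    then have "c * (?m * exp (?m * of_real x)) * v_minus lam $ 1 =
        c * exp (?m * of_real x) * (- (lam / of_real R0) * v_minus lam $ 1 - of_real (q * k / s))"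
      by (metis mult.assoc mult.commute)
    then have "vector [c * (?m * exp (?m * of_real x)) * v_minus lam $ 1,
        c * (?m * exp (?m * of_real x))] = G lam R0 *v w x"
      by (simp add: G_mult w_def vec2_eq_iff) (simp add: algebra_simps)
    ultimately show ?thesis by simp
  qed
  moreover have "decays_exponentially w"
    unfolding decays_exponentially_def
  proof (intro exI conjI)
    show "0 < Re ?m" using assms k_pos s_pos by simp
    show "\<forall>\<^sub>F x in at_bot. norm (w x) \<le> norm c * (norm (v_minus lam $ 1) + 1) * exp (Re ?m * x)"
    proof (intro always_eventually allI)
      fix x
      have "norm (w x) \<le> norm (w x $ 1) + norm (w x $ 2)" by (rule norm_vec2_le)
      also have "\<dots> = norm c * (norm (v_minus lam $ 1) + 1) * exp (Re ?m * x)"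
        by (simp add: w_def norm_mult algebra_simps)
      finally show "norm (w x) \<le> norm c * (norm (v_minus lam $ 1) + 1) * exp (Re ?m * x)" .
    qed
  qed
  moreover have "c *s v_minus lam = w 0"
    by (simp add: w_def vec2_eq_iff) (simp add: v_minus_def)
  ultimately show ?thesis unfolding decaying_subspace_def by blast
qed

text \<open>Variation of constants with no homogeneous contribution exp(- \<lambda> h), normalised
  so that the second component is 1 at \<xi> = 0.\<close>

definition Z0 :: "complex \<Rightarrow> real \<Rightarrow> complex ^ 2" where
  "Z0 lam \<xi> = vector [- of_real (q * k / s) * (exp (- lam * of_real (h \<xi>)) * J lam \<xi>),
                     exp ((of_real k + lam) / of_real s * of_real \<xi>)]"

lemma exp_minus_h_f: "exp (- lam * of_real (h \<xi>)) * f lam \<xi> = exp ((of_real k + lam) / of_real s * of_real \<xi>)"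
  by (simp add: f_def flip: exp_add)

lemma Z0_deriv:
  assumes "Re lam \<ge> 0" "\<xi> < 0"
  shows "(Z0 lam has_vector_derivative G lam (R \<xi>) *v Z0 lam \<xi>) (at \<xi>)"
proof -
  let ?m = "(of_real k + lam) / of_real s"
  have lam': "Re lam > - \<delta>" using assms \<delta>_pos by simp
  have "((\<lambda>x. ?m * of_real x) has_vector_derivative ?m * of_real 1) (at \<xi>)"
    by (intro has_vector_derivative_mult_right has_vector_derivative_of_real DERIV_ident)
  from field_vector_diff_chain_at[OF this DERIV_exp]
  have e2: "((\<lambda>x. exp (?m * of_real x)) has_vector_derivative ?m * exp (?m * of_real \<xi>)) (at \<xi>)"
    by (simp add: o_def)
  have "((\<lambda>x. - lam * of_real (h x)) has_vector_derivative - lam * of_real (1 / R \<xi>)) (at \<xi>)"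
    by (intro has_vector_derivative_mult_right has_vector_derivative_of_real h_deriv)
  from field_vector_diff_chain_at[OF this DERIV_exp]
  have e1: "((\<lambda>x. exp (- lam * of_real (h x))) has_vector_derivative
      - lam * of_real (1 / R \<xi>) * exp (- lam * of_real (h \<xi>))) (at \<xi>)"
    by (simp add: o_def)
  have "(Z0 lam has_vector_derivative vector [- of_real (q * k / s) *
      (exp (- lam * of_real (h \<xi>)) * f lam \<xi> + - lam * of_real (1 / R \<xi>) * exp (- lam * of_real (h \<xi>)) * J lam \<xi>),
      ?m * exp (?m * of_real \<xi>)]) (at \<xi>)"
    unfolding Z0_def
    by (intro has_vector_derivative_vec2 has_vector_derivative_mult_right
        has_vector_derivative_mult e1 e2 J_deriv lam' assms)
  moreover have "vector [- of_real (q * k / s) *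
      (exp (- lam * of_real (h \<xi>)) * f lam \<xi> + - lam * of_real (1 / R \<xi>) * exp (- lam * of_real (h \<xi>)) * J lam \<xi>),
      ?m * exp (?m * of_real \<xi>)] = G lam (R \<xi>) *v Z0 lam \<xi>"
  proof -
    have alg: "- c * (e + - l * (1 / r) * E * j) = - (l / r) * (- c * (E * j)) - c * e" for c e l r E j :: complex
      by (simp add: divide_inverse algebra_simps)
    show ?thesis
      unfolding exp_minus_h_f G_mult Z0_def vector_2 of_real_divide of_real_1 alg ..
  qed
  ultimately show ?thesis by simp
qed

lemma Z0_tendsto_0:
  assumes "Re lam \<ge> 0"
  shows "(Z0 lam \<longlongrightarrow> Z0 lam 0) (at_left 0)"
proof (rule tendsto_vec2)
  have lam': "Re lam > - \<delta>" using assms \<delta>_pos by simp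
  have "continuous_on UNIV (\<lambda>x. exp (- lam * of_real (h x)))"
    by (intro continuous_intros)
  then have "((\<lambda>x. exp (- lam * of_real (h x))) \<longlongrightarrow> exp (- lam * of_real (h 0))) (at 0 within UNIV)"
    unfolding continuous_on by (rule bspec) simp
  then have "((\<lambda>x. exp (- lam * of_real (h x))) \<longlongrightarrow> exp (- lam * of_real (h 0))) (at_left 0)"
    by (rule tendsto_within_subset) simp
  then show "((\<lambda>x. Z0 lam x $ 1) \<longlongrightarrow> Z0 lam 0 $ 1) (at_left 0)"
    unfolding Z0_def vector_2 by (intro tendsto_mult tendsto_const J_tendsto_0[OF lam'])
  show "((\<lambda>x. Z0 lam x $ 2) \<longlongrightarrow> Z0 lam 0 $ 2) (at_left 0)"
    unfolding Z0_def vector_2 by (intro tendsto_intros)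
qed

lemma norm_exp_rate: "norm (exp ((of_real k + lam) / of_real s * of_real \<xi>) :: complex) = exp ((k + Re lam) / s * \<xi>)"
  by simp

text \<open>The factor exp(- \<lambda> h) may grow at minus infinity, but \<open>J\<close> is
  bounded by a multiple of \<open>f\<close>, which carries the reciprocal factor. The product decays
  at the rate of the second component.\<close>

lemma Z0_decays:
  assumes "Re lam \<ge> 0"
  shows "decays_exponentially (Z0 lam)"
  unfolding decays_exponentially_def
proof (intro exI conjI)
  show "0 < (k + Re lam) / s" using assms k_pos s_pos by simp
  show "\<forall>\<^sub>F \<xi> in at_bot. norm (Z0 lam \<xi>) \<le> (q + 1) * exp ((k + Re lam) / s * \<xi>)"
  proof (intro always_eventually allI)
    fix \<xi>
    let ?e = "exp (- lam * of_real (h \<xi>))"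
    have "norm (Z0 lam \<xi> $ 1) = q * k / s * (norm ?e * norm (J lam \<xi>))"
      using q_pos k_pos s_pos by (simp add: Z0_def norm_mult norm_divide)
    also have "\<dots> \<le> q * k / s * (norm ?e * (norm (f lam \<xi>) * (s / k)))"
      using q_pos k_pos s_pos norm_J_le[OF assms] by (intro mult_left_mono) auto
    also have "\<dots> = q * norm (?e * f lam \<xi>)"
      unfolding norm_mult using k_pos s_pos by simp
    also have "\<dots> = q * exp ((k + Re lam) / s * \<xi>)"
      unfolding exp_minus_h_f norm_exp_rate ..
    finally have "norm (Z0 lam \<xi> $ 1) \<le> q * exp ((k + Re lam) / s * \<xi>)" .
    moreover have "norm (Z0 lam \<xi> $ 2) = exp ((k + Re lam) / s * \<xi>)"
      unfolding Z0_def vector_2 by (rule norm_exp_rate)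
    ultimately show "norm (Z0 lam \<xi>) \<le> (q + 1) * exp ((k + Re lam) / s * \<xi>)"
      using norm_vec2_le[of "Z0 lam \<xi>"] by (simp add: distrib_right)
  qed
qed

text \<open>The unit vector along the mode is compared with a multiple of \<open>v_minus lam\<close>
  that has the same second component. The first components then differ by at most the relative error
  of \<open>J_asymptotic\<close>, which vanishes as R tends to \<open>R0\<close>.\<close>

lemma Z0_tangent:
  assumes "Re lam \<ge> 0"
  shows "((\<lambda>\<xi>. infdist (Z0 lam \<xi> /\<^sub>R norm (Z0 lam \<xi>)) (decaying_subspace (G lam R0))) \<longlongrightarrow> 0) at_bot"
proof (rule Lim_null_comparison)
  let ?m = "(of_real k + lam) / of_real s" and ?n = "lam / of_real R0 + (of_real k + lam) / of_real s"
  let ?B = "\<lambda>\<xi>. q * k / s / norm ?n * (norm lam * (1 / R0 - 1 / R \<xi>) * (s / k))"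
  show "\<forall>\<^sub>F \<xi> in at_bot. norm (infdist (Z0 lam \<xi> /\<^sub>R norm (Z0 lam \<xi>)) (decaying_subspace (G lam R0))) \<le> ?B \<xi>"
  proof (rule eventually_mono[OF eventually_le_at_bot[of 0]])
    fix \<xi> :: real assume \<xi>: "\<xi> \<le> 0"
    let ?N = "norm (Z0 lam \<xi>)" and ?e = "exp (?m * of_real \<xi>)"
    define c where "c = ?e / of_real ?N"
    have "norm (Z0 lam \<xi> $ 2) \<le> ?N" by (rule Finite_Cartesian_Product.norm_nth_le)
    then have N: "norm ?e \<le> ?N" by (simp add: Z0_def)
    have e_pos: "norm ?e > 0" by simp
    have N_pos: "?N > 0" using N e_pos by linarith
    \<comment> \<open>Factoring out the eigenvalue gap exposes exactly the combination of
      \<open>J\<close> and \<open>f\<close> estimated before.\<close>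
    have diff: "Z0 lam \<xi> $ 1 - ?e * v_minus lam $ 1 =
        - of_real (q * k / s) / ?n * (exp (- lam * of_real (h \<xi>)) * (?n * J lam \<xi> - f lam \<xi>))"
    proof -
      have "- d * (E * j) - e * (- d / n) = - d / n * (E * (n * j) - e)" if "n \<noteq> 0" for d E j e n :: complex
        using that by (simp add: field_simps)
      from this[OF rate_nonzero[OF assms]] show ?thesis
        unfolding right_diff_distrib[of "exp _"] exp_minus_h_f Z0_def v_minus_def vector_2 .
    qed
    have "norm (Z0 lam \<xi> $ 1 - ?e * v_minus lam $ 1) =
        q * k / s / norm ?n * (norm (exp (- lam * of_real (h \<xi>))) * norm (?n * J lam \<xi> - f lam \<xi>))"
      unfolding diff norm_mult norm_divide using q_pos k_pos s_pos by (simp add: norm_mult norm_divide)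
    also have "\<dots> \<le> q * k / s / norm ?n * (norm (exp (- lam * of_real (h \<xi>))) *
        (norm (f lam \<xi>) * (norm lam * (1 / R0 - 1 / R \<xi>) * (s / k))))"
      using q_pos k_pos s_pos by (intro mult_left_mono J_asymptotic assms \<xi>) auto
    also have "\<dots> = norm (exp (- lam * of_real (h \<xi>)) * f lam \<xi>) * ?B \<xi>"
      unfolding norm_mult by (simp only: ac_simps)
    also have "\<dots> = norm ?e * ?B \<xi>" unfolding exp_minus_h_f ..
    finally have d: "norm (Z0 lam \<xi> $ 1 - ?e * v_minus lam $ 1) \<le> norm ?e * ?B \<xi>" .
    have "infdist (Z0 lam \<xi> /\<^sub>R ?N) (decaying_subspace (G lam R0)) \<le> dist (Z0 lam \<xi> /\<^sub>R ?N) (c *s v_minus lam)"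
      by (rule infdist_le[OF v_minus_in_decaying_subspace[OF assms]])
    also have "\<dots> \<le> norm ((Z0 lam \<xi> /\<^sub>R ?N - c *s v_minus lam) $ 1) + norm ((Z0 lam \<xi> /\<^sub>R ?N - c *s v_minus lam) $ 2)"
      unfolding dist_norm by (rule norm_vec2_le)
    also have "(Z0 lam \<xi> /\<^sub>R ?N - c *s v_minus lam) $ 2 = 0"
    proof -
      have "Z0 lam \<xi> $ 2 = ?e" "v_minus lam $ 2 = 1" by (simp_all only: Z0_def v_minus_def vector_2)
      then show ?thesis
        unfolding vector_minus_component vector_scaleR_component vector_smult_component c_def
        by (simp add: scaleR_conv_of_real[where 'a=complex] divide_inverse)
    qed
    also have "(Z0 lam \<xi> /\<^sub>R ?N - c *s v_minus lam) $ 1 = (Z0 lam \<xi> $ 1 - ?e * v_minus lam $ 1) / of_real ?N"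
      unfolding vector_minus_component vector_scaleR_component vector_smult_component c_def
      by (simp add: scaleR_conv_of_real[where 'a=complex] divide_inverse algebra_simps)
    also have "norm \<dots> + norm (0 :: complex) \<le> norm ?e * ?B \<xi> / ?N"
      unfolding norm_zero add_0_right norm_divide norm_of_real abs_norm_cancel
      by (rule divide_right_mono[OF d norm_ge_zero])
    also have "\<dots> \<le> ?B \<xi>"
    proof -
      have "0 \<le> ?B \<xi>" using R_gt[of \<xi>] R0_pos q_pos k_pos s_pos by (intro mult_nonneg_nonneg) (auto simp: frac_le)
      then have "norm ?e * ?B \<xi> \<le> ?N * ?B \<xi>" using N by (rule mult_right_mono[rotated])
      then show ?thesis unfolding pos_divide_le_eq[OF N_pos] mult.commute[of "?B \<xi>" ?N] .
    qed
    finally show "norm (infdist (Z0 lam \<xi> /\<^sub>R ?N) (decaying_subspace (G lam R0))) \<le> ?B \<xi>"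
      by (simp add: infdist_nonneg)
  qed
  have "(?B \<longlongrightarrow> q * k / s / norm ?n * (norm lam * (1 / R0 - 1 / R0) * (s / k))) at_bot"
    by (intro tendsto_intros tendsto_R_at_bot) (use R0_pos in auto)
  then show "(?B \<longlongrightarrow> 0) at_bot" by simp
qed

lemma Z0_analytic:
  assumes "\<xi> \<le> 0"
  shows "(\<lambda>lam. Z0 lam \<xi> $ i) analytic_on {lam. Re lam \<ge> 0}"
proof -
  let ?U = "{lam. Re lam > - \<delta>}"
  have "(\<lambda>lam. Z0 lam \<xi> $ 1) holomorphic_on ?U"
    unfolding Z0_def vector_2 by (intro holomorphic_intros J_holomorphic assms)
  moreover have "(\<lambda>lam. Z0 lam \<xi> $ 2) holomorphic_on ?U"
    unfolding Z0_def vector_2 using s_pos by (intro holomorphic_intros) auto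
  ultimately have "(\<lambda>lam. Z0 lam \<xi> $ i) holomorphic_on ?U" using exhaust_2[of i] by auto
  then have "(\<lambda>lam. Z0 lam \<xi> $ i) analytic_on ?U"
    by (simp add: analytic_on_open open_halfspace_Re_gt)
  then show ?thesis by (rule analytic_on_subset) (use \<delta>_pos in auto)
qed

section \<open>Jumps and decaying modes along a given detonation\<close>

context
  fixes ub zb :: "real \<Rightarrow> real"
  assumes det: "strong_ZND_detonation q k \<phi> s (s + R0) up ub zb"
begin

lemmas profile_right = detonation_profile(1)[OF det]
lemmas profile_left = detonation_profile(2)[OF det]

lemma G_mat_eq:
  assumes "\<xi> < 0"
  shows "G_mat q k \<phi> s ub zb lam \<xi> = G lam (R \<xi>)"
proof -
  have ub: "ub \<xi> = s + R \<xi>" using profile_left[OF assms] by simp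
  obtain N1 where N1: "open N1" "{s + R0..2 * s - up} \<subseteq> N1" "\<And>v. v \<in> N1 \<Longrightarrow> \<phi> v = 1"
    using ignition_1 by blast
  have in_N1: "ub \<xi> \<in> N1" using N1(2) R_gt[of \<xi>] R_le[of \<xi>] assms ub by (auto simp: subset_iff)
  have "(\<phi> has_real_derivative 0) (at (ub \<xi>))"
    by (rule has_field_derivative_transform_within_open[OF DERIV_const[of 1] N1(1) in_N1]) (simp add: N1(3))
  then have d: "deriv \<phi> (ub \<xi>) = 0" by (rule DERIV_imp_deriv)
  have p: "\<phi> (ub \<xi>) = 1" using N1(3) in_N1 by simp
  have inv: "matrix_inv (A_mat s ub \<xi>) = vector [vector [of_real (1 / R \<xi>), 0], vector [0, of_real (- 1 / s)]]"
    using R_pos[of \<xi>] s_pos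
    by (intro matrix_inv_eqI) (simp_all add: A_mat_def ub vec2_eq_iff matrix_matrix_mult_def sum_2 mat_def)
  show ?thesis
    unfolding G_mat_def inv
    by (simp add: E_mat_def d p G_def vec2_eq_iff matrix_matrix_mult_def sum_2 mat_def)
       (simp add: minus_divide_left)
qed

lemma G_minus_eq: "G_minus q k \<phi> s ub zb lam = G lam R0"
  unfolding G_minus_def
proof (rule tendsto_Lim)
  have "((\<lambda>\<xi>. G lam (R \<xi>)) \<longlongrightarrow> G lam R0) at_bot"
    unfolding G_def
    by (intro tendsto_vec2; simp; intro tendsto_intros tendsto_R_at_bot) (use R0_pos in auto)
  moreover have "\<forall>\<^sub>F \<xi> in at_bot. G lam (R \<xi>) = G_mat q k \<phi> s ub zb lam \<xi>"
    by (rule eventually_mono[OF eventually_gt_at_bot[of 0]]) (simp add: G_mat_eq)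
  ultimately show "(G_mat q k \<phi> s ub zb lam \<longlongrightarrow> G lam R0) at_bot"
    using tendsto_cong by fast
qed simp

lemma decaying_mode_Z0: "decaying_mode q k \<phi> s ub zb Z0"
  unfolding decaying_mode_def
proof (intro conjI allI impI)
  fix lam :: complex assume lam: "Re lam \<ge> 0"
  show "(Z0 lam has_vector_derivative G_mat q k \<phi> s ub zb lam \<xi> *v Z0 lam \<xi>) (at \<xi>)" if "\<xi> < 0" for \<xi>
    using Z0_deriv[OF lam that] by (simp add: G_mat_eq that)
  show "(Z0 lam \<longlongrightarrow> Z0 lam 0) (at_left 0)" by (rule Z0_tendsto_0[OF lam])
  show "\<exists>\<xi><0. Z0 lam \<xi> \<noteq> 0"
    by (rule exI[of _ "-1"]) (simp add: Z0_def vec2_eq_iff)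
  show "decays_exponentially (Z0 lam)" by (rule Z0_decays[OF lam])
  show "((\<lambda>\<xi>. infdist (Z0 lam \<xi> /\<^sub>R norm (Z0 lam \<xi>))
      (decaying_subspace (G_minus q k \<phi> s ub zb lam))) \<longlongrightarrow> 0) at_bot"
    unfolding G_minus_eq by (rule Z0_tangent[OF lam])
next
  show "(\<lambda>lam. Z0 lam \<xi> $ i) analytic_on {lam. Re lam \<ge> 0}" if "\<xi> \<le> 0" for \<xi> i
    by (rule Z0_analytic[OF that])
qed

lemma jump_profile: "jump (profile ub zb) = vector [of_real (up - (2 * s - up)), 0]"
proof -
  have "((\<lambda>\<xi>. vector [of_real (s + R \<xi>), of_real (exp (k / s * \<xi>))] :: complex ^ 2) \<longlongrightarrow>
      vector [of_real (s + (s - up)), of_real (exp (k / s * 0))]) (at_left 0)"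
    by (rule tendsto_vec2; unfold vector_2; intro tendsto_intros tendsto_R_0)
  moreover have "\<forall>\<^sub>F \<xi> in at_left 0. vector [of_real (s + R \<xi>), of_real (exp (k / s * \<xi>))] = profile ub zb \<xi>"
    by (rule eventually_mono[OF eventually_at_left_real[of "-1" "0::real"]]) (simp_all add: profile_def profile_left)
  ultimately have "(profile ub zb \<longlongrightarrow> vector [of_real (s + (s - up)), of_real (exp (k / s * 0))]) (at_left 0)"
    using tendsto_cong by fast
  then have l: "Lim (at_left 0) (profile ub zb) = vector [of_real (s + (s - up)), of_real (exp (k / s * 0))]"
    by (intro tendsto_Lim) auto
  have "\<forall>\<^sub>F \<xi> in at_right 0. profile ub zb \<xi> = vector [of_real up, 1]"
    by (rule eventually_mono[OF eventually_at_right_less]) (simp add: profile_def profile_right)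
  then have r: "Lim (at_right 0) (profile ub zb) = vector [of_real up, 1]"
    by (intro tendsto_Lim tendsto_eventually) auto
  show ?thesis unfolding jump_def l r by (simp add: vec2_eq_iff)
qed

text \<open>Behind the shock the factor R = u - s in A cancels the denominator of u', so the left
  limit is (q k, - k); ahead of the shock the profile is constant.\<close>

lemma jump_flux_derivative:
  "jump (\<lambda>\<xi>. A_mat s ub \<xi> *v vector_derivative (profile ub zb) (at \<xi>)) = vector [- of_real (q * k), of_real k]"
proof -
  let ?a = "\<lambda>\<xi>. A_mat s ub \<xi> *v vector_derivative (profile ub zb) (at \<xi>)"
  let ?g = "\<lambda>\<xi>. vector [of_real (q * k * exp (k / s * \<xi>)), of_real (- k * exp (k / s * \<xi>))] :: complex ^ 2"
  have left: "?a \<xi> = ?g \<xi>" if "\<xi> < 0" for \<xi>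
  proof -
    have R': "((\<lambda>\<xi>. s + R \<xi>) has_real_derivative 0 + q * k * exp (k / s * \<xi>) / R \<xi>) (at \<xi>)"
      by (intro DERIV_add DERIV_const R_deriv)
    have z': "((\<lambda>\<xi>. exp (k / s * \<xi>)) has_real_derivative exp (k / s * \<xi>) * (k / s)) (at \<xi>)"
      using s_pos by (auto intro!: derivative_eq_intros)
    have "(profile ub zb has_vector_derivative
        vector [of_real (0 + q * k * exp (k / s * \<xi>) / R \<xi>), of_real (exp (k / s * \<xi>) * (k / s))]) (at \<xi>)"
      by (rule has_vector_derivative_transform_within_open[OF
            has_vector_derivative_vec2[OF has_vector_derivative_of_real[OF R'] has_vector_derivative_of_real[OF z']],
            where S="{..<0}"])
        (use that in \<open>auto simp: profile_def profile_left\<close>)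
    then have d: "vector_derivative (profile ub zb) (at \<xi>) =
        vector [of_real (0 + q * k * exp (k / s * \<xi>) / R \<xi>), of_real (exp (k / s * \<xi>) * (k / s))]"
      by (rule vector_derivative_at)
    show ?thesis
      unfolding d using R_pos[of \<xi>] s_pos profile_left[OF that]
      by (simp add: A_mat_def vec2_eq_iff matrix_vector_mult_def sum_2)
  qed
  have right: "?a \<xi> = 0" if "\<xi> > 0" for \<xi>
  proof -
    have "(profile ub zb has_vector_derivative 0) (at \<xi>)"
      by (rule has_vector_derivative_transform_within_open[OF
            has_vector_derivative_const[of "vector [of_real up, 1]"], where S="{0<..}"])
        (use that in \<open>auto simp: profile_def profile_right\<close>)
    then show ?thesis by (simp add: vector_derivative_at)
  qed
  have "(?g \<longlongrightarrow> vector [of_real (q * k * exp (k / s * 0)), of_real (- k * exp (k / s * 0))]) (at_left 0)"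
    by (rule tendsto_vec2; unfold vector_2; intro tendsto_intros)
  moreover have "\<forall>\<^sub>F \<xi> in at_left 0. ?g \<xi> = ?a \<xi>"
    by (rule eventually_mono[OF eventually_at_left_real[of "-1" "0::real"]]) (auto simp: left)
  ultimately have "(?a \<longlongrightarrow> vector [of_real (q * k * exp (k / s * 0)), of_real (- k * exp (k / s * 0))]) (at_left 0)"
    using tendsto_cong by fast
  then have l: "Lim (at_left 0) ?a = vector [of_real (q * k * exp (k / s * 0)), of_real (- k * exp (k / s * 0))]"
    by (intro tendsto_Lim) auto
  have "\<forall>\<^sub>F \<xi> in at_right 0. ?a \<xi> = 0"
    by (rule eventually_mono[OF eventually_at_right_less]) (rule right)
  then have r: "Lim (at_right 0) ?a = 0"
    by (intro tendsto_Lim tendsto_eventually) auto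
  show ?thesis unfolding jump_def l r by (simp add: vec2_eq_iff)
qed

lemma D_ZND_eq:
  "D_ZND s ub zb Z lam = - of_real k * Z lam 0 $ 1 + (of_real (2 * s - 2 * up) * lam - of_real (q * k)) * Z lam 0 $ 2"
  unfolding D_ZND_def Let_def jump_profile jump_flux_derivative det_transpose
  unfolding det_2
  by (simp add: algebra_simps)

text \<open>The triangular form gives Z2 = C exp((k + \<lambda>) \<xi> / s) for any admissible mode.
  The first equation then determines Z1 at 0, once its homogeneous solution has been excluded by
  decay.\<close>

lemma decaying_mode_at_0:
  assumes Z: "decaying_mode q k \<phi> s ub zb Z" and lam: "Re lam \<ge> 0"
  shows "Z lam 0 $ 2 \<noteq> 0"
    and "Z lam 0 $ 1 = - (of_real (q * k) * Z lam 0 $ 2 / (of_real k + lam)) * (1 - lam * Psi q k s up lam)"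
proof -
  let ?m = "(of_real k + lam) / of_real s"
  define C where "C = Z lam 0 $ 2"
  have Z': "\<And>\<xi>. \<xi> < 0 \<Longrightarrow> (Z lam has_vector_derivative G lam (R \<xi>) *v Z lam \<xi>) (at \<xi>)"
    and lim: "(Z lam \<longlongrightarrow> Z lam 0) (at_left 0)"
    and nontrivial: "\<exists>\<xi><0. Z lam \<xi> \<noteq> 0" and decays: "decays_exponentially (Z lam)"
    using Z lam by (auto simp: decaying_mode_def G_mat_eq)
  have z1': "((\<lambda>\<xi>. Z lam \<xi> $ 1) has_vector_derivative
      - (lam / of_real (R \<xi>)) * Z lam \<xi> $ 1 - of_real (q * k / s) * Z lam \<xi> $ 2) (at \<xi>)"
    and z2': "((\<lambda>\<xi>. Z lam \<xi> $ 2) has_vector_derivative ?m * Z lam \<xi> $ 2) (at \<xi>)" if "\<xi> < 0" for \<xi>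
    using bounded_linear.has_vector_derivative[OF bounded_linear_vec_nth Z'[OF that], of 1]
      bounded_linear.has_vector_derivative[OF bounded_linear_vec_nth Z'[OF that], of 2]
    by (simp_all add: G_mult)
  have const: "\<exists>c. \<forall>x\<in>{..<0}. g x = c"
    if "\<And>x. x < 0 \<Longrightarrow> (g has_vector_derivative 0) (at x)" for g :: "real \<Rightarrow> complex"
  proof -
    have "\<And>x. x \<in> {..<0} \<Longrightarrow> (g has_vector_derivative 0) (at x within {..<0})"
      using that has_vector_derivative_at_within by blast
    from has_vector_derivative_zero_constant[OF _ this] show ?thesis
      by (metis convex_real_interval(4))
  qed
  have exp': "((\<lambda>x. exp (c * of_real (g x))) has_vector_derivative c * of_real g' * exp (c * of_real (g x))) (at x)"
    if "(g has_real_derivative g') (at x)" for c :: complex and g g' x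
  proof -
    have "((\<lambda>x. c * of_real (g x)) has_vector_derivative c * of_real g') (at x)"
      by (intro has_vector_derivative_mult_right has_vector_derivative_of_real that)
    from field_vector_diff_chain_at[OF this DERIV_exp] show ?thesis by (simp add: o_def)
  qed
  have z2: "Z lam \<xi> $ 2 = C * exp (?m * of_real \<xi>)" if "\<xi> < 0" for \<xi>
  proof -
    have "((\<lambda>\<xi>. exp (- ?m * of_real \<xi>) * Z lam \<xi> $ 2) has_vector_derivative 0) (at \<xi>)" if "\<xi> < 0" for \<xi>
      using has_vector_derivative_mult[OF exp'[OF DERIV_ident, of "- ?m"] z2'[OF that]]
      by (simp add: algebra_simps)
    then obtain c where c: "\<And>\<xi>. \<xi> < 0 \<Longrightarrow> exp (- ?m * of_real \<xi>) * Z lam \<xi> $ 2 = c"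
      using const[of "\<lambda>\<xi>. exp (- ?m * of_real \<xi>) * Z lam \<xi> $ 2"] by auto
    have "((\<lambda>\<xi>. exp (- ?m * of_real \<xi>) * Z lam \<xi> $ 2) \<longlongrightarrow> exp (- ?m * of_real 0) * Z lam 0 $ 2) (at_left 0)"
      by (intro tendsto_intros lim)
    moreover have "\<forall>\<^sub>F \<xi> in at_left 0. exp (- ?m * of_real \<xi>) * Z lam \<xi> $ 2 = c"
      by (rule eventually_mono[OF eventually_at_left_real[of "-1" "0::real"]]) (use c in auto)
    ultimately have "exp (- ?m * of_real 0) * Z lam 0 $ 2 = c"
      by (rule tendsto_unique_eventually_eq[OF _ tendsto_const]) simp
    then have "c = C" by (simp add: C_def)
    have "exp (?m * of_real \<xi>) * exp (- ?m * of_real \<xi>) = 1"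
      by (simp flip: exp_add)
    then have "Z lam \<xi> $ 2 = exp (?m * of_real \<xi>) * (exp (- ?m * of_real \<xi>) * Z lam \<xi> $ 2)"
      by (simp only: mult.assoc[symmetric] mult_1)
    then show ?thesis unfolding c[OF that] \<open>c = C\<close> by (simp only: mult.commute)
  qed
  have decay1: "((\<lambda>\<xi>. Z lam \<xi> $ 1) \<longlongrightarrow> 0) at_bot"
  proof -
    obtain B \<alpha> where "\<alpha> > 0" and B: "\<forall>\<^sub>F \<xi> in at_bot. norm (Z lam \<xi>) \<le> B * exp (\<alpha> * \<xi>)"
      using decays by (auto simp: decays_exponentially_def)
    show ?thesis
    proof (rule Lim_null_comparison)
      show "\<forall>\<^sub>F \<xi> in at_bot. norm (Z lam \<xi> $ 1) \<le> B * exp (\<alpha> * \<xi>)"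
        using B by (rule eventually_mono) (rule order_trans[OF Finite_Cartesian_Product.norm_nth_le])
      have "((\<lambda>\<xi>. exp (\<alpha> * \<xi>)) \<longlongrightarrow> 0) at_bot"
        using \<open>\<alpha> > 0\<close> by (intro filterlim_compose[OF exp_at_bot]
            filterlim_tendsto_pos_mult_at_bot[OF tendsto_const _ filterlim_ident])
      from tendsto_mult[OF tendsto_const this, of B]
      show "((\<lambda>\<xi>. B * exp (\<alpha> * \<xi>)) \<longlongrightarrow> 0) at_bot" by simp
    qed
  qed
  show "Z lam 0 $ 1 = - (of_real (q * k) * Z lam 0 $ 2 / (of_real k + lam)) * (1 - lam * Psi q k s up lam)"
    unfolding C_def[symmetric]
  proof (rule decaying_solution_at_0[OF lam _ _ decay1])
    show "((\<lambda>\<xi>. Z lam \<xi> $ 1) has_vector_derivative - (lam / of_real (R \<xi>)) * Z lam \<xi> $ 1 -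
        of_real (q * k / s) * (C * exp (?m * of_real \<xi>))) (at \<xi>)" if "\<xi> < 0" for \<xi>
      using z1'[OF that] unfolding z2[OF that] .
    show "((\<lambda>\<xi>. Z lam \<xi> $ 1) \<longlongrightarrow> Z lam 0 $ 1) (at_left 0)" by (intro tendsto_intros lim)
  qed
  show "Z lam 0 $ 2 \<noteq> 0"
  proof
    \<comment> \<open>The first component is then c exp(- \<lambda> h), whose modulus is at least
      |c| because h \<le> 0. Decay forces c = 0 and contradicts nontriviality.\<close>
    assume "Z lam 0 $ 2 = 0"
    then have z2_0: "Z lam \<xi> $ 2 = 0" if "\<xi> < 0" for \<xi> using z2[OF that] by (simp add: C_def)
    have "((\<lambda>\<xi>. exp (lam * of_real (h \<xi>)) * Z lam \<xi> $ 1) has_vector_derivative 0) (at \<xi>)" if "\<xi> < 0" for \<xi>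
      using has_vector_derivative_mult[OF exp'[OF h_deriv, of lam] z1'[OF that]] z2_0[OF that]
      by (simp add: algebra_simps)
    then obtain c where c: "\<And>\<xi>. \<xi> < 0 \<Longrightarrow> exp (lam * of_real (h \<xi>)) * Z lam \<xi> $ 1 = c"
      using const[of "\<lambda>\<xi>. exp (lam * of_real (h \<xi>)) * Z lam \<xi> $ 1"] by auto
    have "norm c \<le> 0"
    proof (rule tendsto_le[OF _ tendsto_norm_zero[OF decay1] tendsto_const])
      show "\<forall>\<^sub>F \<xi> in at_bot. norm c \<le> norm (Z lam \<xi> $ 1)"
      proof (rule eventually_mono[OF eventually_gt_at_bot[of 0]])
        fix \<xi> :: real assume "\<xi> < 0"
        then have "norm (exp (lam * of_real (h \<xi>))) \<le> 1"
          using h_bounds(1)[of \<xi>] lam by (simp add: mult_nonneg_nonpos)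
        then show "norm c \<le> norm (Z lam \<xi> $ 1)"
          unfolding c[OF \<open>\<xi> < 0\<close>, symmetric] norm_mult by (intro mult_left_le_one_le) auto
      qed
    qed simp
    then have "Z lam \<xi> $ 1 = 0" if "\<xi> < 0" for \<xi> using c[OF that] by simp
    then show False using nontrivial z2_0 by (auto simp: vec2_eq_iff)
  qed
qed

text \<open>The factor \<lambda> comes from a cancellation: over the common denominator k +
  \<lambda>, the term q k^2 contributed by Z1 cancels against the one in q k (k + \<lambda>) from
  the jump. Every remaining term contains \<lambda>.\<close>

lemma D_ZND_decaying_mode:
  assumes Z: "decaying_mode q k \<phi> s ub zb Z" and lam: "Re lam \<ge> 0"
  shows "D_ZND s ub zb Z lam = Z lam 0 $ 2 *
    ((of_real ((2 * s - up) - up) * lam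
      + (of_real ((2 * s - up) - up - q) - of_real (q * k) * Psi q k s up lam) * of_real k)
     * (lam / (of_real k + lam)))"
proof -
  have nz: "of_real k + lam \<noteq> 0" using lam k_pos by (auto simp: complex_eq_iff)
  show ?thesis
    unfolding D_ZND_eq decaying_mode_at_0(2)[OF Z lam] using nz
    by (simp add: divide_simps) (simp add: algebra_simps)
qed

end

end

theorem lemma4p1:
  fixes q k s up us um :: real and \<phi> :: "real \<Rightarrow> real"
  assumes "q > 0" and "k > 0" and "up \<ge> 0" and "s > up"
    and "2 * q * s < (s - up)\<^sup>2"
    and us: "us = 2 * s - up"
    and um: "um = s + sqrt (s\<^sup>2 - 2 * q * s + up\<^sup>2 - 2 * s * up)"
    and "\<exists>N. open N \<and> up \<in> N \<and> (\<forall>v\<in>N. \<phi> v = 0)"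
    and "\<exists>N. open N \<and> {um..us} \<subseteq> N \<and> (\<forall>v\<in>N. \<phi> v = 1)"
  shows "(\<exists>ub zb. strong_ZND_detonation q k \<phi> s um up ub zb) \<and>
    (\<forall>ub zb. strong_ZND_detonation q k \<phi> s um up ub zb \<longrightarrow>
      (\<exists>Z. decaying_mode q k \<phi> s ub zb Z) \<and>
      (\<forall>Z. decaying_mode q k \<phi> s ub zb Z \<longrightarrow>
        (\<exists>c. c analytic_on {lam. Re lam \<ge> 0} \<and>
          (\<forall>lam. Re lam \<ge> 0 \<longrightarrow> c lam \<noteq> 0 \<and>
            D_ZND s ub zb Z lam =
              c lam * ((of_real (us - up) * lam
                + (of_real (us - up - q) - of_real (q * k) * Psi q k s up lam) * of_real k)
                * (lam / (of_real k + lam)))))))"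
proof -
  interpret majda q k s up using assms by unfold_locales
  have um: "um = s + R0" unfolding um R0_def by (simp add: power2_diff algebra_simps)
  interpret majda_ignition q k s up \<phi>
    using assms(8,9) unfolding um us by unfold_locales
  show ?thesis
  proof (intro conjI allI impI)
    show "\<exists>ub zb. strong_ZND_detonation q k \<phi> s um up ub zb"
      using strong_ZND_detonation_exists unfolding um by blast
    fix ub zb assume "strong_ZND_detonation q k \<phi> s um up ub zb"
    then have det: "strong_ZND_detonation q k \<phi> s (s + R0) up ub zb" unfolding um .
    show "\<exists>Z. decaying_mode q k \<phi> s ub zb Z" using decaying_mode_Z0[OF det] by blast
    fix Z assume Z: "decaying_mode q k \<phi> s ub zb Z"
    show "\<exists>c. c analytic_on {lam. Re lam \<ge> 0} \<and>
        (\<forall>lam. Re lam \<ge> 0 \<longrightarrow> c lam \<noteq> 0 \<and>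
          D_ZND s ub zb Z lam =
            c lam * ((of_real (us - up) * lam
              + (of_real (us - up - q) - of_real (q * k) * Psi q k s up lam) * of_real k)
              * (lam / (of_real k + lam))))"
    proof (intro exI[of _ "\<lambda>lam. Z lam 0 $ 2"] conjI allI impI)
      show "(\<lambda>lam. Z lam 0 $ 2) analytic_on {lam. Re lam \<ge> 0}"
        using Z by (simp add: decaying_mode_def)
      show "Z lam 0 $ 2 \<noteq> 0" if "Re lam \<ge> 0" for lam
        by (rule decaying_mode_at_0(1)[OF det Z that])
      show "D_ZND s ub zb Z lam = Z lam 0 $ 2 * ((of_real (us - up) * lam
              + (of_real (us - up - q) - of_real (q * k) * Psi q k s up lam) * of_real k)
              * (lam / (of_real k + lam)))" if "Re lam \<ge> 0" for lam
        unfolding us by (rule D_ZND_decaying_mode[OF det Z that])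
    qed
  qed
qed

end
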